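(* Let $k\ge 13$ be an integer, $r\in(r_{core}(k),r_{sat}(k))$, and $\mathbf{\Phi}\sim\mathbf{\Phi}_k(n,rn)$. Let $\tau$ be a local rule of some fixed even radius $R\ge0$ such that, for every rooted instance whose factor graph is a tree, $\tau$ outputs the exact marginal probability that the root variable equals $1$ under a uniformly random solution of that instance. Then $$\lim_{n\to\infty}\Pr\big[\mathtt{DEC}_\tau(\mathbf{\Phi})\in\mathcal{S}(\mathbf{\Phi})\big]=0.$$
   Context: A $k$-XORSAT instance on Boolean variables $x_1,\dots,x_n$ is a set of clauses, each a $GF(2)$ equation $x_{j_1}\oplus\cdots\oplus x_{j_k}=b$; $\mathcal{S}(\Phi)\subseteq\{0,1\}^n$ is its set of satisfying assignments. $\mathbf{\Phi}\sim\mathbf{\Phi}_k(n,m)$ means each of $m$ clauses is drawn independently and uniformly among all $2\binom{n}{k}$ possibilities. The factor graph is the bipartite variable–clause incidence graph; $B_\Phi(x,R)$ is the sub-instance induced by nodes at distance $\le R$ from $x$, rooted at $x$. A local rule of radius $R$ is a map $\tau$ from such rooted instances to $[0,1]$. The $\tau$-decimation algorithm $\mathtt{DEC}_\tau$ sets $\Phi_0=\Phi$ and for $t=0,\dots,n-1$: selects an unassigned variable $x^*$ uniformly at random, sets $\sigma(x^* )=1$ with probability $\tau(B_{\Phi_t}(x^*,R))$ and $0$ otherwise, then forms $\Phi_{t+1}$ by removing $x^*$, adding $\sigma(x^* )$ to the right-hand side of each clause that contained $x^*$, and deleting clauses with no variables left; it outputs $\sigma$. $r_{core}(k)=\sup\{r\in[0,1]: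 Q>1-e^{-krQ^{k-1}}\ \forall Q\in(0,1)\}$; $r_{sat}(k)$ is the satisfiability threshold of random $k$-XORSAT (the constant, known to exist and exceed $r_{core}(k)$, such that $\mathbf{\Phi}_k(n,rn)$ is satisfiable with probability $\to1$ for $r<r_{sat}(k)$ and unsatisfiable with probability $\to1$ for $r>r_{sat}(k)$). *)

theory Defs
  imports "HOL-Probability.Probability"
begin

text \<open>
  Clauses carry labels, so that clauses that coincide, whether drawn twice or made equal by
  decimation, remain distinct nodes of the factor graph. A clause \<open>(A, b)\<close> is the equation
  \<open>\<Oplus>\<^sub>v\<^sub>\<in>\<^sub>A v = b\<close> over \<open>GF(2)\<close>; \<open>True\<close> stands for \<open>1\<close>.
\<close>

type_synonym clause = "nat set \<times> bool"

record xorsat =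
  variables :: "nat set"
  clauses :: "nat \<rightharpoonup> clause"

type_synonym rooted_xorsat = "xorsat \<times> nat"

definition wf_xorsat :: "xorsat \<Rightarrow> bool" where
  "wf_xorsat \<Phi> \<longleftrightarrow> finite (variables \<Phi>) \<and> finite (dom (clauses \<Phi>)) \<and>
     (\<forall>(A, b) \<in> ran (clauses \<Phi>). A \<noteq> {} \<and> A \<subseteq> variables \<Phi>)"

definition satisfies_clause :: "(nat \<Rightarrow> bool) \<Rightarrow> clause \<Rightarrow> bool" where
  "satisfies_clause \<sigma> = (\<lambda>(A, b). odd (card {v \<in> A. \<sigma> v}) = b)"

definition solutions :: "xorsat \<Rightarrow> (nat \<Rightarrow> bool) set" where
  "solutions \<Phi> =
     {\<sigma> \<in> variables \<Phi> \<rightarrow>\<^sub>E UNIV. \<forall>c \<in> ran (clauses \<Phi>). satisfies_clause \<sigma> c}"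

definition all_clauses :: "nat \<Rightarrow> nat \<Rightarrow> clause set" where
  "all_clauses k n = {A. A \<subseteq> {..<n} \<and> card A = k} \<times> UNIV"

definition random_xorsat :: "nat \<Rightarrow> nat \<Rightarrow> nat \<Rightarrow> xorsat pmf" where
  "random_xorsat k n m =
     map_pmf (\<lambda>C. \<lparr>variables = {..<n}, clauses = C\<rparr>)
       (Pi_pmf {..<m} None (\<lambda>_. map_pmf Some (pmf_of_set (all_clauses k n))))"

text \<open>Factor graph: \<open>Inl\<close> marks variable nodes, \<open>Inr\<close> marks clause nodes.\<close>

definition factor_nodes :: "xorsat \<Rightarrow> (nat + nat) set" where
  "factor_nodes \<Phi> = Inl ` variables \<Phi> \<union> Inr ` dom (clauses \<Phi>)"

definition factor_edges :: "xorsat \<Rightarrow> (nat + nat) rel" where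
  "factor_edges \<Phi> =
     (let E = {(Inl v, Inr a) | v a A b. v \<in> variables \<Phi> \<and> clauses \<Phi> a = Some (A, b) \<and> v \<in> A}
      in E \<union> E\<inverse>)"

definition within_distance :: "xorsat \<Rightarrow> nat \<Rightarrow> nat + nat \<Rightarrow> nat + nat \<Rightarrow> bool" where
  "within_distance \<Phi> R u w \<longleftrightarrow> (\<exists>d\<le>R. (u, w) \<in> factor_edges \<Phi> ^^ d)"

definition is_tree :: "'a set \<Rightarrow> 'a rel \<Rightarrow> bool" where
  "is_tree N E \<longleftrightarrow> N \<noteq> {} \<and> (\<forall>u\<in>N. \<forall>w\<in>N. (u, w) \<in> E\<^sup>*) \<and>
     \<not> (\<exists>p. length p \<ge> 3 \<and> distinct p \<and> set p \<subseteq> N \<and>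
           (\<forall>i<length p. (p ! i, p ! (Suc i mod length p)) \<in> E))"

definition local_ball :: "xorsat \<Rightarrow> nat \<Rightarrow> nat \<Rightarrow> rooted_xorsat" where
  "local_ball \<Phi> x R =
     (let V = {v \<in> variables \<Phi>. within_distance \<Phi> R (Inl x) (Inl v)}
      in (\<lparr>variables = V,
           clauses = (\<lambda>a. if within_distance \<Phi> R (Inl x) (Inr a)
                          then map_option (\<lambda>(A, b). (A \<inter> V, b)) (clauses \<Phi> a)
                          else None)\<rparr>, x))"

definition rooted_instances :: "nat \<Rightarrow> rooted_xorsat set" where
  "rooted_instances R = {(\<Phi>, x). wf_xorsat \<Phi> \<and> x \<in> variables \<Phi> \<and>
     (\<forall>w \<in> factor_nodes \<Phi>. within_distance \<Phi> R (Inl x) w)}"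

definition local_rule :: "nat \<Rightarrow> (rooted_xorsat \<Rightarrow> real) \<Rightarrow> bool" where
  "local_rule R \<tau> \<longleftrightarrow> (\<forall>B \<in> rooted_instances R. \<tau> B \<in> {0..1})"

text \<open>
  A tree instance is unsatisfiable if it contains contradicting unit clauses. The marginal then
  does not exist, and the rule is left unconstrained.
\<close>

definition exact_on_trees :: "nat \<Rightarrow> (rooted_xorsat \<Rightarrow> real) \<Rightarrow> bool" where
  "exact_on_trees R \<tau> \<longleftrightarrow>
     (\<forall>(\<Phi>, x) \<in> rooted_instances R.
        is_tree (factor_nodes \<Phi>) (factor_edges \<Phi>) \<and> solutions \<Phi> \<noteq> {} \<longrightarrow>
        \<tau> (\<Phi>, x) = measure_pmf.prob (pmf_of_set (solutions \<Phi>)) {\<sigma>. \<sigma> x})"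

definition assign_clause :: "nat \<Rightarrow> bool \<Rightarrow> clause \<Rightarrow> clause option" where
  "assign_clause x s = (\<lambda>(A, b).
     if A - {x} = {} then None
     else Some (A - {x}, if x \<in> A then b \<noteq> s else b))"

definition assign_variable :: "xorsat \<Rightarrow> nat \<Rightarrow> bool \<Rightarrow> xorsat" where
  "assign_variable \<Phi> x s =
     \<lparr>variables = variables \<Phi> - {x},
      clauses = (\<lambda>a. Option.bind (clauses \<Phi> a) (assign_clause x s))\<rparr>"

primrec decimate ::
  "(rooted_xorsat \<Rightarrow> real) \<Rightarrow> nat \<Rightarrow> nat \<Rightarrow> xorsat \<Rightarrow> (nat \<Rightarrow> bool) \<Rightarrow> (nat \<Rightarrow> bool) pmf"
where
  "decimate \<tau> R 0 \<Phi> \<sigma> = return_pmf \<sigma>"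
| "decimate \<tau> R (Suc t) \<Phi> \<sigma> = do {
     x \<leftarrow> pmf_of_set (variables \<Phi>);
     s \<leftarrow> bernoulli_pmf (\<tau> (local_ball \<Phi> x R));
     decimate \<tau> R t (assign_variable \<Phi> x s) (\<sigma>(x := s))
   }"

text \<open>Starting from the constant \<open>undefined\<close> makes the output extensional, as in \<open>solutions\<close>.\<close>

definition DEC :: "(rooted_xorsat \<Rightarrow> real) \<Rightarrow> nat \<Rightarrow> xorsat \<Rightarrow> (nat \<Rightarrow> bool) pmf" where
  "DEC \<tau> R \<Phi> = decimate \<tau> R (card (variables \<Phi>)) \<Phi> (\<lambda>_. undefined)"

definition r_core :: "nat \<Rightarrow> real" where
  "r_core k = Sup {r \<in> {0..1}. \<forall>Q \<in> {0<..<1}. Q > 1 - exp (- (real k * r * Q ^ (k - 1)))}"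

definition is_r_sat :: "nat \<Rightarrow> real \<Rightarrow> bool" where
  "is_r_sat k s \<longleftrightarrow>
     (\<forall>r\<ge>0. r < s \<longrightarrow>
        (\<lambda>n. measure_pmf.prob (random_xorsat k n (nat \<lfloor>r * real n\<rfloor>)) {\<Phi>. solutions \<Phi> \<noteq> {}})
          \<longlonglongrightarrow> 1) \<and>
     (\<forall>r\<ge>0. r > s \<longrightarrow>
        (\<lambda>n. measure_pmf.prob (random_xorsat k n (nat \<lfloor>r * real n\<rfloor>)) {\<Phi>. solutions \<Phi> = {}})
          \<longlonglongrightarrow> 1)"

end

theory Submission
  imports Defs
begin

text \<open>
  Entropy argument. The expected number of solutions is \<open>2 ^ (n - m)\<close>, and along a path of the
  algorithm that ends in a solution every step with marginal \<open>1/2\<close> costs a factor \<open>1/2\<close>. Hence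
  the algorithm fails as soon as, for some \<open>T\<close>, fewer than \<open>m - (n - T)\<close> of the first \<open>T\<close> steps
  are not of this kind, with a linear margin.

  Fix the order in which variables are chosen; the clauses stay random. A step at \<open>x\<close> has marginal
  \<open>1/2\<close> unless a short cycle lies near \<open>x\<close> (in expectation only \<open>O(1)\<close> many \<open>x\<close>), or unit clause
  propagation from the variables assigned so far reaches \<open>x\<close>: on a tree, if it does not, one can
  flip \<open>x\<close> together with one further variable of each clause that is met. Steps of the second kind
  are charged injectively to clauses lying inside the propagation closure of the first \<open>T\<close>
  variables.

  To bound that number of clauses, process the known variables one at a time and count the clauses
  with at most one unprocessed variable. After \<open>y n\<close> variables this count is distributed as if the
  processed set were fixed in advance, so it is about \<open>r n \<phi>(y)\<close> with
  \<open>\<phi>(y) = y ^ k + k y ^ (k - 1) (1 - y)\<close>. If \<open>2 r \<phi>(y) + (1 - y) < r\<close>, some \<open>T\<close> makes it smaller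
  than both \<open>y n - T\<close>, so that propagation stops before \<open>y n\<close> variables, and \<open>m - (n - T)\<close>. Such
  a \<open>y\<close> exists when \<open>k r \<ge> 4.87\<close>, and \<open>k r_core(k) \<ge> 4.87\<close> for \<open>k \<ge> 13\<close>.
\<close>

section \<open>Exposing clauses along unit clause propagation\<close>

text \<open>Whether a step counts as free is decided by the order and the variable sets of the
  clauses alone, never by right-hand sides or coin flips. This is why a frozen order suffices
  although the ball seen by the rule changes with each assignment. Right-hand sides enter only
  through the expected number of solutions; bad variable sets are discarded at the price of their
  probability, so no independence between them and the number of solutions is required.

  The obstacle is that propagation reads the clauses in an order that depends on them, over linearly
  many steps. The process is not followed in time. Instead the generating function of the number of
  counted clauses is computed exactly, and it turns out to be the same for every starting set.

  The inequality for \<open>y\<close> is the condition that two requirements on \<open>T\<close> are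
  compatible. Let \<open>T = \<theta> n\<close> and \<open>g = r \<phi>(y)\<close>. Stopping before
  \<open>y n\<close> variables needs \<open>\<theta> + g < y\<close>; beating the entropy
  \<open>n - m\<close> needs \<open>\<theta> - g > 1 - r\<close>. The interval for
  \<open>\<theta>\<close> is nonempty exactly if \<open>2 g + (1 - y) < r\<close>.\<close>

text \<open>Known variables \<open>Q\<close> are processed one at a time. A clause is counted, and its last variable
  becomes known, once a single one of its variables is left unprocessed. If \<open>Q\<close> runs empty, an
  arbitrary variable is processed, so that the number of processed variables is always \<open>i\<close>.\<close>

primrec explore :: "nat \<Rightarrow> nat set \<Rightarrow> nat set \<Rightarrow> nat set \<Rightarrow> (nat \<Rightarrow> nat set) \<Rightarrow> nat" where
  "explore 0 V Q J C = 0"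
| "explore (Suc i) V Q J C =
    (let w = (if Q = {} then Min V else Min Q);
         C' = (\<lambda>a. C a - {w});
         U = {a \<in> J. card (C' a) = 1}
     in card U + explore i (V - {w}) (Q - {w} \<union> (\<Union>a\<in>U. C' a)) (J - U) C')"

definition closed_under :: "nat set \<Rightarrow> (nat \<Rightarrow> nat set) \<Rightarrow> nat set \<Rightarrow> bool" where
  "closed_under J C K \<longleftrightarrow> (\<forall>a\<in>J. \<forall>v\<in>C a. C a - {v} \<subseteq> K \<longrightarrow> v \<in> K)"

lemma explore_cong:
  assumes "\<And>a. a \<in> J \<Longrightarrow> C a = D a"
  shows "explore i V Q J C = explore i V Q J D"
  using assms
proof (induction i arbitrary: V Q J C D)
  case (Suc i)
  define w where "w = (if Q = {} then Min V else Min Q)"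
  have U: "{a \<in> J. card (C a - {w}) = 1} = {a \<in> J. card (D a - {w}) = 1}" (is "?U = ?U'")
    using Suc.prems by auto
  have Q: "(\<Union>a\<in>?U. C a - {w}) = (\<Union>a\<in>?U. D a - {w})"
    using Suc.prems by auto
  have "explore i (V - {w}) (Q - {w} \<union> (\<Union>a\<in>?U. C a - {w})) (J - ?U) (\<lambda>a. C a - {w})
      = explore i (V - {w}) (Q - {w} \<union> (\<Union>a\<in>?U. C a - {w})) (J - ?U) (\<lambda>a. D a - {w})"
    by (rule Suc.IH) (use Suc.prems in auto)
  then show ?case
    unfolding explore.simps Let_def w_def[symmetric] using U Q by simp
qed simp

text \<open>Each step takes one variable out of \<open>Q\<close> and adds at most one per counted
  clause, so under the size hypothesis \<open>Q\<close> runs empty before step \<open>i\<close>.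
  \<open>K\<close> is the set of variables processed by then: clauses inside it have all been
  counted, and none has exactly one variable outside it.\<close>

lemma explore_stops_closed:
  assumes "finite J" "finite Q" "\<And>a. a \<in> J \<Longrightarrow> card (C a) \<ge> 2"
    and "card Q + explore i V Q J C < i"
  shows "\<exists>K. Q \<subseteq> K \<and> closed_under J C K \<and> card {a \<in> J. C a \<subseteq> K} \<le> explore i V Q J C"
  using assms
proof (induction i arbitrary: V Q J C)
  case (Suc i)
  show ?case
  proof (cases "Q = {}")
    case True
    \<comment> \<open>With nothing known, \<open>K = {}\<close> is closed because no clause has
      fewer than two variables.\<close>
    have "\<not> C a - {v} \<subseteq> {}" if "a \<in> J" for a v
    proof
      assume "C a - {v} \<subseteq> {}"
      then have "card (C a) \<le> card {v}" by (intro card_mono) auto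
      then show False using Suc.prems(3)[OF that] by simp
    qed
    then have "closed_under J C {}" by (auto simp: closed_under_def)
    moreover have none: "{a \<in> J. C a \<subseteq> {}} = {}" using Suc.prems(3) by fastforce
    have "card {a \<in> J. C a \<subseteq> {}} \<le> explore (Suc i) V Q J C" unfolding none by simp
    ultimately show ?thesis using True by blast
  next
    case False
    define w where "w = Min Q"
    have w: "w \<in> Q" unfolding w_def using False Suc.prems(2) by simp
    define C' where "C' = (\<lambda>a. C a - {w})"
    define U where "U = {a \<in> J. card (C' a) = 1}"
    define Q' where "Q' = Q - {w} \<union> (\<Union>a\<in>U. C' a)"
    have ex: "explore (Suc i) V Q J C = card U + explore i (V - {w}) Q' (J - U) C'"
      using False unfolding U_def C'_def Q'_def w_def by (simp add: Let_def)
    have finU: "finite U" "U \<subseteq> J" using Suc.prems(1) by (auto simp: U_def)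
    have finC: "finite (C' a)" if "a \<in> U" for a
      using that by (auto simp: U_def intro: card_ge_0_finite)
    have "card (\<Union>a\<in>U. C' a) \<le> (\<Sum>a\<in>U. card (C' a))"
      by (rule card_UN_le) (rule finU)
    also have "\<dots> = card U" by (simp add: U_def)
    finally have "card Q' \<le> card (Q - {w}) + card U"
      unfolding Q'_def by (meson card_Un_le add_left_mono order_trans)
    moreover have "Suc (card (Q - {w})) = card Q"
      using w Suc.prems(2) by (metis card_Suc_Diff1)
    ultimately have lt: "card Q' + explore i (V - {w}) Q' (J - U) C' < i"
      using Suc.prems(4) unfolding ex by linarith
    have fQ: "finite Q'" unfolding Q'_def using Suc.prems(2) finU finC by auto
    have sz: "card (C' a) \<ge> 2" if "a \<in> J - U" for a
    proof -
      have "card (C a) \<ge> 2" using that Suc.prems(3) by blast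
      then have "card (C' a) \<ge> 1" unfolding C'_def
        by (auto simp: card_Diff_singleton_if)
      moreover have "card (C' a) \<noteq> 1" using that by (auto simp: U_def)
      ultimately show ?thesis by linarith
    qed
    obtain K where K: "Q' \<subseteq> K" "closed_under (J - U) C' K"
        "card {a \<in> J - U. C' a \<subseteq> K} \<le> explore i (V - {w}) Q' (J - U) C'"
      using Suc.IH[OF _ fQ sz lt] Suc.prems(1) by blast
    have U_in: "C' a \<subseteq> K" if "a \<in> U" for a
      using that K(1) by (auto simp: Q'_def)
    have "closed_under J C (insert w K)"
      unfolding closed_under_def
    proof (intro ballI impI)
      fix a v assume a: "a \<in> J" "v \<in> C a" "C a - {v} \<subseteq> insert w K"
      show "v \<in> insert w K"
      proof (cases "a \<in> U \<or> v = w")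
        case True then show ?thesis using U_in a by (auto simp: C'_def)
      next
        case False
        then have "v \<in> C' a" "C' a - {v} \<subseteq> K" using a by (auto simp: C'_def)
        then show ?thesis using K(2) False a by (auto simp: closed_under_def)
      qed
    qed
    moreover have "card {a \<in> J. C a \<subseteq> insert w K} \<le> card (U \<union> {a \<in> J - U. C' a \<subseteq> K})"
      using Suc.prems(1) finU by (intro card_mono) (auto simp: C'_def)
    then have "card {a \<in> J. C a \<subseteq> insert w K} \<le> explore (Suc i) V Q J C"
      using K(3) card_Un_le[of U "{a \<in> J - U. C' a \<subseteq> K}"] unfolding ex by linarith
    moreover have "Q \<subseteq> insert w K" using K(1) by (auto simp: Q'_def)
    ultimately show ?thesis by blast
  qed
qed simp

lemma sum_PiE_split:
  assumes "finite J" "U \<subseteq> J"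
  shows "(\<Sum>C\<in>PiE J F. g C) =
    (\<Sum>C1\<in>PiE U F. \<Sum>C2\<in>PiE (J - U) F. g (\<lambda>a. if a \<in> U then C1 a else C2 a))"
proof -
  have "(\<Sum>(C1, C2)\<in>PiE U F \<times> PiE (J - U) F. g (\<lambda>a. if a \<in> U then C1 a else C2 a))
      = (\<Sum>C\<in>PiE J F. g C)"
  proof (rule sum.reindex_bij_witness[where
        i = "\<lambda>C. (restrict C U, restrict C (J - U))" and
        j = "\<lambda>(C1, C2) a. if a \<in> U then C1 a else C2 a"], goal_cases)
    case (1 a)
    then show ?case using assms(2)
      by (auto simp: PiE_iff extensional_def restrict_def fun_eq_iff split: prod.splits if_splits)
  next
    case (2 a)
    then show ?case using assms(2)
      by (auto simp: PiE_iff extensional_def split: if_splits)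
  next
    case (3 b)
    then show ?case using assms(2)
      by (auto simp: PiE_iff extensional_def restrict_def fun_eq_iff)
  next
    case (4 b)
    then show ?case using assms(2)
      by (auto simp: PiE_iff)
  next
    case (5 b)
    then show ?case by (simp add: case_prod_unfold)
  qed
  then show ?thesis by (simp add: sum.cartesian_product)
qed

text \<open>Distributivity: \<open>H\<close> collects the indices where the option \<open>X\<close>
  is taken. In the application \<open>X\<close> holds the sets that contain the variable being
  processed.\<close>

lemma sum_PiE_Un:
  assumes "finite J" "\<And>a. a \<in> J \<Longrightarrow> finite (X a)" "\<And>a. a \<in> J \<Longrightarrow> finite (Y a)"
    and "\<And>a. a \<in> J \<Longrightarrow> X a \<inter> Y a = {}"
  shows "(\<Sum>C\<in>PiE J (\<lambda>a. X a \<union> Y a). g C) =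
    (\<Sum>H\<in>Pow J. \<Sum>C\<in>PiE J (\<lambda>a. if a \<in> H then X a else Y a). g C)"
proof -
  have eq: "PiE J (\<lambda>a. X a \<union> Y a) = (\<Union>H\<in>Pow J. PiE J (\<lambda>a. if a \<in> H then X a else Y a))"
    (is "?L = ?R")
  proof
    show "?L \<subseteq> ?R"
    proof
      fix C assume C: "C \<in> ?L"
      define H where "H = {a \<in> J. C a \<in> X a}"
      have "C a \<in> (if a \<in> H then X a else Y a)" if "a \<in> J" for a
        using PiE_mem[OF C that] that by (auto simp: H_def)
      then have "C \<in> PiE J (\<lambda>a. if a \<in> H then X a else Y a)"
        using C by (simp add: PiE_iff)
      moreover have "H \<in> Pow J" by (auto simp: H_def)
      ultimately show "C \<in> ?R" by (rule UN_I[rotated])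
    qed
    show "?R \<subseteq> ?L" by (intro UN_least PiE_mono) auto
  qed
  show ?thesis unfolding eq
  proof (rule sum.UNION_disjoint)
    show "finite (Pow J)" using assms by simp
    show "\<forall>H\<in>Pow J. finite (PiE J (\<lambda>a. if a \<in> H then X a else Y a))"
      using assms by (auto intro!: finite_PiE)
    show "\<forall>H\<in>Pow J. \<forall>H'\<in>Pow J. H \<noteq> H' \<longrightarrow>
      PiE J (\<lambda>a. if a \<in> H then X a else Y a) \<inter> PiE J (\<lambda>a. if a \<in> H' then X a else Y a) = {}"
    proof (intro ballI impI equals0I)
      fix H H' C assume *: "H \<in> Pow J" "H' \<in> Pow J" "H \<noteq> H'"
        "C \<in> PiE J (\<lambda>a. if a \<in> H then X a else Y a) \<inter> PiE J (\<lambda>a. if a \<in> H' then X a else Y a)"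
      obtain a where "a \<in> J" "(a \<in> H) \<noteq> (a \<in> H')" using * by auto
      moreover from this have "C a \<in> (if a \<in> H then X a else Y a)" "C a \<in> (if a \<in> H' then X a else Y a)"
        using *(4) by (blast dest: PiE_mem)+
      ultimately show False using assms(4)[of a] by (auto split: if_splits)
    qed
  qed
qed

definition subsets_of_card :: "nat set \<Rightarrow> nat \<Rightarrow> nat set set" where
  "subsets_of_card V s = {A. A \<subseteq> V \<and> card A = s}"

lemma finite_subsets_of_card: "finite V \<Longrightarrow> finite (subsets_of_card V s)"
  by (simp add: subsets_of_card_def)

lemma card_subsets_of_card: "finite V \<Longrightarrow> card (subsets_of_card V s) = card V choose s"
  by (simp add: subsets_of_card_def n_subsets)

text \<open>The sum of \<open>\<rho>\<close> to the indicator of meeting a fixed \<open>i\<close>-set in at least \<open>s - 1\<close>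
  elements, over all \<open>s\<close>-subsets of a \<open>v\<close>-set.\<close>

definition clause_weight :: "real \<Rightarrow> nat \<Rightarrow> nat \<Rightarrow> nat \<Rightarrow> real" where
  "clause_weight \<rho> v i s =
     real (v choose s) + (\<rho> - 1) * (real (i choose s) + real (i choose (s - 1)) * (real v - real i))"

lemma clause_weight_0: "2 \<le> s \<Longrightarrow> clause_weight \<rho> v 0 s = real (v choose s)"
  by (cases s; cases "s - 1") (auto simp: clause_weight_def)

text \<open>Pascal's rule, split by whether the set contains the processed variable. A pair that
  contains it is completed at once: it earns \<open>\<rho>\<close>, and its other element is one of
  \<open>v - 1\<close>.\<close>

lemma clause_weight_Suc:
  assumes "2 \<le> s" "0 < v"
  shows "clause_weight \<rho> v (Suc i) s =
    (if s = 2 then \<rho> * real (v - 1) else clause_weight \<rho> (v - 1) i (s - 1))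
     + clause_weight \<rho> (v - 1) i s"
proof -
  obtain u where u: "v = Suc u" using assms(2) not0_implies_Suc by blast
  obtain t where t: "s = Suc (Suc t)" using assms(1) by (metis add_2_eq_Suc le_Suc_ex)
  show ?thesis
  proof (cases t)
    case 0
    then show ?thesis unfolding u t clause_weight_def
      by (simp add: numeral_2_eq_2 algebra_simps)
  next
    case (Suc t')
    then show ?thesis unfolding u t clause_weight_def
      by (simp add: algebra_simps)
  qed
qed

text \<open>A clause is revealed only through its intersection with the processed variables, so the order
  may depend on the revealed part: the right-hand side is the value for a processed set that is
  fixed in advance.\<close>

lemma sum_power_explore:
  fixes \<rho> :: real
  assumes "finite V" "i \<le> card V" "Q \<subseteq> V" "finite J" "\<And>a. a \<in> J \<Longrightarrow> 2 \<le> s a"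
  shows "(\<Sum>C\<in>PiE J (\<lambda>a. subsets_of_card V (s a)). \<rho> ^ explore i V Q J C)
    = (\<Prod>a\<in>J. clause_weight \<rho> (card V) i (s a))"
  using assms
proof (induction i arbitrary: V Q J s)
  case 0
  then show ?case
    by (simp add: card_PiE card_subsets_of_card clause_weight_0)
next
  case (Suc i)
  define w where "w = (if Q = {} then Min V else Min Q)"
  have Vne: "V \<noteq> {}" using Suc.prems(2) by auto
  have w: "w \<in> V"
    using Suc.prems(1,3) Vne finite_subset[OF Suc.prems(3)] by (auto simp: w_def subset_iff)
  define V' where "V' = V - {w}"
  have V': "finite V'" "card V' = card V - 1" "i \<le> card V'" "V = insert w V'" "w \<notin> V'"
    using Suc.prems(1,2) w by (auto simp: V'_def)
  define X where "X = (\<lambda>a. {A \<in> subsets_of_card V (s a). w \<in> A})"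
  define Y where "Y = (\<lambda>a. {A \<in> subsets_of_card V (s a). w \<notin> A})"
  define hit where "hit = (\<lambda>a. if s a = 2 then \<rho> * real (card V - 1)
                                 else clause_weight \<rho> (card V - 1) i (s a - 1))"
  define miss where "miss = (\<lambda>a. clause_weight \<rho> (card V - 1) i (s a))"
  \<comment> \<open>\<open>H\<close> is the set of clauses that contain \<open>w\<close>. Given
    \<open>H\<close>, deleting \<open>w\<close> is a bijection onto families of subsets of
    \<open>V'\<close>, and the clauses counted now are those in \<open>H\<close> of size
    two.\<close>
  have inner: "(\<Sum>C\<in>PiE J (\<lambda>a. if a \<in> H then X a else Y a). \<rho> ^ explore (Suc i) V Q J C)
      = (\<Prod>a\<in>H. hit a) * (\<Prod>a\<in>J - H. miss a)" if H: "H \<subseteq> J" for H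
  proof -
    define s' where "s' = (\<lambda>a. if a \<in> H then s a - 1 else s a)"
    define U where "U = {a \<in> H. s a = 2}"
    have UJ: "U \<subseteq> J" "finite U" using H Suc.prems(4) finite_subset[OF H]
      by (auto simp: U_def)
    define F where "F = (\<lambda>a. subsets_of_card V' (s' a))"
    define g where "g = (\<lambda>C. \<rho> ^ (card U +
        explore i V' (Q - {w} \<union> (\<Union>a\<in>U. C a)) (J - U) C))"
    have "(\<Sum>C\<in>PiE J (\<lambda>a. if a \<in> H then X a else Y a). \<rho> ^ explore (Suc i) V Q J C)
        = (\<Sum>C\<in>PiE J F. g C)"
    proof (rule sum.reindex_bij_witness[where
          j = "\<lambda>C. restrict (\<lambda>a. C a - {w}) J" and
          i = "\<lambda>C. restrict (\<lambda>a. if a \<in> H then insert w (C a) else C a) J"], goal_cases)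
      case (1 C)
      have "w \<in> C a \<longleftrightarrow> a \<in> H" if "a \<in> J" for a
        using 1 that by (auto simp: PiE_iff X_def Y_def split: if_splits)
      then show ?case using 1
        by (intro ext) (simp add: PiE_iff extensional_def restrict_def insert_absorb)
    next
      case (2 C)
      have "C a - {w} \<in> F a" if "a \<in> J" for a
      proof -
        have "C a \<in> (if a \<in> H then X a else Y a)" using 2 that by (auto simp: PiE_iff)
        then show ?thesis
          using finite_subset[OF _ Suc.prems(1)]
          by (auto simp: X_def Y_def F_def s'_def subsets_of_card_def V'_def split: if_splits)
      qed
      then show ?case by auto
    next
      case (3 C)
      have "(if a \<in> H then insert w (C a) else C a) - {w} = C a" if "a \<in> J" for a
      proof -
        have "w \<notin> C a" using 3 that V'(5) by (auto simp: PiE_iff F_def subsets_of_card_def)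
        then show ?thesis by auto
      qed
      then show ?case using 3 by (intro ext) (simp add: PiE_iff extensional_def restrict_def)
    next
      case (4 C)
      have "(if a \<in> H then insert w (C a) else C a) \<in> (if a \<in> H then X a else Y a)"
        if "a \<in> J" for a
      proof -
        have C: "C a \<subseteq> V'" "card (C a) = s' a" using 4 that
          by (auto simp: PiE_iff F_def subsets_of_card_def)
        moreover have "w \<notin> C a" "finite (C a)" using C(1) V'(1,5) finite_subset by auto
        ultimately show ?thesis using Suc.prems(5)[OF that] w
          by (auto simp: X_def Y_def s'_def subsets_of_card_def V'_def)
      qed
      then show ?case by auto
    next
      case (5 C)
      have fin: "finite (C a)" "2 \<le> card (C a)" "card (C a) = s a" "w \<in> C a \<longleftrightarrow> a \<in> H" if "a \<in> J" for a
      proof -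
        have "C a \<in> (if a \<in> H then X a else Y a)" using 5 that by (auto simp: PiE_iff)
        then show "finite (C a)" "2 \<le> card (C a)" "card (C a) = s a" "w \<in> C a \<longleftrightarrow> a \<in> H"
          using finite_subset[OF _ Suc.prems(1)] Suc.prems(5)[OF that]
          by (auto simp: X_def Y_def subsets_of_card_def split: if_splits)
      qed
      have Ueq: "{a \<in> J. card (C a - {w}) = 1} = U"
        using fin H by (auto simp: U_def card_Diff_singleton_if; fastforce)
      let ?C = "restrict (\<lambda>a. C a - {w}) J"
      have un: "(\<Union>a\<in>U. C a - {w}) = (\<Union>a\<in>U. ?C a)" using UJ by auto
      have "explore i V' q (J - U) (\<lambda>a. C a - {w}) = explore i V' q (J - U) ?C" for q
        by (rule explore_cong) auto
      then show ?case
        unfolding g_def explore.simps Let_def w_def[symmetric] Ueq V'_def un by simp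
    qed
    also have "\<dots> = (\<Sum>C1\<in>PiE U F. \<Sum>C2\<in>PiE (J - U) F. g (\<lambda>a. if a \<in> U then C1 a else C2 a))"
      by (rule sum_PiE_split) (use Suc.prems(4) UJ in auto)
    \<comment> \<open>The last variables \<open>C1\<close> of completed clauses only enter the
      queue, and the induction hypothesis gives the same value for every queue. This is where the
      adaptive order drops out.\<close>
    also have "\<dots> = (\<Sum>C1\<in>PiE U F. \<rho> ^ card U * (\<Prod>a\<in>J - U. clause_weight \<rho> (card V') i (s' a)))"
    proof (rule sum.cong[OF refl])
      fix C1 assume C1: "C1 \<in> PiE U F"
      have "(\<Union>a\<in>U. C1 a) \<subseteq> V'" using C1 by (fastforce simp: PiE_iff F_def subsets_of_card_def)
      then have Q': "Q - {w} \<union> (\<Union>a\<in>U. C1 a) \<subseteq> V'" using Suc.prems(3) by (auto simp: V'_def)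
      have sz: "2 \<le> s' a" if "a \<in> J - U" for a
        using Suc.prems(5)[of a] that by (auto simp: s'_def U_def)
      have "(\<Sum>C2\<in>PiE (J - U) F. g (\<lambda>a. if a \<in> U then C1 a else C2 a)) =
        (\<Sum>C2\<in>PiE (J - U) F. \<rho> ^ card U * \<rho> ^ explore i V' (Q - {w} \<union> (\<Union>a\<in>U. C1 a)) (J - U) C2)"
      proof (rule sum.cong[OF refl])
        fix C2
        have "explore i V' q (J - U) (\<lambda>a. if a \<in> U then C1 a else C2 a)
            = explore i V' q (J - U) C2" for q
          by (rule explore_cong) auto
        then show "g (\<lambda>a. if a \<in> U then C1 a else C2 a) =
           \<rho> ^ card U * \<rho> ^ explore i V' (Q - {w} \<union> (\<Union>a\<in>U. C1 a)) (J - U) C2"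
          by (simp add: g_def power_add)
      qed
      also have "\<dots> = \<rho> ^ card U * (\<Prod>a\<in>J - U. clause_weight \<rho> (card V') i (s' a))"
        unfolding sum_distrib_left[symmetric] F_def
        by (subst Suc.IH[OF V'(1,3) Q' _ sz]) (use Suc.prems(4) in auto)
      finally show "(\<Sum>C2\<in>PiE (J - U) F. g (\<lambda>a. if a \<in> U then C1 a else C2 a)) =
        \<rho> ^ card U * (\<Prod>a\<in>J - U. clause_weight \<rho> (card V') i (s' a))" .
    qed
    also have "\<dots> = (\<Prod>a\<in>U. real (card V - 1)) * (\<rho> ^ card U *
        (\<Prod>a\<in>J - U. clause_weight \<rho> (card V') i (s' a)))"
      using UJ(2) V'(1,2)
      by (simp add: card_PiE F_def card_subsets_of_card s'_def U_def)
    also have "\<dots> = (\<Prod>a\<in>U. hit a) * (\<Prod>a\<in>J - U. clause_weight \<rho> (card V') i (s' a))"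
    proof -
      have "(\<Prod>a\<in>U. hit a) = (\<Prod>a\<in>U. \<rho> * real (card V - 1))"
        by (rule prod.cong) (auto simp: hit_def U_def)
      then show ?thesis by (simp add: power_mult_distrib)
    qed
    also have "J - U = (H - U) \<union> (J - H)" using H by (auto simp: U_def)
    also have "(\<Prod>a\<in>(H - U) \<union> (J - H). clause_weight \<rho> (card V') i (s' a)) =
        (\<Prod>a\<in>H - U. hit a) * (\<Prod>a\<in>J - H. miss a)"
    proof -
      have "(\<Prod>a\<in>H - U. clause_weight \<rho> (card V') i (s' a)) = (\<Prod>a\<in>H - U. hit a)"
        by (rule prod.cong) (auto simp: hit_def U_def s'_def V'(2))
      moreover have "(\<Prod>a\<in>J - H. clause_weight \<rho> (card V') i (s' a)) = (\<Prod>a\<in>J - H. miss a)"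
        by (rule prod.cong) (auto simp: miss_def s'_def V'(2))
      ultimately show ?thesis
        using Suc.prems(4) finite_subset[OF H]
        by (subst prod.union_disjoint) auto
    qed
    also have "(\<Prod>a\<in>U. hit a) * ((\<Prod>a\<in>H - U. hit a) * (\<Prod>a\<in>J - H. miss a))
        = (\<Prod>a\<in>H. hit a) * (\<Prod>a\<in>J - H. miss a)"
    proof -
      have "U \<subseteq> H" by (auto simp: U_def)
      then show ?thesis
        using prod.subset_diff[of U H hit] finite_subset[OF H Suc.prems(4)] by (simp add: mult_ac)
    qed
    finally show ?thesis .
  qed
  have "(\<Sum>C\<in>PiE J (\<lambda>a. subsets_of_card V (s a)). \<rho> ^ explore (Suc i) V Q J C)
      = (\<Sum>C\<in>PiE J (\<lambda>a. X a \<union> Y a). \<rho> ^ explore (Suc i) V Q J C)"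
    by (rule sum.cong[OF PiE_cong refl]) (auto simp: X_def Y_def)
  also have "\<dots> = (\<Sum>H\<in>Pow J. (\<Prod>a\<in>H. hit a) * (\<Prod>a\<in>J - H. miss a))"
    using Suc.prems(1,4) inner
    by (subst sum_PiE_Un) (auto simp: X_def Y_def finite_subsets_of_card simp del: explore.simps)
  \<comment> \<open>Summing over \<open>H\<close> multiplies out this product, so the clauses
    separate again.\<close>
  also have "\<dots> = (\<Prod>a\<in>J. hit a + miss a)"
    using Suc.prems(4) by (simp add: prod_add)
  also have "\<dots> = (\<Prod>a\<in>J. clause_weight \<rho> (card V) (Suc i) (s a))"
  proof (rule prod.cong[OF refl])
    fix a assume "a \<in> J"
    moreover have "0 < card V" using Suc.prems(2) by simp
    ultimately show "hit a + miss a = clause_weight \<rho> (card V) (Suc i) (s a)"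
      using clause_weight_Suc[of "s a" "card V" \<rho> i] Suc.prems(5) by (simp add: hit_def miss_def)
  qed
  finally show ?case .
qed

section \<open>Propagation closure and the charging of forced steps to clauses\<close>

definition ucp_closure :: "nat set \<Rightarrow> (nat \<Rightarrow> nat set) \<Rightarrow> nat set \<Rightarrow> nat set" where
  "ucp_closure J C X = \<Inter>{K. X \<subseteq> K \<and> closed_under J C K}"

lemma subset_ucp_closure: "X \<subseteq> ucp_closure J C X"
  by (auto simp: ucp_closure_def)

lemma ucp_closure_least: "X \<subseteq> K \<Longrightarrow> closed_under J C K \<Longrightarrow> ucp_closure J C X \<subseteq> K"
  by (auto simp: ucp_closure_def)

lemma closed_under_ucp_closure: "closed_under J C (ucp_closure J C X)"
  unfolding closed_under_def
proof (intro ballI impI)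
  fix a v assume *: "a \<in> J" "v \<in> C a" "C a - {v} \<subseteq> ucp_closure J C X"
  have "v \<in> K" if "X \<subseteq> K" "closed_under J C K" for K
    using * that ucp_closure_least[OF that] unfolding closed_under_def by blast
  then show "v \<in> ucp_closure J C X" by (auto simp: ucp_closure_def)
qed

lemma ucp_closure_insert:
  "ucp_closure J C (insert x (ucp_closure J C X)) = ucp_closure J C (insert x X)"
proof (rule antisym)
  note sub = subset_ucp_closure[of X J C] subset_ucp_closure[of "insert x X" J C]
    subset_ucp_closure[of "insert x (ucp_closure J C X)" J C]
  have "ucp_closure J C X \<subseteq> ucp_closure J C (insert x X)"
    by (rule ucp_closure_least[OF _ closed_under_ucp_closure]) (use sub in auto)
  then show "ucp_closure J C (insert x (ucp_closure J C X)) \<subseteq> ucp_closure J C (insert x X)"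
    by (intro ucp_closure_least[OF _ closed_under_ucp_closure]) (use sub in auto)
  show "ucp_closure J C (insert x X) \<subseteq> ucp_closure J C (insert x (ucp_closure J C X))"
    by (rule ucp_closure_least[OF _ closed_under_ucp_closure]) (use sub in auto)
qed

lemma ucp_closure_closed: "closed_under J C K \<Longrightarrow> ucp_closure J C K = K"
  by (intro antisym ucp_closure_least subset_ucp_closure) auto

lemma ucp_closure_in_univ: "ucp_closure J C X \<subseteq> X \<union> (\<Union>a\<in>J. C a)"
  by (rule ucp_closure_least) (auto simp: closed_under_def)

text \<open>Adding the elements of the closure one at a time, each new one completes a clause.\<close>

lemma card_ucp_closure_le:
  assumes "finite J" "finite S" "\<And>a. a \<in> J \<Longrightarrow> finite (C a)"
  shows "card (ucp_closure J C S) \<le>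
    card S + card {a \<in> J. C a \<subseteq> ucp_closure J C S \<and> \<not> C a \<subseteq> S}"
proof -
  define cl where "cl = ucp_closure J C S"
  have fin: "finite cl" unfolding cl_def
    by (rule finite_subset[OF ucp_closure_in_univ]) (use assms in auto)
  have "card (cl - S) \<le> card {a \<in> J. C a \<subseteq> cl \<and> \<not> C a \<subseteq> S}"
    if "S \<subseteq> M" "M \<subseteq> cl" "card (M - S) \<le> card {a \<in> J. C a \<subseteq> M \<and> \<not> C a \<subseteq> S}" for M
    using that
  proof (induction "card (cl - M)" arbitrary: M rule: less_induct)
    case less
    show ?case
    proof (cases "closed_under J C M")
      case True
      then have "M = cl" using ucp_closure_least[of S M] less.prems unfolding cl_def by auto
      then show ?thesis using less.prems by simp
    next
      case False
      then obtain a v where av: "a \<in> J" "v \<in> C a" "C a - {v} \<subseteq> M" "v \<notin> M"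
        unfolding closed_under_def by blast
      have "v \<in> cl" using closed_under_ucp_closure[of J C S] av less.prems(2)
        unfolding closed_under_def cl_def by blast
      have "card (cl - insert v M) < card (cl - M)"
        by (rule psubset_card_mono) (use fin \<open>v \<in> cl\<close> av in auto)
      moreover have "card (insert v M - S) \<le> card {a \<in> J. C a \<subseteq> insert v M \<and> \<not> C a \<subseteq> S}"
      proof -
        have "v \<notin> S" using av less.prems(1) by auto
        then have "card (insert v M - S) \<le> Suc (card (M - S))"
          by (simp add: insert_Diff_if card_insert_le_m1 card_insert_if finite_subset[OF less.prems(2) fin])
        also have "\<dots> \<le> Suc (card {a \<in> J. C a \<subseteq> M \<and> \<not> C a \<subseteq> S})" using less.prems by simp
        also have "\<dots> = card (insert a {a \<in> J. C a \<subseteq> M \<and> \<not> C a \<subseteq> S})"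
          using av assms(1) by (subst card_insert_disjoint) auto
        also have "\<dots> \<le> card {a \<in> J. C a \<subseteq> insert v M \<and> \<not> C a \<subseteq> S}"
          by (rule card_mono) (use av assms(1) \<open>v \<notin> S\<close> in auto)
        finally show ?thesis .
      qed
      ultimately show ?thesis
        using less.hyps[of "insert v M"] less.prems(1,2) \<open>v \<in> cl\<close> by blast
    qed
  qed
  from this[of S] have "card (cl - S) \<le> card {a \<in> J. C a \<subseteq> cl \<and> \<not> C a \<subseteq> S}"
    using subset_ucp_closure by (auto simp: cl_def)
  moreover have "card cl \<le> card S + card (cl - S)"
    using card_Un_le[of S "cl - S"] subset_ucp_closure[of S J C] by (simp add: cl_def Un_absorb1)
  ultimately show ?thesis unfolding cl_def by linarith
qed

primrec forced_steps :: "nat set \<Rightarrow> (nat \<Rightarrow> nat set) \<Rightarrow> nat list \<Rightarrow> nat set \<Rightarrow> nat" where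
  "forced_steps J C [] X = 0"
| "forced_steps J C (x # xs) X =
     (if x \<in> ucp_closure J C X then 1 else 0) + forced_steps J C xs (insert x X)"

text \<open>A potential argument with the closure size minus the number of clauses inside the
  closure. A forced step leaves the closure unchanged; any other step enlarges it by at most one
  more than the number of clauses that newly fall inside it.\<close>

lemma forced_steps_le_aux:
  assumes "finite J" "finite X" "\<And>a. a \<in> J \<Longrightarrow> finite (C a)"
  shows "forced_steps J C xs X + card (ucp_closure J C (X \<union> set xs))
      + card {a \<in> J. C a \<subseteq> ucp_closure J C X}
    \<le> card {a \<in> J. C a \<subseteq> ucp_closure J C (X \<union> set xs)} + card (ucp_closure J C X) + length xs"
  using assms(2)
proof (induction xs arbitrary: X)
  case (Cons x xs)
  let ?cl = "ucp_closure J C"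
  let ?N = "\<lambda>K. card {a \<in> J. C a \<subseteq> K}"
  have IH: "forced_steps J C xs (insert x X) + card (?cl (X \<union> set (x # xs))) + ?N (?cl (insert x X))
      \<le> ?N (?cl (X \<union> set (x # xs))) + card (?cl (insert x X)) + length xs"
    using Cons.IH[of "insert x X"] Cons.prems by simp
  show ?case
  proof (cases "x \<in> ?cl X")
    case True
    then have "?cl (insert x X) = ?cl X"
      using ucp_closure_insert[of J C x X] ucp_closure_closed[OF closed_under_ucp_closure]
      by (simp add: insert_absorb)
    then show ?thesis using IH True by simp
  next
    case False
    define S where "S = insert x (?cl X)"
    have fincl: "finite (?cl X)"
      by (rule finite_subset[OF ucp_closure_in_univ]) (use assms Cons.prems in auto)
    have clS: "?cl S = ?cl (insert x X)" by (simp add: S_def ucp_closure_insert)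
    have "card (?cl S) \<le> card S + card {a \<in> J. C a \<subseteq> ?cl S \<and> \<not> C a \<subseteq> S}"
      by (rule card_ucp_closure_le) (use assms fincl in \<open>auto simp: S_def\<close>)
    moreover have "card S = Suc (card (?cl X))" using False fincl by (simp add: S_def)
    moreover have "card {a \<in> J. C a \<subseteq> ?cl S \<and> \<not> C a \<subseteq> S} + ?N (?cl X) \<le> ?N (?cl S)"
    proof -
      have "card {a \<in> J. C a \<subseteq> ?cl S \<and> \<not> C a \<subseteq> S} + ?N (?cl X)
          = card ({a \<in> J. C a \<subseteq> ?cl S \<and> \<not> C a \<subseteq> S} \<union> {a \<in> J. C a \<subseteq> ?cl X})"
        by (rule card_Un_disjoint[symmetric]) (use assms(1) in \<open>auto simp: S_def\<close>)
      also have "\<dots> \<le> ?N (?cl S)"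
        by (rule card_mono) (use assms(1) subset_ucp_closure[of S J C] in \<open>auto simp: S_def\<close>)
      finally show ?thesis .
    qed
    ultimately show ?thesis using IH False unfolding clS by simp
  qed
qed simp

text \<open>From an empty start, the closure of \<open>set xs\<close> has at least
  \<open>length xs\<close> elements. These two terms cancel in the potential bound, so forced steps
  are paid for by clauses inside the closure, which lies in every closed \<open>K\<close> above
  \<open>set xs\<close>.\<close>

lemma forced_steps_le:
  assumes "finite J" "\<And>a. a \<in> J \<Longrightarrow> card (C a) \<ge> 2" "distinct xs" "set xs \<subseteq> K" "closed_under J C K"
  shows "forced_steps J C xs {} \<le> card {a \<in> J. C a \<subseteq> K}"
proof -
  have fin: "finite (C a)" if "a \<in> J" for a
    using assms(2)[OF that] by (intro card_ge_0_finite) simp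
  have "closed_under J C {}"
    unfolding closed_under_def
  proof (intro ballI impI)
    fix a v assume *: "a \<in> J" "v \<in> C a" "C a - {v} \<subseteq> {}"
    then have "card (C a) \<le> card {v}" by (intro card_mono) auto
    then show "v \<in> {}" using assms(2)[OF *(1)] by simp
  qed
  then have "ucp_closure J C {} = {}" by (rule ucp_closure_closed)
  then have *: "forced_steps J C xs {} + card (ucp_closure J C (set xs))
      \<le> card {a \<in> J. C a \<subseteq> ucp_closure J C (set xs)} + length xs"
    using forced_steps_le_aux[of J "{}" C xs] assms(1) fin by simp
  have "length xs = card (set xs)" using assms(3) by (simp add: distinct_card)
  also have "\<dots> \<le> card (ucp_closure J C (set xs))"
    by (intro card_mono finite_subset[OF ucp_closure_in_univ] subset_ucp_closure)
      (use assms(1) fin in auto)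
  finally have "forced_steps J C xs {} \<le> card {a \<in> J. C a \<subseteq> ucp_closure J C (set xs)}"
    using * by linarith
  also have "\<dots> \<le> card {a \<in> J. C a \<subseteq> K}"
    by (rule card_mono) (use assms(1) ucp_closure_least[OF assms(4,5)] in auto)
  finally show ?thesis .
qed

section \<open>Flip sets in trees and marginals equal to one half\<close>

text \<open>Starting from \<open>x\<close>, each clause below a flipped variable \<open>v\<close> flips one further variable
  \<open>ch a v\<close>, which keeps its parity.\<close>

inductive flipped ::
  "(nat \<Rightarrow> nat \<Rightarrow> nat) \<Rightarrow> (nat \<Rightarrow> nat set) \<Rightarrow> (nat \<Rightarrow> nat) \<Rightarrow> (nat \<Rightarrow> nat) \<Rightarrow> nat set \<Rightarrow> nat \<Rightarrow> nat \<Rightarrow> bool"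
  for ch A lv la J x where
  root: "flipped ch A lv la J x x"
| step: "flipped ch A lv la J x v \<Longrightarrow> a \<in> J \<Longrightarrow> v \<in> A a \<Longrightarrow> la a = Suc (lv v) \<Longrightarrow>
    flipped ch A lv la J x (ch a v)"

text \<open>\<open>lv\<close> and \<open>la\<close> are distances from the root \<open>x\<close>: a
  clause has one parent variable, its other variables are children, and a variable has at most one
  parent clause. No clause meets \<open>U\<close> in exactly one variable, so a flipped parent
  always finds a child in \<open>U\<close> to flip with it. Every clause then meets \<open>Z\<close>
  in nothing, or in its parent and one child.\<close>

lemma even_flip_set_exists:
  fixes lv la :: "nat \<Rightarrow> nat"
  assumes "x \<in> U" "lv x = 0" "\<And>a. a \<in> J \<Longrightarrow> card (A a \<inter> U) \<noteq> 1"
    and parent: "\<And>a. a \<in> J \<Longrightarrow> \<exists>v\<in>A a. la a = Suc (lv v) \<and> (\<forall>w\<in>A a. w \<noteq> v \<longrightarrow> lv w = Suc (la a))"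
    and uniq: "\<And>a b w. \<lbrakk>a \<in> J; b \<in> J; w \<in> A a; w \<in> A b; lv w = Suc (la a); lv w = Suc (la b)\<rbrakk> \<Longrightarrow> a = b"
  shows "\<exists>Z. x \<in> Z \<and> Z \<subseteq> insert x (\<Union>a\<in>J. A a) \<and> (\<forall>a\<in>J. even (card (A a \<inter> Z)))"
proof -
  have "\<exists>w. a \<in> J \<and> v \<in> A a \<and> v \<in> U \<longrightarrow> w \<in> A a \<inter> U \<and> w \<noteq> v" for a v
    using assms(3)[of a] by (cases "a \<in> J \<and> v \<in> A a \<and> v \<in> U \<and> A a \<inter> U \<noteq> {v}") auto
  then obtain ch where ch: "a \<in> J \<Longrightarrow> v \<in> A a \<Longrightarrow> v \<in> U \<Longrightarrow> ch a v \<in> A a \<inter> U \<and> ch a v \<noteq> v" for a v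
    by metis
  define Z where "Z = Collect (flipped ch A lv la J x)"
  have ZU: "z \<in> U" if "z \<in> Z" for z
    using that unfolding Z_def mem_Collect_eq
  proof induction
    case root
    show ?case by (rule assms(1))
  next
    case (step v a)
    then show ?case using ch[of a v] by blast
  qed
  have Z_cases: "z = x \<or> (\<exists>v a. z = ch a v \<and> v \<in> Z \<and> a \<in> J \<and> v \<in> A a \<and> la a = Suc (lv v))"
    if "z \<in> Z" for z
    using that unfolding Z_def mem_Collect_eq by (cases rule: flipped.cases) auto
  have sub: "Z \<subseteq> insert x (\<Union>a\<in>J. A a)"
  proof
    fix z assume "z \<in> Z"
    from Z_cases[OF this] show "z \<in> insert x (\<Union>a\<in>J. A a)"
    proof
      assume "\<exists>v a. z = ch a v \<and> v \<in> Z \<and> a \<in> J \<and> v \<in> A a \<and> la a = Suc (lv v)"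
      then obtain v a where "z = ch a v" "v \<in> Z" "a \<in> J" "v \<in> A a" by blast
      then show ?thesis using ch[of a v] ZU[of v] by auto
    qed simp
  qed
  have "even (card (A a \<inter> Z))" if a: "a \<in> J" for a
  proof -
    obtain v0 where v0: "v0 \<in> A a" "la a = Suc (lv v0)"
      "\<And>w. w \<in> A a \<Longrightarrow> w \<noteq> v0 \<Longrightarrow> lv w = Suc (la a)"
      using parent[OF a] by blast
    \<comment> \<open>A child of \<open>a\<close> can be flipped only through its parent clause,
      which is \<open>a\<close> itself, and hence only by the parent variable
      \<open>v0\<close>.\<close>
    have key: "v0 \<in> Z \<and> w = ch a v0" if w: "w \<in> A a \<inter> Z" "w \<noteq> v0" for w
    proof -
      have lw: "lv w = Suc (la a)" using v0(3) w by blast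
      then have "w \<noteq> x" using assms(2) by auto
      then obtain v b where b: "w = ch b v" "v \<in> Z" "b \<in> J" "v \<in> A b" "la b = Suc (lv v)"
        using Z_cases w by blast
      then have wb: "w \<in> A b" "w \<noteq> v" using ch[of b v] ZU by auto
      obtain u where u: "u \<in> A b" "la b = Suc (lv u)" "\<And>w. w \<in> A b \<Longrightarrow> w \<noteq> u \<Longrightarrow> lv w = Suc (la b)"
        using parent[OF b(3)] by blast
      have vu: "v = u" using u(3)[OF b(4)] b(5) by (cases "v = u") auto
      then have "lv w = Suc (la b)" using u(3) wb by blast
      then have "a = b" using uniq[OF a b(3) _ wb(1) lw] w by blast
      moreover have "v = v0" using v0(3)[of v] b \<open>a = b\<close> by (cases "v = v0") auto
      ultimately show ?thesis using b by simp
    qed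
    show ?thesis
    proof (cases "v0 \<in> Z")
      case True
      have "ch a v0 \<in> Z" unfolding Z_def mem_Collect_eq
        by (rule flipped.step) (use True a v0 in \<open>auto simp: Z_def\<close>)
      then have "A a \<inter> Z = {v0, ch a v0}"
        using key True v0(1) ch[OF a v0(1) ZU[OF True]] by blast
      then show ?thesis using ch[OF a v0(1) ZU[OF True]] by simp
    next
      case False
      then have "A a \<inter> Z = {}" using key by blast
      then show ?thesis by simp
    qed
  qed
  moreover have "x \<in> Z" by (simp add: Z_def flipped.root)
  ultimately show ?thesis using sub by blast
qed

lemma odd_card_flip:
  assumes "finite A" "even (card (A \<inter> Z))"
  shows "odd (card {v \<in> A. s v \<noteq> (v \<in> Z)}) = odd (card {v \<in> A. s v})"
proof -
  let ?P = "{v \<in> A. s v} - Z" and ?N = "{v \<in> A \<inter> Z. \<not> s v}" and ?B = "{v \<in> A \<inter> Z. s v}"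
  have "card {v \<in> A. s v \<noteq> (v \<in> Z)} = card ?P + card ?N"
    by (subst card_Un_disjoint[symmetric]) (use assms in \<open>auto intro!: arg_cong[where f = card]\<close>)
  moreover have "card {v \<in> A. s v} = card ?P + card ?B"
    by (subst card_Un_disjoint[symmetric]) (use assms in \<open>auto intro!: arg_cong[where f = card]\<close>)
  moreover have "card (A \<inter> Z) = card ?N + card ?B"
    by (subst card_Un_disjoint[symmetric]) (use assms in \<open>auto intro!: arg_cong[where f = card]\<close>)
  ultimately show ?thesis using assms(2) by presburger
qed

text \<open>Flipping the values on \<open>Z\<close> is an involution on the solutions that changes
  the value of \<open>x\<close>.\<close>

lemma marginal_half:
  assumes "finite (variables \<Psi>)" "x \<in> Z" "Z \<subseteq> variables \<Psi>" "solutions \<Psi> \<noteq> {}"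
    and "\<And>A b. (A, b) \<in> ran (clauses \<Psi>) \<Longrightarrow> A \<subseteq> variables \<Psi> \<and> even (card (A \<inter> Z))"
  shows "measure_pmf.prob (pmf_of_set (solutions \<Psi>)) {\<sigma>. \<sigma> x} = 1 / 2"
proof -
  define S where "S = solutions \<Psi>"
  have fin: "finite S" unfolding S_def solutions_def
    by (rule finite_subset[OF Collect_restrict]) (use assms(1) in \<open>simp add: finite_PiE\<close>)
  define fl where "fl = (\<lambda>\<sigma>. restrict (\<lambda>v. \<sigma> v \<noteq> (v \<in> Z)) (variables \<Psi>))"
  have flS: "fl \<sigma> \<in> S" if "\<sigma> \<in> S" for \<sigma>
  proof -
    have "satisfies_clause (fl \<sigma>) (A, b)" if "(A, b) \<in> ran (clauses \<Psi>)" for A b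
    proof -
      have A: "A \<subseteq> variables \<Psi>" "even (card (A \<inter> Z))" using assms(5) that by auto
      have "{v \<in> A. fl \<sigma> v} = {v \<in> A. \<sigma> v \<noteq> (v \<in> Z)}" using A(1) by (auto simp: fl_def)
      moreover have "satisfies_clause \<sigma> (A, b)" using \<open>\<sigma> \<in> S\<close> that by (auto simp: S_def solutions_def)
      ultimately show ?thesis
        using odd_card_flip[OF finite_subset[OF A(1) assms(1)] A(2), of \<sigma>]
        by (simp add: satisfies_clause_def)
    qed
    then show ?thesis by (auto simp: S_def solutions_def fl_def)
  qed
  have flx: "fl \<sigma> x = (\<not> \<sigma> x)" for \<sigma> using assms(2,3) by (auto simp: fl_def)
  have flfl: "fl (fl \<sigma>) = \<sigma>" if "\<sigma> \<in> S" for \<sigma>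
    using that by (auto simp: fl_def S_def solutions_def PiE_iff extensional_def fun_eq_iff)
  have "bij_betw fl {\<sigma> \<in> S. \<sigma> x} {\<sigma> \<in> S. \<not> \<sigma> x}"
    by (rule bij_betwI[where g = fl]) (use flS flx flfl in auto)
  then have eq: "card {\<sigma> \<in> S. \<sigma> x} = card {\<sigma> \<in> S. \<not> \<sigma> x}" by (rule bij_betw_same_card)
  have "card S = card {\<sigma> \<in> S. \<sigma> x} + card {\<sigma> \<in> S. \<not> \<sigma> x}"
    by (subst card_Un_disjoint[symmetric]) (use fin in \<open>auto intro!: arg_cong[where f = card]\<close>)
  moreover have "card S > 0" using fin assms(4) by (simp add: S_def card_gt_0_iff)
  moreover have "S \<inter> {\<sigma>. \<sigma> x} = {\<sigma> \<in> S. \<sigma> x}" by auto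
  ultimately have "real (card (S \<inter> {\<sigma>. \<sigma> x})) / real (card S) = 1 / 2"
    using eq by (simp add: field_simps)
  then show ?thesis
    using measure_pmf_of_set[of S "{\<sigma>. \<sigma> x}"] fin assms(4) unfolding S_def by metis
qed

section \<open>Tree-like balls\<close>

definition rlevel :: "'a rel \<Rightarrow> 'a \<Rightarrow> 'a \<Rightarrow> nat" where
  "rlevel E r u = (LEAST d. (r, u) \<in> E ^^ d)"

text \<open>A local form of being a tree: breadth-first search from \<open>r\<close> to depth
  \<open>R\<close> reaches each node from only one node of the previous level.\<close>

definition unique_parents :: "'a rel \<Rightarrow> 'a \<Rightarrow> nat \<Rightarrow> bool" where
  "unique_parents E r R \<longleftrightarrow> (\<forall>d<R. \<forall>u v w. (r, v) \<in> E ^^ d \<longrightarrow> (r, w) \<in> E ^^ d \<longrightarrow>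
     (v, u) \<in> E \<longrightarrow> (w, u) \<in> E \<longrightarrow> rlevel E r u = Suc d \<longrightarrow> v = w)"

lemma rlevel_le: "(r, u) \<in> E ^^ d \<Longrightarrow> rlevel E r u \<le> d"
  unfolding rlevel_def by (rule Least_le)

lemma rlevel_reach: "(r, u) \<in> E ^^ d \<Longrightarrow> (r, u) \<in> E ^^ rlevel E r u"
  unfolding rlevel_def by (rule LeastI)

lemma factor_edges_simps:
  "(Inl v, Inr a) \<in> factor_edges \<Phi> \<longleftrightarrow>
     v \<in> variables \<Phi> \<and> (\<exists>A b. clauses \<Phi> a = Some (A, b) \<and> v \<in> A)"
  "(Inr a, Inl v) \<in> factor_edges \<Phi> \<longleftrightarrow>
     v \<in> variables \<Phi> \<and> (\<exists>A b. clauses \<Phi> a = Some (A, b) \<and> v \<in> A)"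
  "(Inl v, Inl w) \<notin> factor_edges \<Phi>" "(Inr a, Inr b) \<notin> factor_edges \<Phi>"
  by (auto simp: factor_edges_def Let_def)

lemma factor_edges_sym: "(u, w) \<in> factor_edges \<Phi> \<Longrightarrow> (w, u) \<in> factor_edges \<Phi>"
  by (auto simp: factor_edges_def Let_def)

lemma factor_edges_isl: "(u, w) \<in> factor_edges \<Phi> \<Longrightarrow> isl u \<noteq> isl w"
  by (auto simp: factor_edges_def Let_def)

lemma factor_relpow_isl: "(Inl x, u) \<in> factor_edges \<Phi> ^^ d \<Longrightarrow> isl u = even d"
  by (induction d arbitrary: u) (auto dest: factor_edges_isl)

text \<open>Levels of neighbours differ by at most one, and they differ in parity since the factor
  graph is bipartite.\<close>

lemma rlevel_factor_edge:
  fixes \<Phi> x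
  defines "lev \<equiv> rlevel (factor_edges \<Phi>) (Inl x)"
  assumes "(Inl x, u) \<in> factor_edges \<Phi> ^^ d" "(u, w) \<in> factor_edges \<Phi>"
  shows "lev w = Suc (lev u) \<or> lev u = Suc (lev w)"
proof -
  have u: "(Inl x, u) \<in> factor_edges \<Phi> ^^ lev u"
    unfolding lev_def by (rule rlevel_reach) (rule assms)
  then have w1: "(Inl x, w) \<in> factor_edges \<Phi> ^^ Suc (lev u)" using assms(3) by auto
  then have w: "(Inl x, w) \<in> factor_edges \<Phi> ^^ lev w" unfolding lev_def by (rule rlevel_reach)
  then have "(Inl x, u) \<in> factor_edges \<Phi> ^^ Suc (lev w)"
    using factor_edges_sym[OF assms(3)] by auto
  then have "lev u \<le> Suc (lev w)" "lev w \<le> Suc (lev u)"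
    using w1 unfolding lev_def by (blast intro: rlevel_le)+
  moreover have "even (lev u) \<noteq> even (lev w)"
    using factor_relpow_isl[OF u] factor_relpow_isl[OF w] factor_edges_isl[OF assms(3)] by simp
  ultimately show ?thesis
    by (metis le_Suc_eq le_antisym)
qed

text \<open>A node of largest level on the cycle has two distinct neighbours on it, and both must
  lie one level lower.\<close>

lemma cycle_contradicts_unique_parents:
  fixes \<Phi> x
  defines "E \<equiv> factor_edges \<Phi>"
  assumes up: "unique_parents E (Inl x) R"
    and p: "length p \<ge> 3" "distinct p" "\<forall>i<length p. (p ! i, p ! (Suc i mod length p)) \<in> E"
    and W: "\<And>u. u \<in> set p \<Longrightarrow> (Inl x, u) \<in> E ^^ rlevel E (Inl x) u \<and> rlevel E (Inl x) u \<le> R"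
  shows False
proof -
  let ?lev = "rlevel E (Inl x)" and ?n = "length p"
  have "set p \<noteq> {}" using p(1) by auto
  then have "Max (?lev ` set p) \<in> ?lev ` set p" by (intro Max_in) auto
  then obtain u where u0: "u \<in> set p" "?lev u = Max (?lev ` set p)" by (metis imageE)
  have u: "u \<in> set p" "\<And>w. w \<in> set p \<Longrightarrow> ?lev w \<le> ?lev u"
    unfolding u0(2) using u0(1) by auto
  obtain i where i: "i < ?n" "u = p ! i" using u(1) by (auto simp: in_set_conv_nth)
  define s where "s = Suc i mod ?n"
  define q where "q = (if i = 0 then ?n - 1 else i - 1)"
  have q: "q < ?n" "Suc q mod ?n = i" using i(1) p(1) by (auto simp: q_def)
  have s: "s < ?n" unfolding s_def by (rule mod_less_divisor) (use p(1) in linarith)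
  have "s \<noteq> q" using i(1) p(1) by (auto simp: s_def q_def mod_Suc split: if_splits)
  then have ne: "p ! s \<noteq> p ! q" using p(2) s q(1) by (simp add: nth_eq_iff_index_eq)
  have e1: "(p ! s, u) \<in> E" using p(3) i factor_edges_sym unfolding E_def s_def by blast
  have e2: "(p ! q, u) \<in> E" using p(3) q i by force
  have lev: "?lev u = Suc (?lev w)" if "w \<in> set p" "(w, u) \<in> E" for w
    using rlevel_factor_edge[of x w "?lev w" \<Phi> u] W[OF that(1)] that(2) u(2)[OF that(1)]
    unfolding E_def by auto
  have in_p: "p ! s \<in> set p" "p ! q \<in> set p" using s q by auto
  have "?lev (p ! s) = ?lev (p ! q)" using lev[OF in_p(1) e1] lev[OF in_p(2) e2] by simp
  moreover have "?lev (p ! s) < R" using lev[OF in_p(1) e1] W[OF u(1)] by simp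
  ultimately show False
    using up W[OF in_p(1)] W[OF in_p(2)] e1 e2 lev[OF in_p(1) e1] ne
    unfolding unique_parents_def by metis
qed

text \<open>\<open>unique_parents\<close> makes the ball a tree and \<open>\<omega>\<close> makes it
  satisfiable, so the rule returns the true marginal there. The set \<open>U\<close> provides the
  variables for the flip set.\<close>

lemma exact_rule_half:
  assumes ex: "exact_on_trees R \<tau>" and "even R" and wf: "wf_xorsat \<Phi>" and x: "x \<in> variables \<Phi>"
    and up: "unique_parents (factor_edges \<Phi>) (Inl x) R"
    and sat: "\<And>c. c \<in> ran (clauses \<Phi>) \<Longrightarrow> satisfies_clause \<omega> c"
    and U: "x \<in> U" "\<And>A b. (A, b) \<in> ran (clauses \<Phi>) \<Longrightarrow> card (A \<inter> U) \<noteq> 1"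
  shows "\<tau> (local_ball \<Phi> x R) = 1 / 2"
proof -
  define E where "E = factor_edges \<Phi>"
  define lev where "lev = rlevel E (Inl x)"
  define W where "W = within_distance \<Phi> R (Inl x)"
  have W_I: "W u" if "(Inl x, u) \<in> E ^^ d" "d \<le> R" for u d
    using that by (auto simp: W_def within_distance_def E_def)
  have W_D: "(Inl x, u) \<in> E ^^ lev u" "lev u \<le> R" if Wu: "W u" for u
  proof -
    obtain d where d: "d \<le> R" "(Inl x, u) \<in> E ^^ d"
      using Wu by (auto simp: W_def within_distance_def E_def)
    show "(Inl x, u) \<in> E ^^ lev u" unfolding lev_def by (rule rlevel_reach) (rule d)
    show "lev u \<le> R" using rlevel_le[OF d(2)] d(1) unfolding lev_def by simp
  qed
  have clause_vars: "A \<subseteq> variables \<Phi>" "A \<noteq> {}" if "clauses \<Phi> a = Some (A, b)" for a A b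
    using wf that unfolding wf_xorsat_def ran_def by fastforce+
  have odd_lev: "odd (lev (Inr a))" if "W (Inr a)" for a
    using factor_relpow_isl[of x "Inr a" _ \<Phi>] W_D[OF that] by (auto simp: E_def)
  define V where "V = {v \<in> variables \<Phi>. W (Inl v)}"
  \<comment> \<open>Clauses sit at odd distance, so for even \<open>R\<close> they lie strictly
    inside the ball and none of them is truncated.\<close>
  have AV: "A \<subseteq> V" if "W (Inr a)" "clauses \<Phi> a = Some (A, b)" for a A b
  proof
    fix v assume v: "v \<in> A"
    have "lev (Inr a) \<noteq> R" using odd_lev[OF that(1)] assms(2) by auto
    then have "Suc (lev (Inr a)) \<le> R" using W_D(2)[OF that(1)] by simp
    moreover have "(Inr a, Inl v) \<in> E"
      using v that clause_vars by (auto simp: E_def factor_edges_simps)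
    ultimately have "W (Inl v)" using W_D(1)[OF that(1)] by (intro W_I[of _ "Suc (lev (Inr a))"]) auto
    then show "v \<in> V" using v clause_vars that by (auto simp: V_def)
  qed
  define \<Psi> where "\<Psi> = \<lparr>variables = V, clauses = (\<lambda>a. if W (Inr a) then clauses \<Phi> a else None)\<rparr>"
  have "map_option (\<lambda>(A, b). (A \<inter> V, b)) (clauses \<Phi> a) = clauses \<Phi> a" if "W (Inr a)" for a
    using AV[OF that] by (cases "clauses \<Phi> a") (auto simp: Int_absorb2)
  then have ball: "local_ball \<Phi> x R = (\<Psi>, x)"
    unfolding local_ball_def \<Psi>_def Let_def W_def[symmetric] V_def[symmetric] by auto
  have \<Psi>_ran: "\<exists>a. W (Inr a) \<and> clauses \<Phi> a = Some c" if "c \<in> ran (clauses \<Psi>)" for c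
    using that by (auto simp: \<Psi>_def ran_def split: if_splits)
  have \<Psi>_sub: "c \<in> ran (clauses \<Phi>)" if "c \<in> ran (clauses \<Psi>)" for c
    using \<Psi>_ran[OF that] by (auto simp: ran_def)
  have fV: "finite V" using wf by (auto simp: V_def wf_xorsat_def)
  have xV: "x \<in> V" using x W_I[of "Inl x" 0] by (auto simp: V_def)
  have edges: "(u, w) \<in> factor_edges \<Psi> \<longleftrightarrow> (u, w) \<in> E \<and> W u \<and> W w" for u w
    by (cases u; cases w) (auto simp: factor_edges_simps E_def \<Psi>_def V_def split: if_splits)
  have nodes: "W u" if "u \<in> factor_nodes \<Psi>" for u
    using that by (auto simp: factor_nodes_def \<Psi>_def V_def split: if_splits)
  have path: "(Inl x, u) \<in> factor_edges \<Psi> ^^ d" if "(Inl x, u) \<in> E ^^ d" "d \<le> R" for u d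
    using that
  proof (induction d arbitrary: u)
    case (Suc d)
    then obtain w where w: "(Inl x, w) \<in> E ^^ d" "(w, u) \<in> E" by auto
    then have "W w" "W u" using Suc.prems W_I[of w d] W_I[of u "Suc d"] by auto
    then have "(w, u) \<in> factor_edges \<Psi>" using edges w by auto
    then show ?case using Suc.IH[OF w(1)] Suc.prems by auto
  qed simp
  have wf\<Psi>: "wf_xorsat \<Psi>"
  proof -
    have "dom (clauses \<Psi>) \<subseteq> dom (clauses \<Phi>)" by (auto simp: \<Psi>_def split: if_splits)
    then have "finite (dom (clauses \<Psi>))" using wf finite_subset by (auto simp: wf_xorsat_def)
    moreover have "A \<noteq> {} \<and> A \<subseteq> V" if "(A, b) \<in> ran (clauses \<Psi>)" for A b
      using \<Psi>_ran[OF that] AV clause_vars by blast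
    ultimately show ?thesis using fV by (auto simp: wf_xorsat_def \<Psi>_def)
  qed
  have rooted: "(\<Psi>, x) \<in> rooted_instances R"
    using wf\<Psi> xV nodes path W_D by (auto simp: rooted_instances_def within_distance_def \<Psi>_def; blast)
  have tree: "is_tree (factor_nodes \<Psi>) (factor_edges \<Psi>)"
    unfolding is_tree_def
  proof (intro conjI ballI)
    show "factor_nodes \<Psi> \<noteq> {}" using xV by (auto simp: factor_nodes_def \<Psi>_def)
    have sym: "sym (factor_edges \<Psi>)" by (auto intro!: symI factor_edges_sym)
    fix u w assume "u \<in> factor_nodes \<Psi>" "w \<in> factor_nodes \<Psi>"
    then have "(Inl x, u) \<in> (factor_edges \<Psi>)\<^sup>*" "(Inl x, w) \<in> (factor_edges \<Psi>)\<^sup>*"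
      using nodes path W_D by (blast intro: relpow_imp_rtrancl)+
    then show "(u, w) \<in> (factor_edges \<Psi>)\<^sup>*"
      using sym_rtrancl[OF sym] by (meson rtrancl_trans symD)
  next
    show "\<not> (\<exists>p. length p \<ge> 3 \<and> distinct p \<and> set p \<subseteq> factor_nodes \<Psi> \<and>
      (\<forall>i<length p. (p ! i, p ! (Suc i mod length p)) \<in> factor_edges \<Psi>))"
    proof
      assume "\<exists>p. 3 \<le> length p \<and> distinct p \<and> set p \<subseteq> factor_nodes \<Psi> \<and>
        (\<forall>i<length p. (p ! i, p ! (Suc i mod length p)) \<in> factor_edges \<Psi>)"
      then obtain p where p: "3 \<le> length p" "distinct p" "set p \<subseteq> factor_nodes \<Psi>"
        "\<forall>i<length p. (p ! i, p ! (Suc i mod length p)) \<in> factor_edges \<Psi>" by blast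
      show False
      proof (rule cycle_contradicts_unique_parents[OF up p(1,2)])
        show "\<forall>i<length p. (p ! i, p ! (Suc i mod length p)) \<in> factor_edges \<Phi>"
          using p(4) edges by (auto simp: E_def)
        show "(Inl x, u) \<in> factor_edges \<Phi> ^^ rlevel (factor_edges \<Phi>) (Inl x) u \<and>
            rlevel (factor_edges \<Phi>) (Inl x) u \<le> R" if "u \<in> set p" for u
          using W_D[of u] nodes p(3) that unfolding lev_def E_def by blast
      qed
    qed
  qed
  have sol: "restrict \<omega> V \<in> solutions \<Psi>"
  proof -
    have "satisfies_clause (restrict \<omega> V) (A, b)" if "(A, b) \<in> ran (clauses \<Psi>)" for A b
    proof -
      have "A \<subseteq> V" using \<Psi>_ran[OF that] AV by blast
      then have "{v \<in> A. restrict \<omega> V v} = {v \<in> A. \<omega> v}" by auto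
      then show ?thesis using sat[OF \<Psi>_sub[OF that]] by (simp add: satisfies_clause_def)
    qed
    then show ?thesis by (auto simp: solutions_def \<Psi>_def)
  qed
  define A where "A = (\<lambda>a. fst (the (clauses \<Psi> a)))"
  define J where "J = dom (clauses \<Psi>)"
  have J: "W (Inr a) \<and> clauses \<Phi> a = Some (A a, snd (the (clauses \<Psi> a)))" if "a \<in> J" for a
    using that by (auto simp: J_def A_def \<Psi>_def split: if_splits)
  have AE: "(Inl w, Inr a) \<in> E" "(Inr a, Inl w) \<in> E" if "a \<in> J" "w \<in> A a" for a w
    using J[OF that(1)] that(2) clause_vars by (fastforce simp: E_def factor_edges_simps)+
  have AW: "W (Inl w)" if "a \<in> J" "w \<in> A a" for a w
    using AV[of a] J[OF that(1)] that(2) by (auto simp: V_def)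
  have parents: "v = w" if "(v, u) \<in> E" "(w, u) \<in> E" "W v" "W w" "W u"
    "lev u = Suc (lev v)" "lev u = Suc (lev w)" for u v w
  proof -
    have "lev v < R" "lev v = lev w" using W_D[OF that(5)] that(6,7) by auto
    then show ?thesis
      using up W_D(1)[OF that(3)] W_D(1)[OF that(4)] that(1,2,6) unfolding unique_parents_def E_def[symmetric] lev_def
      by metis
  qed
  have "\<exists>Z. x \<in> Z \<and> Z \<subseteq> insert x (\<Union>a\<in>J. A a) \<and> (\<forall>a\<in>J. even (card (A a \<inter> Z)))"
  proof (rule even_flip_set_exists[where lv = "\<lambda>v. lev (Inl v)" and la = "\<lambda>a. lev (Inr a)" and U = U])
    show "x \<in> U" by (rule U)
    show "lev (Inl x) = 0" using rlevel_le[of "Inl x" "Inl x" 0 E] by (simp add: lev_def)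
    show "card (A a \<inter> U) \<noteq> 1" if "a \<in> J" for a
      using U(2)[of "A a"] J[OF that] by (auto simp: ran_def)
    show "\<exists>v\<in>A a. lev (Inr a) = Suc (lev (Inl v)) \<and> (\<forall>w\<in>A a. w \<noteq> v \<longrightarrow> lev (Inl w) = Suc (lev (Inr a)))"
      if a: "a \<in> J" for a
    proof -
      have Wa: "W (Inr a)" using J[OF a] by simp
      obtain d where d: "lev (Inr a) = Suc d" using odd_lev[OF Wa] by (cases "lev (Inr a)") auto
      then obtain u where u: "(Inl x, u) \<in> E ^^ d" "(u, Inr a) \<in> E" using W_D(1)[OF Wa] by auto
      have "lev u \<le> d" using rlevel_le[OF u(1)] by (simp add: lev_def)
      then have lu: "lev (Inr a) = Suc (lev u)"
        using rlevel_factor_edge[of x u d \<Phi> "Inr a"] u d unfolding lev_def E_def by auto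
      obtain v where v: "u = Inl v" using u(2) by (cases u) (auto simp: E_def factor_edges_simps)
      have vA: "v \<in> A a" using u(2) J[OF a] unfolding v by (auto simp: E_def factor_edges_simps)
      moreover have "lev (Inl w) = Suc (lev (Inr a))" if w: "w \<in> A a" "w \<noteq> v" for w
      proof -
        have "lev (Inr a) \<noteq> Suc (lev (Inl w))"
          using parents[of "Inl w" "Inr a" "Inl v"] AE[OF a] w AW[OF a] vA Wa lu v by auto
        then show ?thesis
          using rlevel_factor_edge[of x "Inr a" "lev (Inr a)" \<Phi> "Inl w"] W_D[OF Wa] AE(2)[OF a w(1)]
          unfolding lev_def E_def by auto
      qed
      ultimately show ?thesis using lu v by auto
    qed
    show "a = b" if "a \<in> J" "b \<in> J" "w \<in> A a" "w \<in> A b"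
      "lev (Inl w) = Suc (lev (Inr a))" "lev (Inl w) = Suc (lev (Inr b))" for a b w
      using parents[of "Inr a" "Inl w" "Inr b"] AE that AW J by auto
  qed
  then obtain Z where Z: "x \<in> Z" "Z \<subseteq> insert x (\<Union>a\<in>J. A a)" "\<And>a. a \<in> J \<Longrightarrow> even (card (A a \<inter> Z))"
    by blast
  have "measure_pmf.prob (pmf_of_set (solutions \<Psi>)) {\<sigma>. \<sigma> x} = 1 / 2"
  proof (rule marginal_half[OF _ Z(1)])
    show "finite (variables \<Psi>)" using fV by (simp add: \<Psi>_def)
    show "Z \<subseteq> variables \<Psi>" using Z(2) xV AV J by (fastforce simp: \<Psi>_def)
    show "solutions \<Psi> \<noteq> {}" using sol by blast
    fix B b assume B: "(B, b) \<in> ran (clauses \<Psi>)"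
    then obtain a where a: "clauses \<Psi> a = Some (B, b)" by (auto simp: ran_def)
    then have "a \<in> J" "A a = B" by (auto simp: J_def A_def)
    then show "B \<subseteq> variables \<Psi> \<and> even (card (B \<inter> Z))"
      using Z(3)[of a] wf\<Psi> B by (auto simp: wf_xorsat_def)
  qed
  moreover have "\<tau> (\<Psi>, x) = measure_pmf.prob (pmf_of_set (solutions \<Psi>)) {\<sigma>. \<sigma> x}"
    using ex rooted tree sol unfolding exact_on_trees_def by blast
  ultimately show ?thesis by (simp add: ball)
qed

section \<open>Decimation along a fixed order\<close>

primrec dec_along :: "(rooted_xorsat \<Rightarrow> real) \<Rightarrow> nat \<Rightarrow> nat list \<Rightarrow> xorsat \<Rightarrow> (nat \<Rightarrow> bool) \<Rightarrow> (nat \<Rightarrow> bool) pmf" where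
  "dec_along \<tau> R [] \<Phi> \<sigma> = return_pmf \<sigma>"
| "dec_along \<tau> R (x # xs) \<Phi> \<sigma> = do {
     s \<leftarrow> bernoulli_pmf (\<tau> (local_ball \<Phi> x R));
     dec_along \<tau> R xs (assign_variable \<Phi> x s) (\<sigma>(x := s))
   }"

primrec random_order :: "nat \<Rightarrow> nat set \<Rightarrow> nat list pmf" where
  "random_order 0 V = return_pmf []"
| "random_order (Suc t) V = do {
     x \<leftarrow> pmf_of_set V;
     xs \<leftarrow> random_order t (V - {x});
     return_pmf (x # xs)
   }"

lemma variables_assign_variable [simp]: "variables (assign_variable \<Phi> x s) = variables \<Phi> - {x}"
  by (simp add: assign_variable_def)

text \<open>The next variable is chosen from the unassigned ones, whatever values were given before,
  so the whole order can be drawn ahead of all coins.\<close>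

lemma decimate_eq_dec_along:
  "decimate \<tau> R t \<Phi> \<sigma> = bind_pmf (random_order t (variables \<Phi>)) (\<lambda>xs. dec_along \<tau> R xs \<Phi> \<sigma>)"
proof (induction t arbitrary: \<Phi> \<sigma>)
  case (Suc t)
  show ?case
    unfolding decimate.simps Suc.IH variables_assign_variable random_order.simps
    by (simp add: bind_assoc_pmf bind_return_pmf)
      (subst bind_commute_pmf, rule refl)
qed (simp add: bind_return_pmf)

lemma set_random_order:
  assumes "finite V" "card V = t" "xs \<in> set_pmf (random_order t V)"
  shows "distinct xs \<and> set xs = V"
  using assms
proof (induction t arbitrary: V xs)
  case (Suc t)
  then have "V \<noteq> {}" by auto
  then obtain x ys where x: "x \<in> V" "ys \<in> set_pmf (random_order t (V - {x}))" "xs = x # ys"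
    using Suc.prems by (auto simp: set_pmf_of_set)
  then have "distinct ys \<and> set ys = V - {x}" using Suc.IH[of "V - {x}" ys] Suc.prems by simp
  then show ?case using x by auto
qed simp

lemma dec_along_outside:
  assumes "\<omega> \<in> set_pmf (dec_along \<tau> R xs \<Phi> \<sigma>)" "y \<notin> set xs"
  shows "\<omega> y = \<sigma> y"
  using assms by (induction xs arbitrary: \<Phi> \<sigma>) fastforce+

text \<open>The output reveals the coin: \<open>x\<close> is never assigned again, so only the
  branch that sets it to \<open>\<omega> x\<close> can produce \<open>\<omega>\<close>.\<close>

lemma pmf_dec_along_Cons:
  assumes "x \<notin> set xs"
  shows "pmf (dec_along \<tau> R (x # xs) \<Phi> \<sigma>) \<omega> = pmf (bernoulli_pmf (\<tau> (local_ball \<Phi> x R))) (\<omega> x) *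
    pmf (dec_along \<tau> R xs (assign_variable \<Phi> x (\<omega> x)) (\<sigma>(x := \<omega> x))) \<omega>"
proof -
  have zero: "pmf (dec_along \<tau> R xs (assign_variable \<Phi> x s) (\<sigma>(x := s))) \<omega> = 0" if "s \<noteq> \<omega> x" for s
    using dec_along_outside[of \<omega> \<tau> R xs _ "\<sigma>(x := s)" x] assms that by (auto simp: pmf_eq_0_set_pmf)
  have "pmf (dec_along \<tau> R (x # xs) \<Phi> \<sigma>) \<omega> =
    (\<Sum>s\<in>{\<omega> x}. pmf (dec_along \<tau> R xs (assign_variable \<Phi> x s) (\<sigma>(x := s))) \<omega> *
      pmf (bernoulli_pmf (\<tau> (local_ball \<Phi> x R))) s)"
    unfolding dec_along.simps pmf_bind
    by (rule integral_measure_pmf_real) (use zero in blast)+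
  then show ?thesis by simp
qed

text \<open>An instance reduced by assigning \<open>X\<close>, up to its right-hand sides: what
  remains of the clauses is the same for all values given to \<open>X\<close>.\<close>

definition skeleton :: "nat set \<Rightarrow> (nat \<Rightarrow> nat set) \<Rightarrow> nat set \<Rightarrow> nat set \<Rightarrow> xorsat \<Rightarrow> bool" where
  "skeleton J C V X \<Phi> \<longleftrightarrow> variables \<Phi> = V - X \<and>
     (\<forall>a. map_option fst (clauses \<Phi> a) = (if a \<in> J \<and> C a - X \<noteq> {} then Some (C a - X) else None))"

lemma skeleton_clause:
  assumes "skeleton J C V X \<Phi>" "clauses \<Phi> a = Some (A, b)"
  shows "a \<in> J" "A = C a - X" "A \<noteq> {}"
proof -
  have "map_option fst (clauses \<Phi> a) = (if a \<in> J \<and> C a - X \<noteq> {} then Some (C a - X) else None)"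
    using assms(1) by (simp add: skeleton_def)
  then show "a \<in> J" "A = C a - X" "A \<noteq> {}" using assms(2) by (auto split: if_splits)
qed

lemma skeleton_assign_variable:
  assumes "skeleton J C V X \<Phi>"
  shows "skeleton J C V (insert x X) (assign_variable \<Phi> x s)"
  unfolding skeleton_def
proof (intro conjI allI)
  show "variables (assign_variable \<Phi> x s) = V - insert x X"
    using assms by (auto simp: skeleton_def)
  fix a
  have *: "map_option fst (clauses \<Phi> a) = (if a \<in> J \<and> C a - X \<noteq> {} then Some (C a - X) else None)"
    using assms by (simp add: skeleton_def)
  have eq: "C a - insert x X = (C a - X) - {x}" by auto
  show "map_option fst (clauses (assign_variable \<Phi> x s) a) =
    (if a \<in> J \<and> C a - insert x X \<noteq> {} then Some (C a - insert x X) else None)"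
  proof (cases "clauses \<Phi> a")
    case None
    then show ?thesis using * unfolding eq by (auto simp: assign_variable_def split: if_splits)
  next
    case (Some c)
    then obtain A b where c: "clauses \<Phi> a = Some (A, b)" by (cases c) auto
    show ?thesis using skeleton_clause[OF assms c] c unfolding eq
      by (auto simp: assign_variable_def assign_clause_def)
  qed
qed

lemma skeleton_wf:
  assumes "skeleton J C V X \<Phi>" "finite V" "finite J" "\<And>a. a \<in> J \<Longrightarrow> C a \<subseteq> V"
  shows "wf_xorsat \<Phi>"
proof -
  have "dom (clauses \<Phi>) \<subseteq> J" using skeleton_clause[OF assms(1)] by auto
  moreover have "A \<noteq> {} \<and> A \<subseteq> variables \<Phi>" if "(A, b) \<in> ran (clauses \<Phi>)" for A b
  proof -
    obtain a where a: "clauses \<Phi> a = Some (A, b)" using \<open>(A, b) \<in> _\<close> by (auto simp: ran_def)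
    show ?thesis using skeleton_clause[OF assms(1) a] assms(1,4) by (auto simp: skeleton_def)
  qed
  moreover have "finite (variables \<Phi>)" using assms(1,2) by (simp add: skeleton_def)
  ultimately show ?thesis
    using finite_subset[OF _ assms(3)] unfolding wf_xorsat_def by blast
qed

lemma satisfies_assign_variable:
  assumes "\<And>c. c \<in> ran (clauses \<Phi>) \<Longrightarrow> satisfies_clause \<omega> c" "wf_xorsat \<Phi>"
    and "c \<in> ran (clauses (assign_variable \<Phi> x (\<omega> x)))"
  shows "satisfies_clause \<omega> c"
proof -
  obtain a where "clauses (assign_variable \<Phi> x (\<omega> x)) a = Some c" using assms(3) by (auto simp: ran_def)
  then obtain A b where A: "clauses \<Phi> a = Some (A, b)" "assign_clause x (\<omega> x) (A, b) = Some c"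
    by (auto simp: assign_variable_def bind_eq_Some_conv)
  then have c: "c = (A - {x}, if x \<in> A then b \<noteq> \<omega> x else b)"
    by (auto simp: assign_clause_def split: if_splits)
  have "(A, b) \<in> ran (clauses \<Phi>)" using A by (auto simp: ran_def)
  then have sat: "odd (card {v \<in> A. \<omega> v}) = b" and fin: "finite A"
    using assms(1)[of "(A, b)"] assms(2) finite_subset[of A "variables \<Phi>"]
    unfolding satisfies_clause_def wf_xorsat_def by blast+
  have "card {v \<in> A. \<omega> v} = (if x \<in> A \<and> \<omega> x then 1 else 0) + card {v \<in> A - {x}. \<omega> v}"
  proof (cases "x \<in> A \<and> \<omega> x")
    case True
    then have "{v \<in> A. \<omega> v} = insert x {v \<in> A - {x}. \<omega> v}" by auto
    then show ?thesis using True fin by simp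
  next
    case False
    then have "{v \<in> A. \<omega> v} = {v \<in> A - {x}. \<omega> v}" by auto
    then show ?thesis using False by simp
  qed
  then show ?thesis using sat unfolding c by (auto simp: satisfies_clause_def)
qed

section \<open>Short cycles, described by pairs of paths\<close>

definition path_pair :: "(nat \<Rightarrow> nat) \<Rightarrow> nat \<Rightarrow> nat \<times> nat" where
  "path_pair p i = (if even i then (p (Suc i), p i) else (p i, p (Suc i)))"

text \<open>Even positions of a path hold variables, odd positions hold clause labels. Two paths from
  \<open>x\<close> to a common end that separate after position \<open>j\<close> use \<open>2 * d - j\<close> incidences, but only
  \<open>2 * d - j - 1\<close> nodes besides \<open>x\<close>.\<close>

definition near_cycle :: "nat set \<Rightarrow> (nat \<Rightarrow> nat set) \<Rightarrow> nat \<Rightarrow> nat \<Rightarrow> bool" where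
  "near_cycle J C R x \<longleftrightarrow> (\<exists>d\<le>R. \<exists>j<d. \<exists>p q. p 0 = x \<and> (\<forall>i\<le>j. q i = p i) \<and> q d = p d \<and>
     card (path_pair p ` {..<d} \<union> path_pair q ` {..<d}) = 2 * d - j \<and>
     path_pair p ` {..<d} \<union> path_pair q ` {..<d} \<subseteq> {(a, v). a \<in> J \<and> v \<in> C a})"

text \<open>Every initial piece of a shortest path is itself a shortest path.\<close>

lemma shortest_path_levels:
  assumes "f 0 = r" "\<And>i. i < D \<Longrightarrow> (f i, f (Suc i)) \<in> E" "rlevel E r (f D) = D" "i \<le> D"
  shows "(r, f i) \<in> E ^^ i" "rlevel E r (f i) = i"
proof -
  show 1: "(r, f i) \<in> E ^^ i"
    using assms(1,2,4) unfolding relpow_fun_conv by (intro exI[of _ f]) auto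
  have "(f i, f D) \<in> E ^^ (D - i)"
    using assms(2,4) unfolding relpow_fun_conv by (intro exI[of _ "\<lambda>l. f (i + l)"]) auto
  then have "(r, f D) \<in> E ^^ (rlevel E r (f i) + (D - i))"
    using rlevel_reach[OF 1] unfolding relpow_add by blast
  then have "D \<le> rlevel E r (f i) + (D - i)" using rlevel_le assms(3) by metis
  moreover have "rlevel E r (f i) \<le> i" using rlevel_le[OF 1] .
  ultimately show "rlevel E r (f i) = i" using assms(4) by linarith
qed

text \<open>Two parents of \<open>u\<close> give two shortest paths from \<open>x\<close> to
  \<open>u\<close>. The assumption on incidences lets \<open>\<Phi>\<close> be a reduced instance
  while \<open>J\<close> and \<open>C\<close> describe the original one, so the exceptional
  \<open>x\<close> are fixed for the whole run.\<close>

lemma near_cycle_if_not_unique_parents: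
  assumes "\<not> unique_parents (factor_edges \<Phi>) (Inl x) R"
    and sub: "\<And>v a. (Inl v, Inr a) \<in> factor_edges \<Phi> \<Longrightarrow> a \<in> J \<and> v \<in> C a"
  shows "near_cycle J C R x"
proof -
  define E where "E = factor_edges \<Phi>"
  define lev where "lev = rlevel E (Inl x)"
  obtain d u v w where d: "d < R" "(Inl x, v) \<in> E ^^ d" "(Inl x, w) \<in> E ^^ d"
    "(v, u) \<in> E" "(w, u) \<in> E" "lev u = Suc d" "v \<noteq> w"
    using assms(1) unfolding unique_parents_def E_def[symmetric] lev_def by blast
  define D where "D = Suc d"
  have path: "\<exists>f. f 0 = Inl x \<and> f d = z \<and> f D = u \<and> (\<forall>i<D. (f i, f (Suc i)) \<in> E)"
    if z: "(Inl x, z) \<in> E ^^ d" "(z, u) \<in> E" for z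
  proof -
    obtain f where f: "f 0 = Inl x" "f d = z" "\<forall>i<d. (f i, f (Suc i)) \<in> E"
      using z(1) unfolding relpow_fun_conv by blast
    show ?thesis
      by (rule exI[of _ "f(D := u)"]) (use f z(2) in \<open>auto simp: D_def less_Suc_eq\<close>)
  qed
  obtain f where f: "f 0 = Inl x" "f d = v" "f D = u" "\<And>i. i < D \<Longrightarrow> (f i, f (Suc i)) \<in> E"
    using path[OF d(2,4)] by blast
  obtain g0 where g0: "g0 0 = Inl x" "g0 d = w" "g0 D = u" "\<And>i. i < D \<Longrightarrow> (g0 i, g0 (Suc i)) \<in> E"
    using path[OF d(3,5)] by blast
  \<comment> \<open>The last position before the end where the paths agree; \<open>j < d\<close>
    because \<open>v \<noteq> w\<close>.\<close>
  define j where "j = Max {i. i \<le> d \<and> f i = g0 i}"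
  have fin: "finite {i. i \<le> d \<and> f i = g0 i}" by simp
  have "j \<in> {i. i \<le> d \<and> f i = g0 i}" unfolding j_def
    by (rule Max_in[OF fin]) (use f(1) g0(1) in auto)
  then have j: "j \<le> d" "f j = g0 j" by auto
  have j_max: "f i \<noteq> g0 i" if "j < i" "i \<le> d" for i
    using Max_ge[OF fin, of i] that unfolding j_def by fastforce
  have jd: "j < d" using j f(2) g0(2) d(7) by (cases "j = d") auto
  \<comment> \<open>The paths may separate and meet again before \<open>j\<close>; copying
    \<open>f\<close> up to there leaves a single separation.\<close>
  define g where "g = (\<lambda>i. if i \<le> j then f i else g0 i)"
  have g: "g 0 = Inl x" "g D = u" using f(1) g0(3) jd by (auto simp: g_def D_def)
  have gE: "(g i, g (Suc i)) \<in> E" if "i < D" for i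
  proof (cases "i = j")
    case True
    then show ?thesis using g0(4)[OF that] j by (simp add: g_def)
  next
    case False
    then show ?thesis using f(4)[OF that] g0(4)[OF that] by (auto simp: g_def)
  qed
  have ne: "f i \<noteq> g i" if "j < i" "i \<le> d" for i using j_max[OF that] that by (simp add: g_def)
  define val :: "nat + nat \<Rightarrow> nat" where "val = case_sum id id"
  have val_inj: "s = t" if "val s = val t" "isl s = isl t" for s t
    using that by (cases s; cases t) (auto simp: val_def)
  have node: "h i = (if even i then Inl (val (h i)) else Inr (val (h i)))" "lev (h i) = i"
    if h: "h 0 = Inl x" "h D = u" "\<And>i. i < D \<Longrightarrow> (h i, h (Suc i)) \<in> E" "i \<le> D" for h i
  proof -
    have "rlevel E (Inl x) (h D) = D" using d(6) h(2) by (simp add: lev_def D_def)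
    note * = shortest_path_levels[OF h(1) h(3) this h(4)]
    show "lev (h i) = i" using *(2) by (simp add: lev_def)
    have "isl (h i) = even i" using *(1) factor_relpow_isl by (auto simp: E_def)
    then show "h i = (if even i then Inl (val (h i)) else Inr (val (h i)))"
      by (cases "h i") (auto simp: val_def)
  qed
  \<comment> \<open>On a shortest path the smaller level of the two ends of an incidence is its
    position. Hence incidences at different positions are distinct, even across the two
    paths.\<close>
  have pair: "fst (path_pair (val \<circ> h) i) \<in> J \<and>
        snd (path_pair (val \<circ> h) i) \<in> C (fst (path_pair (val \<circ> h) i))"
      "min (lev (Inr (fst (path_pair (val \<circ> h) i)))) (lev (Inl (snd (path_pair (val \<circ> h) i)))) = i"
    if h: "h 0 = Inl x" "h D = u" "\<And>i. i < D \<Longrightarrow> (h i, h (Suc i)) \<in> E" "i < D" for h i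
  proof -
    have i: "i \<le> D" "Suc i \<le> D" using h(4) by auto
    have n1: "h i = (if even i then Inl (val (h i)) else Inr (val (h i)))" "lev (h i) = i"
      by (rule node[OF h(1-3) i(1)], assumption)+
    have n2: "h (Suc i) = (if odd i then Inl (val (h (Suc i))) else Inr (val (h (Suc i))))" "lev (h (Suc i)) = Suc i"
      using node[OF h(1-3) i(2)] by auto
    show "fst (path_pair (val \<circ> h) i) \<in> J \<and>
        snd (path_pair (val \<circ> h) i) \<in> C (fst (path_pair (val \<circ> h) i))"
    proof (cases "even i")
      case True
      then have "(Inl (val (h i)), Inr (val (h (Suc i)))) \<in> factor_edges \<Phi>"
        using n1 n2 h(3)[OF h(4)] by (simp add: E_def)
      from sub[OF this] show ?thesis using True by (simp add: path_pair_def)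
    next
      case False
      then have "(Inr (val (h i)), Inl (val (h (Suc i)))) \<in> factor_edges \<Phi>"
        using n1 n2 h(3)[OF h(4)] by (simp add: E_def)
      from sub[OF factor_edges_sym[OF this]] show ?thesis using False by (simp add: path_pair_def)
    qed
    show "min (lev (Inr (fst (path_pair (val \<circ> h) i)))) (lev (Inl (snd (path_pair (val \<circ> h) i)))) = i"
      using n1 n2 by (cases "even i") (auto simp: path_pair_def)
  qed
  define p where "p = val \<circ> f"
  define q where "q = val \<circ> g"
  note fp = pair[OF f(1,3,4), folded p_def] and gq = pair[OF g(1,2) gE, folded q_def]
  have same: "i = i'" if "path_pair p i = path_pair q i'" "i < D" "i' < D" for i i'
    using fp(2)[OF _ that(2)] gq(2)[OF _ that(3)] that(1) by simp
  have injp: "inj_on (path_pair p) {..<D}"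
    by (rule inj_onI) (metis fp(2) lessThan_iff)
  have injq: "inj_on (path_pair q) {j..<D}"
    by (rule inj_onI) (metis gq(2) atLeastLessThan_iff)
  have isl_eq: "isl (f i) = isl (g i)" if "i \<le> D" for i
    using node(1)[OF f(1,3,4) that] node(1)[OF g(1,2) gE that] by (metis sum.disc)
  have disj: "path_pair p ` {..<D} \<inter> path_pair q ` {j..<D} = {}"
  proof (rule equals0I)
    fix z assume "z \<in> path_pair p ` {..<D} \<inter> path_pair q ` {j..<D}"
    then obtain i i' where i: "i < D" "j \<le> i'" "i' < D" "path_pair p i = path_pair q i'" by force
    then have "i = i'" using same by blast
    then have pq: "p i = q i" "p (Suc i) = q (Suc i)"
      using i(4) by (auto simp: path_pair_def split: if_splits)
    have fg: "f i = g i" "f (Suc i) = g (Suc i)"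
      using val_inj[of "f i" "g i"] val_inj[of "f (Suc i)" "g (Suc i)"] pq isl_eq[of i] isl_eq[of "Suc i"] i(1)
      by (auto simp: p_def q_def)
    show False
    proof (cases "i = j")
      case True
      then show False using ne[of "Suc i"] fg(2) jd by auto
    next
      case False
      then show False using ne[of i] fg(1) i \<open>i = i'\<close> by (auto simp: D_def)
    qed
  qed
  have qp: "q i = p i" if "i \<le> j" for i using that by (simp add: p_def q_def g_def)
  have "path_pair p ` {..<D} \<union> path_pair q ` {..<D} = path_pair p ` {..<D} \<union> path_pair q ` {j..<D}"
  proof -
    have "path_pair q i = path_pair p i" if "i < j" for i using that qp by (simp add: path_pair_def)
    then have "path_pair q ` {..<j} = path_pair p ` {..<j}" by (intro image_cong) auto
    then have "path_pair q ` {..<j} \<subseteq> path_pair p ` {..<D}" using jd by (auto simp: D_def)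
    moreover have "{..<D} = {..<j} \<union> {j..<D}" using jd by (auto simp: D_def)
    then have "path_pair q ` {..<D} = path_pair q ` {..<j} \<union> path_pair q ` {j..<D}"
      by (metis image_Un)
    ultimately show ?thesis by blast
  qed
  also have "card \<dots> = D + (D - j)"
    by (subst card_Un_disjoint) (use disj injp injq in \<open>auto simp: card_image\<close>)
  also have "\<dots> = 2 * D - j" using jd by (simp add: D_def)
  finally have card: "card (path_pair p ` {..<D} \<union> path_pair q ` {..<D}) = 2 * D - j" .
  have inc: "path_pair p ` {..<D} \<union> path_pair q ` {..<D} \<subseteq> {(a, v). a \<in> J \<and> v \<in> C a}"
    using fp(1) gq(1) by (auto simp: case_prod_unfold)
  have "D \<le> R" "j < D" "p 0 = x" "q D = p D"
    using d(1) jd f(1,3) g(2) by (auto simp: D_def p_def q_def val_def)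
  then show ?thesis unfolding near_cycle_def
    using qp card inc by blast
qed

definition free_step :: "nat set \<Rightarrow> (nat \<Rightarrow> nat set) \<Rightarrow> nat \<Rightarrow> nat set \<Rightarrow> nat \<Rightarrow> bool" where
  "free_step J C R X x \<longleftrightarrow> \<not> near_cycle J C R x \<and> x \<notin> ucp_closure J C X"

text \<open>Here \<open>U\<close> is the complement of the propagation closure: a clause with
  exactly one variable outside the closure would have forced that variable into it.\<close>

lemma exact_rule_free_step:
  assumes "exact_on_trees R \<tau>" "even R" "skeleton J C V X \<Phi>"
    and fin: "finite V" "finite J" "\<And>a. a \<in> J \<Longrightarrow> C a \<subseteq> V"
    and sat: "\<And>c. c \<in> ran (clauses \<Phi>) \<Longrightarrow> satisfies_clause \<omega> c"
    and x: "x \<in> V - X" "free_step J C R X x"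
  shows "\<tau> (local_ball \<Phi> x R) = 1 / 2"
proof (rule exact_rule_half[OF assms(1,2) skeleton_wf[OF assms(3) fin] _ _ sat])
  show "x \<in> variables \<Phi>" using x(1) assms(3) by (simp add: skeleton_def)
  show "unique_parents (factor_edges \<Phi>) (Inl x) R"
  proof (rule ccontr)
    assume "\<not> unique_parents (factor_edges \<Phi>) (Inl x) R"
    then have "near_cycle J C R x"
      by (rule near_cycle_if_not_unique_parents)
        (use skeleton_clause[OF assms(3)] in \<open>fastforce simp: factor_edges_simps\<close>)
    then show False using x(2) by (simp add: free_step_def)
  qed
  show "x \<in> - ucp_closure J C X" using x(2) by (simp add: free_step_def)
  fix A b assume "(A, b) \<in> ran (clauses \<Phi>)"
  then obtain a where a: "clauses \<Phi> a = Some (A, b)" by (auto simp: ran_def)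
  show "card (A \<inter> - ucp_closure J C X) \<noteq> 1"
  proof
    assume "card (A \<inter> - ucp_closure J C X) = 1"
    then obtain v where v: "A \<inter> - ucp_closure J C X = {v}" by (auto simp: card_1_singleton_iff)
    have "C a - {v} \<subseteq> ucp_closure J C X"
      using v skeleton_clause(2)[OF assms(3) a] subset_ucp_closure[of X J C] by blast
    moreover have "v \<in> C a" using v skeleton_clause(2)[OF assms(3) a] by blast
    ultimately have "v \<in> ucp_closure J C X"
      using closed_under_ucp_closure[of J C X] skeleton_clause(1)[OF assms(3) a]
      by (auto simp: closed_under_def)
    then show False using v by blast
  qed
qed

primrec free_steps :: "nat set \<Rightarrow> (nat \<Rightarrow> nat set) \<Rightarrow> nat \<Rightarrow> nat list \<Rightarrow> nat set \<Rightarrow> nat" where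
  "free_steps J C R [] X = 0"
| "free_steps J C R (x # xs) X =
     (if free_step J C R X x then 1 else 0) + free_steps J C R xs (insert x X)"

lemma free_steps_append_ge: "free_steps J C R xs X \<le> free_steps J C R (xs @ ys) X"
  by (induction xs arbitrary: X) auto

lemma free_steps_ge:
  assumes "distinct xs"
  shows "length xs \<le> free_steps J C R xs X + forced_steps J C xs X + card {x \<in> set xs. near_cycle J C R x}"
  using assms
proof (induction xs arbitrary: X)
  case (Cons x xs)
  have "card {y \<in> set (x # xs). near_cycle J C R y} =
      (if near_cycle J C R x then 1 else 0) + card {y \<in> set xs. near_cycle J C R y}"
  proof (cases "near_cycle J C R x")
    case True
    then have "{y \<in> set (x # xs). near_cycle J C R y} = insert x {y \<in> set xs. near_cycle J C R y}"
      by auto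
    then show ?thesis using True Cons.prems by simp
  next
    case False
    then have "{y \<in> set (x # xs). near_cycle J C R y} = {y \<in> set xs. near_cycle J C R y}"
      by auto
    then show ?thesis using False by simp
  qed
  then show ?case using Cons.IH[of "insert x X"] Cons.prems by (auto simp: free_step_def)
qed simp

text \<open>A run that outputs \<open>\<omega>\<close> assigns the values of
  \<open>\<omega>\<close>, so \<open>\<omega>\<close> satisfies every reduced instance met on the
  way. Free steps thus contribute exactly \<open>1 / 2\<close>, all others at most one.\<close>

lemma pmf_dec_along_le:
  assumes "exact_on_trees R \<tau>" "even R"
    and fin: "finite V" "finite J" "\<And>a. a \<in> J \<Longrightarrow> C a \<subseteq> V"
    and "skeleton J C V X \<Phi>" "\<And>c. c \<in> ran (clauses \<Phi>) \<Longrightarrow> satisfies_clause \<omega> c"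
    and "distinct xs" "set xs \<subseteq> V - X"
  shows "pmf (dec_along \<tau> R xs \<Phi> \<sigma>) \<omega> \<le> (1 / 2) ^ free_steps J C R xs X"
  using assms(6-)
proof (induction xs arbitrary: X \<Phi> \<sigma>)
  case Nil
  then show ?case by (simp add: pmf_le_1)
next
  case (Cons x xs)
  have IH: "pmf (dec_along \<tau> R xs (assign_variable \<Phi> x (\<omega> x)) (\<sigma>(x := \<omega> x))) \<omega>
      \<le> (1 / 2) ^ free_steps J C R xs (insert x X)"
    by (rule Cons.IH[OF skeleton_assign_variable[OF Cons.prems(1)]
        satisfies_assign_variable[OF Cons.prems(2) skeleton_wf[OF Cons.prems(1) fin]]])
      (use Cons.prems in auto)
  have step: "pmf (bernoulli_pmf (\<tau> (local_ball \<Phi> x R))) (\<omega> x) \<le>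
      (1 / 2) ^ (if free_step J C R X x then 1 else 0)"
  proof (cases "free_step J C R X x")
    case True
    have "\<tau> (local_ball \<Phi> x R) = 1 / 2"
      by (rule exact_rule_free_step[OF assms(1,2) Cons.prems(1) fin Cons.prems(2) _ True])
        (use Cons.prems in auto)
    then have "pmf (bernoulli_pmf (\<tau> (local_ball \<Phi> x R))) (\<omega> x) = 1 / 2"
      by (simp only: pmf_bernoulli_half)
    then show ?thesis using True by simp
  qed (simp add: pmf_le_1)
  have "x \<notin> set xs" using Cons.prems(3) by simp
  then show ?case
    unfolding pmf_dec_along_Cons[OF \<open>x \<notin> set xs\<close>] free_steps.simps power_add
    by (intro mult_mono IH step) auto
qed

section \<open>Random clauses\<close>

text \<open>The default \<open>undefined\<close> makes the support a \<open>PiE\<close>, the index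
  set of the sum in \<open>sum_power_explore\<close>.\<close>

definition random_scopes :: "nat \<Rightarrow> nat \<Rightarrow> nat \<Rightarrow> (nat \<Rightarrow> nat set) pmf" where
  "random_scopes k n m = Pi_pmf {..<m} undefined (\<lambda>_. pmf_of_set (subsets_of_card {..<n} k))"

definition scopes :: "xorsat \<Rightarrow> nat \<Rightarrow> nat set" where
  "scopes \<Phi> = case_option undefined fst \<circ> clauses \<Phi>"

lemma subsets_of_card_ne: "k \<le> n \<Longrightarrow> subsets_of_card {..<n} k \<noteq> {}"
  using card_subsets_of_card[of "{..<n}" k] by (metis card.empty card_lessThan finite_lessThan zero_less_binomial_iff less_irrefl)

lemma random_scopes_eq:
  "k \<le> n \<Longrightarrow> random_scopes k n m = pmf_of_set (PiE {..<m} (\<lambda>_. subsets_of_card {..<n} k))"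
proof -
  assume "k \<le> n"
  have "PiE_dflt {..<m} undefined (\<lambda>_. subsets_of_card {..<n} k) = PiE {..<m} (\<lambda>_. subsets_of_card {..<n} k)"
    by (auto simp: PiE_dflt_def PiE_iff extensional_def)
  then show ?thesis unfolding random_scopes_def
    by (subst Pi_pmf_of_set) (use \<open>k \<le> n\<close> in \<open>auto simp: subsets_of_card_ne finite_subsets_of_card\<close>)
qed

lemma set_random_scopes:
  "k \<le> n \<Longrightarrow> set_pmf (random_scopes k n m) = PiE {..<m} (\<lambda>_. subsets_of_card {..<n} k)"
  by (subst random_scopes_eq)
    (auto simp: set_pmf_of_set subsets_of_card_ne finite_subsets_of_card finite_PiE PiE_eq_empty_iff)

lemma map_fst_pmf_of_set_Times:
  assumes "finite A" "A \<noteq> {}" "finite B" "B \<noteq> {}"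
  shows "map_pmf fst (pmf_of_set (A \<times> B)) = pmf_of_set A"
proof -
  have "pmf_of_set (A \<times> B) = pair_pmf (pmf_of_set A) (pmf_of_set B)"
    by (rule pmf_eqI)
      (use assms in \<open>auto simp: pmf_pair pmf_of_set[OF assms(2,1)] pmf_of_set[OF assms(4,3)] indicator_def\<close>)
  then show ?thesis by (simp add: map_fst_pair_pmf)
qed

lemma all_clauses_eq: "all_clauses k n = subsets_of_card {..<n} k \<times> UNIV"
  by (simp add: all_clauses_def subsets_of_card_def)

lemma map_scopes_random_xorsat:
  assumes "k \<le> n"
  shows "map_pmf scopes (random_xorsat k n m) = random_scopes k n m"
proof -
  have "map_pmf scopes (random_xorsat k n m) =
      map_pmf (\<lambda>h. case_option undefined fst \<circ> h)
        (Pi_pmf {..<m} None (\<lambda>_. map_pmf Some (pmf_of_set (all_clauses k n))))"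
    by (simp add: random_xorsat_def map_pmf_comp scopes_def)
  also have "\<dots> = Pi_pmf {..<m} undefined
      (\<lambda>_. map_pmf (case_option undefined fst) (map_pmf Some (pmf_of_set (all_clauses k n))))"
    by (rule Pi_pmf_map[symmetric]) auto
  also have "map_pmf (case_option undefined fst) (map_pmf Some (pmf_of_set (all_clauses k n)))
      = map_pmf fst (pmf_of_set (all_clauses k n))"
    by (simp add: map_pmf_comp)
  also have "\<dots> = pmf_of_set (subsets_of_card {..<n} k)"
    unfolding all_clauses_eq
    by (rule map_fst_pmf_of_set_Times) (use assms in \<open>auto simp: subsets_of_card_ne finite_subsets_of_card\<close>)
  finally show ?thesis by (simp add: random_scopes_def)
qed

lemma set_random_xorsat:
  assumes "k \<le> n" "\<Phi> \<in> set_pmf (random_xorsat k n m)"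
  shows "variables \<Phi> = {..<n}" "\<And>a. a < m \<Longrightarrow> \<exists>b. clauses \<Phi> a = Some (scopes \<Phi> a, b)"
    "\<And>a. a \<ge> m \<Longrightarrow> clauses \<Phi> a = None"
    "\<And>a. a < m \<Longrightarrow> scopes \<Phi> a \<subseteq> {..<n} \<and> card (scopes \<Phi> a) = k"
proof -
  have fin: "finite (all_clauses k n)" "all_clauses k n \<noteq> {}"
    using assms(1) by (auto simp: all_clauses_eq subsets_of_card_ne finite_subsets_of_card)
  obtain D where D: "\<Phi> = \<lparr>variables = {..<n}, clauses = D\<rparr>"
    "D \<in> set_pmf (Pi_pmf {..<m} None (\<lambda>_. map_pmf Some (pmf_of_set (all_clauses k n))))"
    using assms(2) by (auto simp: random_xorsat_def)
  have D': "D \<in> PiE_dflt {..<m} None (\<lambda>_. Some ` all_clauses k n)"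
    using D(2) fin by (simp add: set_Pi_pmf set_pmf_of_set comp_def)
  show "variables \<Phi> = {..<n}" using D(1) by simp
  show "clauses \<Phi> a = None" if "a \<ge> m" for a using D(1) D' that by (auto simp: PiE_dflt_def)
  fix a assume "a < m"
  then obtain A b where "D a = Some (A, b)" "(A, b) \<in> all_clauses k n"
    using D' by (auto simp: PiE_dflt_def)
  then show "\<exists>b. clauses \<Phi> a = Some (scopes \<Phi> a, b)"
    "scopes \<Phi> a \<subseteq> {..<n} \<and> card (scopes \<Phi> a) = k"
    using D(1) by (auto simp: scopes_def all_clauses_def)
qed

lemma finite_set_random_xorsat:
  assumes "k \<le> n"
  shows "finite (set_pmf (random_xorsat k n m))"
proof -
  have fin: "finite (all_clauses k n)" "all_clauses k n \<noteq> {}"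
    using assms(1) by (auto simp: all_clauses_eq subsets_of_card_ne finite_subsets_of_card)
  have "finite (set_pmf (Pi_pmf {..<m} None (\<lambda>_. map_pmf Some (pmf_of_set (all_clauses k n)))))"
    by (subst set_Pi_pmf) (use fin in \<open>auto simp: set_pmf_of_set\<close>)
  then show ?thesis by (simp add: random_xorsat_def)
qed

text \<open>The ratio of the two binomials is the product of \<open>(k - l) / (n - l)\<close> over
  \<open>l < s\<close>, and each factor is at most \<open>k / n\<close>.\<close>

lemma binomial_ratio_le:
  assumes "s \<le> k" "k \<le> n"
  shows "((n - s) choose (k - s)) * n ^ s \<le> k ^ s * (n choose k)"
  using assms(1)
proof (induction s)
  case (Suc s)
  define a where "a = n - Suc s"
  define b where "b = k - Suc s"
  have ab: "n - s = Suc a" "k - s = Suc b" using Suc.prems assms(2) by (auto simp: a_def b_def)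
  define a' where "a' = Suc a"
  define b' where "b' = Suc b"
  have "a' * (a choose b) = (a' choose b') * b'" unfolding a'_def b'_def by (rule Suc_times_binomial_eq)
  then have "(a choose b) * n * a' = (a' choose b') * (b' * n)" by (simp add: mult_ac)
  also have "b' * n \<le> k * a'"
  proof -
    have "n = a' + s" "k = b' + s" using ab Suc.prems assms(2) by (auto simp: a'_def b'_def)
    moreover have "b' \<le> a'" using assms(2) by (auto simp: a_def b_def a'_def b'_def)
    ultimately show ?thesis by (simp add: algebra_simps)
  qed
  then have "(a' choose b') * (b' * n) \<le> (a' choose b') * (k * a')" by (rule mult_le_mono2)
  finally have "((a choose b) * n) * a' \<le> (k * (a' choose b')) * a'" by (simp add: mult_ac)
  moreover have "a' > 0" by (simp add: a'_def)
  ultimately have "(a choose b) * n \<le> k * (a' choose b')" by simp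
  then have *: "(a choose b) * n \<le> k * (Suc a choose Suc b)" unfolding a'_def b'_def .
  have "(a choose b) * n ^ Suc s = ((a choose b) * n) * n ^ s" by simp
  also have "\<dots> \<le> k * (Suc a choose Suc b) * n ^ s" using * by (rule mult_le_mono1)
  also have "\<dots> = k * ((n - s choose (k - s)) * n ^ s)" by (simp add: ab)
  also have "\<dots> \<le> k * (k ^ s * (n choose k))" using Suc by (intro mult_le_mono2) auto
  finally show ?case by (simp add: a_def b_def mult.assoc)
qed simp

lemma prob_superset_le:
  assumes "0 < k" "k \<le> n" "finite B"
  shows "measure_pmf.prob (pmf_of_set (subsets_of_card {..<n} k)) {X. B \<subseteq> X} \<le> (real k / real n) ^ card B"
proof -
  let ?S = "subsets_of_card {..<n} k"
  have S: "finite ?S" "?S \<noteq> {}" "card ?S = n choose k"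
    using assms by (auto simp: subsets_of_card_ne finite_subsets_of_card card_subsets_of_card)
  have eq: "measure_pmf.prob (pmf_of_set ?S) {X. B \<subseteq> X} = real (card (?S \<inter> {X. B \<subseteq> X})) / real (n choose k)"
    using measure_pmf_of_set[OF S(2,1)] S(3) by simp
  show ?thesis
  proof (cases "B \<subseteq> {..<n} \<and> card B \<le> k")
    case True
    have "?S \<inter> {X. B \<subseteq> X} \<subseteq> (\<union>) B ` subsets_of_card ({..<n} - B) (k - card B)"
    proof
      fix X assume X: "X \<in> ?S \<inter> {X. B \<subseteq> X}"
      then have "X - B \<in> subsets_of_card ({..<n} - B) (k - card B)"
        using assms(3) by (auto simp: subsets_of_card_def card_Diff_subset)
      moreover have "X = B \<union> (X - B)" using X by auto
      ultimately show "X \<in> (\<union>) B ` subsets_of_card ({..<n} - B) (k - card B)" by (rule rev_image_eqI)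
    qed
    then have "card (?S \<inter> {X. B \<subseteq> X}) \<le> card ((\<union>) B ` subsets_of_card ({..<n} - B) (k - card B))"
      by (intro card_mono finite_imageI finite_subsets_of_card) auto
    also have "\<dots> \<le> card (subsets_of_card ({..<n} - B) (k - card B))"
      by (intro card_image_le finite_subsets_of_card) auto
    also have "\<dots> = (n - card B) choose (k - card B)"
      using True assms(3) by (simp add: card_subsets_of_card card_Diff_subset)
    finally have "card (?S \<inter> {X. B \<subseteq> X}) * n ^ card B \<le> k ^ card B * (n choose k)"
      using binomial_ratio_le[of "card B" k n] True assms(2) by (meson mult_le_mono1 order_trans)
    then have "real (card (?S \<inter> {X. B \<subseteq> X})) * real n ^ card B \<le> real k ^ card B * real (n choose k)"
      by (metis of_nat_le_iff of_nat_mult of_nat_power)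
    moreover have "real n ^ card B > 0" "real (n choose k) > 0" using assms by auto
    ultimately show ?thesis unfolding eq by (simp add: power_divide field_simps)
  next
    case False
    have "?S \<inter> {X. B \<subseteq> X} = {}"
    proof (rule equals0I)
      fix X assume X: "X \<in> ?S \<inter> {X. B \<subseteq> X}"
      then have "finite X" using finite_subset by (auto simp: subsets_of_card_def)
      then have "card B \<le> card X" using X by (auto intro: card_mono)
      then show False using X False by (auto simp: subsets_of_card_def)
    qed
    then show ?thesis unfolding eq by simp
  qed
qed

lemma prob_incidences_le:
  assumes "0 < k" "k \<le> n" "finite S" "S \<subseteq> {..<m} \<times> UNIV"
  shows "measure_pmf.prob (random_scopes k n m) {C. S \<subseteq> {(a, v). a \<in> {..<m} \<and> v \<in> C a}}
    \<le> (real k / real n) ^ card S"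
proof -
  have "{C. S \<subseteq> {(a, v). a \<in> {..<m} \<and> v \<in> C a}} = Pi {..<m} (\<lambda>a. {X. S `` {a} \<subseteq> X})"
    using assms(4) by (auto simp: Pi_iff; blast)
  then have "measure_pmf.prob (random_scopes k n m) {C. S \<subseteq> {(a, v). a \<in> {..<m} \<and> v \<in> C a}} =
      (\<Prod>a<m. measure_pmf.prob (pmf_of_set (subsets_of_card {..<n} k)) {X. S `` {a} \<subseteq> X})"
    unfolding random_scopes_def by (simp only: measure_Pi_pmf_Pi finite_lessThan)
  also have "\<dots> \<le> (\<Prod>a<m. (real k / real n) ^ card (S `` {a}))"
    by (intro prod_mono conjI prob_superset_le) (use assms in auto)
  also have "\<dots> = (real k / real n) ^ (\<Sum>a<m. card (S `` {a}))"
    by (simp add: power_sum)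
  also have "(\<Sum>a<m. card (S `` {a})) = card S"
  proof -
    have "S = Sigma {..<m} (\<lambda>a. S `` {a})" using assms(4) by auto
    then show ?thesis using card_SigmaI[of "{..<m}" "\<lambda>a. S `` {a}"] assms(3)
      by (metis finite_Image finite_lessThan)
  qed
  finally show ?thesis .
qed

lemma path_pair_image_cong:
  "(\<And>i. i \<le> d \<Longrightarrow> p i = p' i) \<Longrightarrow> path_pair p ` {..<d} = path_pair p' ` {..<d}"
  by (rule image_cong) (auto simp: path_pair_def)

text \<open>First moment over path pairs: about \<open>n ^ (2 * d - j - 1)\<close> choices, each
  present with probability at most \<open>(k / n) ^ (2 * d - j)\<close>, and at most
  \<open>R * R\<close> pairs \<open>(d, j)\<close>.\<close>

lemma prob_near_cycle_le:
  assumes "0 < k" "k \<le> n" "m \<le> n" "x < n"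
  shows "measure_pmf.prob (random_scopes k n m) {C. near_cycle {..<m} C R x}
    \<le> real (R * R * k ^ (2 * R)) / real n"
proof -
  \<comment> \<open>Paths are encoded by finite data for the union bound: \<open>g\<close> gives
    \<open>p\<close> on \<open>1..d\<close>, and \<open>h\<close> gives \<open>q\<close> strictly
    between \<open>j\<close> and \<open>d\<close>.\<close>
  define P where "P = (\<lambda>(g :: nat \<Rightarrow> nat). g(0 := x))"
  define Q where "Q = (\<lambda>d j (g :: nat \<Rightarrow> nat) (h :: nat \<Rightarrow> nat) i. if i \<le> j \<or> i = d then P g i else h i)"
  define S where "S = (\<lambda>d j g h. path_pair (P g) ` {..<d} \<union> path_pair (Q d j g h) ` {..<d})"
  define G where "G = (\<lambda>d j. (PiE {1..d} (\<lambda>_. {..<n})) \<times> (PiE {Suc j..<d} (\<lambda>_. {..<n})))"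
  define I where "I = (SIGMA d:{1..R}. {..<d})"
  define inc where "inc = (\<lambda>C :: nat \<Rightarrow> nat set. {(a, v). a \<in> {..<m} \<and> v \<in> C a})"
  define ev where "ev = (\<lambda>(d, j). \<lambda>(g, h).
     {C. card (S d j g h) = 2 * d - j \<and> S d j g h \<subseteq> {..<m} \<times> UNIV \<and> S d j g h \<subseteq> inc C})"
  let ?p = "measure_pmf.prob (random_scopes k n m)"
  have finI: "finite I" by (simp add: I_def)
  have finG: "finite (G d j)" for d j by (auto simp: G_def intro!: finite_PiE)
  have cover: "{C. near_cycle {..<m} C R x} \<inter> set_pmf (random_scopes k n m) \<subseteq>
      (\<Union>dj\<in>I. \<Union>gh\<in>G (fst dj) (snd dj). ev dj gh)"
  proof
    fix C assume C: "C \<in> {C. near_cycle {..<m} C R x} \<inter> set_pmf (random_scopes k n m)"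
    then have CV: "C a \<subseteq> {..<n}" if "a < m" for a
      using that assms(2) by (auto simp: set_random_scopes PiE_iff subsets_of_card_def)
    obtain d j p q where *: "d \<le> R" "j < d" "p 0 = x" "\<And>i. i \<le> j \<Longrightarrow> q i = p i" "q d = p d"
      "card (path_pair p ` {..<d} \<union> path_pair q ` {..<d}) = 2 * d - j"
      "path_pair p ` {..<d} \<union> path_pair q ` {..<d} \<subseteq> inc C"
      using C unfolding near_cycle_def inc_def by auto
    have bound: "s i < n" if s: "path_pair s ` {..<d} \<subseteq> inc C" "1 \<le> i" "i \<le> d" for s i
    proof -
      obtain i' where i': "i = Suc i'" "i' < d" using s(2,3) by (cases i) auto
      then have "path_pair s i' \<in> inc C" using s(1) by auto
      then have pr: "fst (path_pair s i') < m" "snd (path_pair s i') \<in> C (fst (path_pair s i'))"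
        by (auto simp: inc_def case_prod_unfold)
      \<comment> \<open>Clause labels are below \<open>m \<le> n\<close>, so labels and variables
        alike have at most \<open>n\<close> choices.\<close>
      then have "fst (path_pair s i') < n" "snd (path_pair s i') < n" using CV assms(3) by fastforce+
      then show ?thesis using i' by (auto simp: path_pair_def split: if_splits)
    qed
    define g where "g = restrict p {1..d}"
    define h where "h = restrict q {Suc j..<d}"
    have Pg: "P g i = p i" if "i \<le> d" for i using that *(3) by (auto simp: P_def g_def)
    have Qg: "Q d j g h i = q i" if "i \<le> d" for i
      using that *(4,5) Pg *(2) by (auto simp: Q_def h_def)
    have S_eq: "S d j g h = path_pair p ` {..<d} \<union> path_pair q ` {..<d}"
      unfolding S_def using path_pair_image_cong[OF Pg] path_pair_image_cong[OF Qg] by simp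
    have "(g, h) \<in> G d j" using bound[of p] bound[of q] *(7) by (auto simp: G_def g_def h_def)
    moreover have "(d, j) \<in> I" using * by (auto simp: I_def)
    moreover have "C \<in> ev (d, j) (g, h)"
      using *(6,7) by (auto simp: ev_def S_eq inc_def)
    ultimately show "C \<in> (\<Union>dj\<in>I. \<Union>gh\<in>G (fst dj) (snd dj). ev dj gh)" by force
  qed
  have ev_le: "?p (ev (d, j) gh) \<le> (real k / real n) ^ (2 * d - j)" for d j gh
  proof -
    obtain g h where gh: "gh = (g, h)" by (cases gh)
    show ?thesis
    proof (cases "card (S d j g h) = 2 * d - j \<and> S d j g h \<subseteq> {..<m} \<times> UNIV")
      case True
      have "finite (S d j g h)" by (simp add: S_def)
      then have "?p {C. S d j g h \<subseteq> inc C} \<le> (real k / real n) ^ card (S d j g h)"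
        unfolding inc_def by (intro prob_incidences_le) (use assms True in auto)
      then show ?thesis using True by (simp add: ev_def gh)
    next
      case False
      then have "ev (d, j) gh = {}" by (auto simp: ev_def gh)
      then show ?thesis by simp
    qed
  qed
  have pair_le: "(\<Sum>gh\<in>G d j. ?p (ev (d, j) gh)) \<le> real (k ^ (2 * R)) / real n" if dj: "(d, j) \<in> I" for d j
  proof -
    have d: "1 \<le> d" "d \<le> R" "j < d" using dj by (auto simp: I_def)
    have card: "card (G d j) = n ^ (2 * d - j - 1)"
    proof -
      have "card (G d j) = n ^ d * n ^ (d - Suc j)"
        by (simp add: G_def card_cartesian_product card_PiE)
      also have "\<dots> = n ^ (2 * d - j - 1)" unfolding power_add[symmetric]
        using d by (intro arg_cong[where f = "\<lambda>e. n ^ e"]) auto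
      finally show ?thesis .
    qed
    have "(\<Sum>gh\<in>G d j. ?p (ev (d, j) gh)) \<le> real (card (G d j)) * (real k / real n) ^ (2 * d - j)"
      by (rule sum_bounded_above) (rule ev_le)
    also have "\<dots> = real k ^ (2 * d - j) / real n"
    proof -
      obtain e where e: "2 * d - j = Suc e" using d by (cases "2 * d - j") auto
      have "real n > 0" using assms by simp
      then show ?thesis unfolding card e by (simp add: power_divide)
    qed
    also have "\<dots> \<le> real (k ^ (2 * R)) / real n"
      using assms(1) d by (auto intro!: divide_right_mono power_increasing)
    finally show ?thesis .
  qed
  have "?p {C. near_cycle {..<m} C R x} = ?p ({C. near_cycle {..<m} C R x} \<inter> set_pmf (random_scopes k n m))"
    by (simp add: measure_Int_set_pmf)
  also have "\<dots> \<le> ?p (\<Union>dj\<in>I. \<Union>gh\<in>G (fst dj) (snd dj). ev dj gh)"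
    by (rule measure_pmf.finite_measure_mono[OF cover]) auto
  also have "\<dots> \<le> (\<Sum>dj\<in>I. ?p (\<Union>gh\<in>G (fst dj) (snd dj). ev dj gh))"
    by (rule measure_pmf.finite_measure_subadditive_finite) (use finI in auto)
  also have "\<dots> \<le> (\<Sum>dj\<in>I. \<Sum>gh\<in>G (fst dj) (snd dj). ?p (ev dj gh))"
    by (intro sum_mono measure_pmf.finite_measure_subadditive_finite) (use finG in auto)
  also have "\<dots> \<le> (\<Sum>dj\<in>I. real (k ^ (2 * R)) / real n)"
    using pair_le by (intro sum_mono) auto
  also have "\<dots> = real (card I) * (real (k ^ (2 * R)) / real n)" by simp
  also have "card I \<le> R * R"
  proof -
    have "card I = (\<Sum>d\<in>{1..R}. d)" by (simp add: I_def)
    also have "\<dots> \<le> (\<Sum>d\<in>{1..R}. R)" by (rule sum_mono) auto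
    finally show ?thesis by simp
  qed
  then have "real (card I) * (real (k ^ (2 * R)) / real n) \<le> real (R * R) * (real (k ^ (2 * R)) / real n)"
    by (intro mult_right_mono of_nat_mono) auto
  finally show ?thesis by simp
qed

lemma finite_set_random_scopes: "k \<le> n \<Longrightarrow> finite (set_pmf (random_scopes k n m))"
  by (simp add: set_random_scopes finite_PiE finite_subsets_of_card)

text \<open>Markov's inequality; the expected number of such \<open>x\<close> is bounded
  independently of \<open>n\<close>.\<close>

lemma prob_many_near_cycles_le:
  assumes "0 < k" "k \<le> n" "m \<le> n" "0 < N"
  shows "measure_pmf.prob (random_scopes k n m) {C. N \<le> card {x. x < n \<and> near_cycle {..<m} C R x}}
    \<le> real (R * R * k ^ (2 * R)) / real N"
proof -
  let ?M = "random_scopes k n m"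
  let ?B = "{C. N \<le> card {x. x < n \<and> near_cycle {..<m} C R x}}"
  have int: "integrable ?M f" for f :: "(nat \<Rightarrow> nat set) \<Rightarrow> real"
    by (rule integrable_measure_pmf_finite) (rule finite_set_random_scopes[OF assms(2)])
  have "real N * measure_pmf.prob ?M ?B = (\<integral>C. real N * indicator ?B C \<partial>?M)" by simp
  also have "\<dots> \<le> (\<integral>C. (\<Sum>x<n. indicator {C. near_cycle {..<m} C R x} C) \<partial>?M)"
  proof (rule integral_mono[OF int int])
    fix C
    have "(\<Sum>x<n. indicator {C. near_cycle {..<m} C R x} C :: real) = real (card {x. x < n \<and> near_cycle {..<m} C R x})"
      by (simp add: indicator_def sum.If_cases lessThan_def Int_def)
    then show "real N * indicator ?B C \<le> (\<Sum>x<n. indicator {C. near_cycle {..<m} C R x} C :: real)"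
      by (simp add: indicator_def)
  qed
  also have "\<dots> = (\<Sum>x<n. measure_pmf.prob ?M {C. near_cycle {..<m} C R x})"
    by (subst Bochner_Integration.integral_sum) (auto simp: int)
  also have "\<dots> \<le> (\<Sum>x<n. real (R * R * k ^ (2 * R)) / real n)"
    by (intro sum_mono prob_near_cycle_le) (use assms in auto)
  also have "\<dots> \<le> real (R * R * k ^ (2 * R))" by simp
  finally show ?thesis using assms(4) by (simp add: field_simps)
qed

text \<open>A Chernoff bound: Markov's inequality for \<open>\<rho>\<close> to the power of the
  count, whose mean is known exactly.\<close>

lemma prob_explore_ge_le:
  fixes \<rho> :: real
  assumes "1 \<le> \<rho>" "2 \<le> k" "k \<le> n" "i \<le> n" "A \<subseteq> {..<n}"
  shows "measure_pmf.prob (random_scopes k n m) {C. D \<le> explore i {..<n} A {..<m} C}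
    \<le> (clause_weight \<rho> n i k / real (n choose k)) ^ m / \<rho> ^ D"
proof -
  let ?S = "PiE {..<m} (\<lambda>_. subsets_of_card {..<n} k)"
  let ?B = "{C. D \<le> explore i {..<n} A {..<m} C}"
  have S: "finite ?S" "?S \<noteq> {}" "card ?S = (n choose k) ^ m"
    using assms(3) by (auto simp: finite_PiE finite_subsets_of_card PiE_eq_empty_iff subsets_of_card_ne
        card_PiE card_subsets_of_card)
  have "real (card (?S \<inter> ?B)) * \<rho> ^ D = (\<Sum>C\<in>?S \<inter> ?B. \<rho> ^ D)" by simp
  also have "\<dots> \<le> (\<Sum>C\<in>?S \<inter> ?B. \<rho> ^ explore i {..<n} A {..<m} C)"
    by (intro sum_mono power_increasing) (use assms in auto)
  also have "\<dots> \<le> (\<Sum>C\<in>?S. \<rho> ^ explore i {..<n} A {..<m} C)"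
    by (intro sum_mono2) (use S(1) assms(1) in auto)
  also have "\<dots> = clause_weight \<rho> n i k ^ m"
    using sum_power_explore[of "{..<n}" i A "{..<m}" "\<lambda>_. k" \<rho>] assms by simp
  finally have "real (card (?S \<inter> ?B)) * \<rho> ^ D \<le> clause_weight \<rho> n i k ^ m" .
  moreover have "measure_pmf.prob (random_scopes k n m) ?B = real (card (?S \<inter> ?B)) / real ((n choose k) ^ m)"
    unfolding random_scopes_eq[OF assms(3)] using measure_pmf_of_set[OF S(2,1)] S(3) by simp
  moreover have "real (n choose k) > 0" "\<rho> ^ D > 0" using assms by auto
  ultimately show ?thesis by (simp add: power_divide field_simps)
qed

section \<open>Expected number of solutions\<close>

lemma card_satisfied_clauses:
  "card {c \<in> all_clauses k n. satisfies_clause \<sigma> c} = card (subsets_of_card {..<n} k)"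
proof -
  have "{c \<in> all_clauses k n. satisfies_clause \<sigma> c} =
      (\<lambda>A. (A, odd (card {v \<in> A. \<sigma> v}))) ` subsets_of_card {..<n} k"
    by (auto simp: all_clauses_eq satisfies_clause_def)
  then show ?thesis by (simp add: card_image inj_on_def)
qed

lemma prob_satisfied_le:
  assumes "k \<le> n"
  shows "measure_pmf.prob (random_xorsat k n m) {\<Phi>. \<forall>c\<in>ran (clauses \<Phi>). satisfies_clause \<sigma> c}
    \<le> (1 / 2) ^ m"
proof -
  have fin: "finite (all_clauses k n)" "all_clauses k n \<noteq> {}"
    "card (all_clauses k n) = 2 * card (subsets_of_card {..<n} k)"
    using assms(1) by (auto simp: all_clauses_eq subsets_of_card_ne finite_subsets_of_card card_cartesian_product)
  let ?M = "Pi_pmf {..<m} None (\<lambda>_. map_pmf Some (pmf_of_set (all_clauses k n)))"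
  let ?G = "{o'. \<forall>c. o' = Some c \<longrightarrow> satisfies_clause \<sigma> c}"
  have half: "measure_pmf.prob (map_pmf Some (pmf_of_set (all_clauses k n))) ?G = 1 / 2"
  proof -
    have "card (subsets_of_card {..<n} k) > 0"
      using assms by (simp add: card_gt_0_iff subsets_of_card_ne finite_subsets_of_card)
    moreover have "all_clauses k n \<inter> Some -` ?G = {c \<in> all_clauses k n. satisfies_clause \<sigma> c}" by auto
    ultimately show ?thesis
      using measure_pmf_of_set[OF fin(2,1), of "Some -` ?G"] fin(3) card_satisfied_clauses[of k n \<sigma>]
      by simp
  qed
  have "measure_pmf.prob (random_xorsat k n m) {\<Phi>. \<forall>c\<in>ran (clauses \<Phi>). satisfies_clause \<sigma> c}
      = measure_pmf.prob ?M {D. \<forall>c\<in>ran D. satisfies_clause \<sigma> c}"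
    by (simp add: random_xorsat_def vimage_def)
  also have "\<dots> \<le> measure_pmf.prob ?M (Pi {..<m} (\<lambda>_. ?G))"
    by (rule measure_pmf.finite_measure_mono) (auto simp: ran_def)
  also have "\<dots> = (\<Prod>a<m. 1 / 2)"
    by (simp only: measure_Pi_pmf_Pi finite_lessThan half)
  finally show ?thesis by simp
qed

lemma expected_solutions_le:
  assumes "k \<le> n"
  shows "measure_pmf.expectation (random_xorsat k n m) (\<lambda>\<Phi>. real (card (solutions \<Phi>))) \<le> 2 ^ n * (1 / 2) ^ m"
proof -
  let ?M = "random_xorsat k n m"
  let ?F = "PiE {..<n} (\<lambda>_. UNIV :: bool set)"
  let ?E = "\<lambda>\<sigma>. {\<Phi>. \<forall>c\<in>ran (clauses \<Phi>). satisfies_clause \<sigma> c}"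
  have fF: "finite ?F" "card ?F = 2 ^ n" by (auto simp: finite_PiE card_PiE)
  have int: "integrable ?M f" for f :: "xorsat \<Rightarrow> real"
    by (rule integrable_measure_pmf_finite) (rule finite_set_random_xorsat[OF assms])
  have "measure_pmf.expectation ?M (\<lambda>\<Phi>. real (card (solutions \<Phi>))) =
      measure_pmf.expectation ?M (\<lambda>\<Phi>. \<Sum>\<sigma>\<in>?F. indicator (?E \<sigma>) \<Phi>)"
  proof (rule integral_cong_AE)
    show "AE \<Phi> in ?M. real (card (solutions \<Phi>)) = (\<Sum>\<sigma>\<in>?F. indicator (?E \<sigma>) \<Phi>)"
    proof (rule AE_pmfI)
      fix \<Phi> assume "\<Phi> \<in> set_pmf ?M"
      then have "solutions \<Phi> = ?F \<inter> {\<sigma>. \<Phi> \<in> ?E \<sigma>}"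
        using set_random_xorsat(1)[OF assms] by (auto simp: solutions_def)
      then show "real (card (solutions \<Phi>)) = (\<Sum>\<sigma>\<in>?F. indicator (?E \<sigma>) \<Phi>)"
        using fF(1) by (simp add: indicator_def sum.If_cases)
    qed
  qed auto
  also have "\<dots> = (\<Sum>\<sigma>\<in>?F. measure_pmf.prob ?M (?E \<sigma>))"
    by (subst Bochner_Integration.integral_sum) (auto simp: int)
  also have "\<dots> \<le> (\<Sum>\<sigma>\<in>?F. (1 / 2) ^ m)"
    by (intro sum_mono prob_satisfied_le assms)
  finally show ?thesis using fF by simp
qed

lemma measure_bind_pmf_eq:
  "measure_pmf.prob (bind_pmf M f) A = measure_pmf.expectation M (\<lambda>x. measure_pmf.prob (f x) A)"
  unfolding bind_pmf.rep_eq
  by (auto simp: measure_pmf.measure_bind[where N = "count_space UNIV"] measure_subprob)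

lemma measure_bind_pmf_le:
  assumes "\<And>x. x \<in> set_pmf M \<Longrightarrow> measure_pmf.prob (f x) A \<le> B"
  shows "measure_pmf.prob (bind_pmf M f) A \<le> B"
proof -
  have "measure_pmf.expectation M (\<lambda>x. measure_pmf.prob (f x) A) \<le> measure_pmf.expectation M (\<lambda>_. B)"
    by (rule integral_mono_AE)
      (use assms in \<open>auto intro!: measure_pmf.integrable_const_bound[where B = 1] simp: AE_measure_pmf_iff\<close>)
  then show ?thesis by (simp add: measure_bind_pmf_eq)
qed

section \<open>Numerical bounds\<close>

text \<open>The second-order term will make up for the exponent \<open>k - 1\<close> in place of
  \<open>k\<close>.\<close>

lemma one_minus_le_exp_quadratic:
  fixes x :: real
  assumes "0 \<le> x" "x < 1"
  shows "1 - x \<le> exp (- x - x\<^sup>2 / 2)"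
proof -
  define f where "f = (\<lambda>t. ln (1 - t) + t + t\<^sup>2 / 2 :: real)"
  have "f x \<le> f 0"
  proof (rule DERIV_nonpos_imp_nonincreasing[OF assms(1)])
    fix t assume t: "0 \<le> t" "t \<le> x"
    then have "(f has_real_derivative (- t\<^sup>2 / (1 - t))) (at t)"
      unfolding f_def using assms(2)
      by (auto intro!: derivative_eq_intros simp: field_simps power2_eq_square)
    moreover have "- t\<^sup>2 / (1 - t) \<le> 0" using t assms(2) by (simp add: divide_nonpos_pos)
    ultimately show "\<exists>y. (f has_real_derivative y) (at t) \<and> y \<le> 0" by blast
  qed
  then have "ln (1 - x) \<le> - x - x\<^sup>2 / 2" by (simp add: f_def)
  then show ?thesis using assms(2) by (metis diff_gt_0_iff_gt exp_le_cancel_iff exp_ln)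
qed

text \<open>\<open>3.57 = 4.87 - 1.3\<close> is the least value of \<open>u\<close> below. The bound
  uses \<open>33.1\<close> squared against \<open>2.718 ^ 7\<close> for \<open>exp (7 / 2)\<close>,
  and a Taylor polynomial for the remaining \<open>0.07\<close>.\<close>

lemma exp_neg_3_57: "exp (- (357 / 100)) \<le> (282 / 10000 :: real)"
proof -
  have e: "exp 1 \<ge> (2718 / 1000 :: real)" using e_approx_32 by (simp add: abs_if split: if_split_asm)
  have "(331 / 10 :: real) \<^sup>2 \<le> (2718 / 1000) ^ 7" by (simp add: power_divide)
  also have "\<dots> \<le> exp 1 ^ 7" by (rule power_mono) (use e in auto)
  also have "\<dots> = (exp (7 / 2)) \<^sup>2" by (simp flip: exp_of_nat_mult)
  finally have "331 / 10 \<le> exp (7 / 2 :: real)" by (rule power2_le_imp_le) simp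
  moreover have "1 + 7 / 100 + (7 / 100)\<^sup>2 / 2 \<le> exp (7 / 100 :: real)"
    by (rule exp_lower_Taylor_quadratic) simp
  ultimately have "(331 / 10) * (1 + 7 / 100 + (7 / 100)\<^sup>2 / 2) \<le> exp (7 / 2) * exp (7 / 100 :: real)"
    by (intro mult_mono) auto
  also have "\<dots> = exp (357 / 100)" by (simp flip: exp_add)
  finally have "10000 / 282 \<le> exp (357 / 100 :: real)" by (simp add: power2_eq_square)
  then show ?thesis by (simp add: exp_minus field_simps)
qed

text \<open>The fraction of \<open>k\<close>-sets with at least \<open>k - 1\<close> elements in a set of density \<open>y\<close>.\<close>

definition almost_inside :: "nat \<Rightarrow> real \<Rightarrow> real" where
  "almost_inside k y = y ^ k + real k * y ^ (k - 1) * (1 - y)"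

text \<open>With \<open>c = k r\<close> the choice is \<open>y = 1 - (c - 1.3) / k\<close>, which makes the claim an inequality
  between functions of \<open>c\<close> that holds for all \<open>c \<ge> 4.83\<close>.\<close>

lemma overconstrained_density_exists:
  fixes r :: real
  assumes "13 \<le> k" "487 / 100 \<le> real k * r" "r \<le> 1"
  shows "\<exists>y. 0 < y \<and> y < 1 \<and> 2 * r * almost_inside k y + (1 - y) < r"
proof -
  define c where "c = real k * r"
  define u where "u = c - 13 / 10"
  define y where "y = 1 - u / real k"
  have k: "real k \<ge> 13" using assms(1) by simp
  have r: "r = c / real k" using k by (simp add: c_def)
  have c: "487 / 100 \<le> c" "c \<le> real k"
    using assms k mult_left_mono[of r 1 "real k"] by (auto simp: c_def)
  have u: "357 / 100 \<le> u" "u < real k" using c by (auto simp: u_def)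
  have y: "0 < y" "y < 1" using u k by (auto simp: y_def)
  have pow: "y ^ (k - 1) \<le> exp (- u)"
  proof -
    define x where "x = u / real k"
    have x: "0 \<le> x" "x < 1" using u k by (auto simp: x_def)
    have "y ^ (k - 1) \<le> exp (- x - x\<^sup>2 / 2) ^ (k - 1)"
      using one_minus_le_exp_quadratic[OF x] y by (intro power_mono) (auto simp: y_def x_def)
    also have "\<dots> = exp (real (k - 1) * (- x - x\<^sup>2 / 2))" by (simp add: exp_of_nat_mult)
    also have "\<dots> \<le> exp (- u)"
    proof -
      have ux: "u = real k * x" using k by (simp add: x_def)
      have k1: "real (k - 1) = real k - 1" using assms(1) by simp
      have "real k * x \<ge> 357 / 100" using u ux by simp
      moreover have "x \<ge> 0" by (rule x)
      \<comment> \<open>The factor in parentheses is \<open>u - x - 2\<close>, positive because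
        \<open>u \<ge> 3.57\<close> and \<open>x < 1\<close>.\<close>
      moreover have "real k * (x * x) - x * x - 2 * x = x * (real k * x - x - 2)" by (simp add: algebra_simps)
      ultimately have "real k * (x * x) - x * x - 2 * x \<ge> 0" using x by simp
      then have "real (k - 1) * (- x - x\<^sup>2 / 2) \<le> - u" unfolding ux k1 by (simp add: power2_eq_square algebra_simps)
      then show ?thesis by simp
    qed
    finally show ?thesis .
  qed
  have "almost_inside k y = y ^ (k - 1) * (y + real k * (1 - y))"
    using assms(1) by (cases k) (auto simp: almost_inside_def algebra_simps)
  also have "\<dots> \<le> exp (- u) * (1 + u)"
  proof (rule mult_mono[OF pow])
    have "real k * (1 - y) = u" using k by (simp add: y_def)
    then show "y + real k * (1 - y) \<le> 1 + u" "0 \<le> y + real k * (1 - y)" using y u by auto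
  qed auto
  finally have ai: "almost_inside k y \<le> exp (- u) * (1 + u)" .
  \<comment> \<open>The excess over the extreme case. Replacing \<open>exp s\<close> by its
    quadratic Taylor polynomial leaves only polynomials in \<open>s\<close>.\<close>
  define s where "s = c - 487 / 100"
  have s: "0 \<le> s" using c by (simp add: s_def)
  have eu: "exp (- u) * (1 + s + s\<^sup>2 / 2) \<le> 282 / 10000"
  proof -
    have "exp (- u) = exp (- (357 / 100)) * exp (- s)"
      by (simp add: u_def s_def flip: exp_add)
    moreover have "exp (- s) * (1 + s + s\<^sup>2 / 2) \<le> exp (- s) * exp s"
      by (rule mult_left_mono) (use exp_lower_Taylor_quadratic[OF s] in auto)
    then have "exp (- s) * (1 + s + s\<^sup>2 / 2) \<le> 1" by (simp flip: exp_add)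
    ultimately have "exp (- u) * (1 + s + s\<^sup>2 / 2) \<le> exp (- (357 / 100)) * 1"
      by (simp add: mult.assoc mult_left_mono)
    then show ?thesis using exp_neg_3_57 by simp
  qed
  \<comment> \<open>Multiplied by \<open>k\<close>, the goal is
    \<open>2 * c * almost_inside k y < c - u = 13 / 10\<close>. Both sides here are quadratics in
    \<open>s\<close> and are compared coefficient by coefficient.\<close>
  have "2 * c * (1 + u) * (282 / 10000) < 13 / 10 * (1 + s + s\<^sup>2 / 2)"
  proof -
    have "2 * c * (1 + u) * (282 / 10000) =
        2 * (487 / 100 * (457 / 100) + (944 / 100) * s + s\<^sup>2) * (282 / 10000)"
      by (simp add: u_def s_def power2_eq_square field_simps)
    also have "\<dots> < 13 / 10 * (1 + s + s\<^sup>2 / 2)"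
    proof -
      have "2 * (487 / 100 * (457 / 100) + 944 / 100 * s + w) * (282 / 10000) < 13 / 10 * (1 + s + w / 2)"
        if "0 \<le> w" for w
        using s that by (simp add: field_simps)
      then show ?thesis by simp
    qed
    finally show ?thesis .
  qed
  moreover have "2 * c * (1 + u) * (exp (- u) * (1 + s + s\<^sup>2 / 2)) \<le> 2 * c * (1 + u) * (282 / 10000)"
    by (rule mult_left_mono[OF eu]) (use c u in auto)
  ultimately have "2 * c * (1 + u) * (exp (- u) * (1 + s + s\<^sup>2 / 2)) < 13 / 10 * (1 + s + s\<^sup>2 / 2)"
    by (rule le_less_trans[rotated])
  then have "(2 * c * (1 + u) * exp (- u)) * (1 + s + s\<^sup>2 / 2) < 13 / 10 * (1 + s + s\<^sup>2 / 2)"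
    by (simp only: mult.assoc)
  moreover have "1 + s + s\<^sup>2 / 2 > 0" using s by (simp add: add_pos_nonneg)
  ultimately have "2 * c * (1 + u) * exp (- u) < 13 / 10" by (simp only: mult_less_cancel_right_pos)
  moreover have "2 * c * almost_inside k y \<le> 2 * c * (exp (- u) * (1 + u))"
    by (rule mult_left_mono[OF ai]) (use c in auto)
  moreover have "2 * c * (exp (- u) * (1 + u)) = 2 * c * (1 + u) * exp (- u)" by (simp only: mult_ac)
  ultimately have "2 * c * almost_inside k y < 13 / 10" by linarith
  then have "2 * c * almost_inside k y + u < c" by (simp add: u_def)
  then have "(2 * c * almost_inside k y + u) / real k < c / real k"
    using k by (intro divide_strict_right_mono) auto
  then have "2 * r * almost_inside k y + (1 - y) < r"
    unfolding r by (simp add: y_def add_divide_distrib)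
  then show ?thesis using y by blast
qed

section \<open>A lower bound for \<open>r_core\<close>\<close>

lemma ln_ge_if_power_ge:
  fixes x :: real
  assumes "0 < b" "0 < x" "(272 / 100) ^ a \<le> x ^ b"
  shows "real a / real b \<le> ln x"
proof -
  have "exp (real a) = exp 1 ^ a" by (simp flip: exp_of_nat_mult)
  also have "\<dots> \<le> (272 / 100) ^ a" by (rule power_mono) (use e_less_272 in auto)
  finally have "exp (real a) \<le> x ^ b" using assms(3) by simp
  then have "real a \<le> ln (x ^ b)" using assms(2) by (simp add: ln_ge_iff)
  then show ?thesis using assms(1,2) by (simp add: ln_realpow field_simps)
qed

text \<open>On \<open>[a, b]\<close>, a tangent of the convex function \<open>- ln\<close> is compared with a chord of \<open>(1 - q) ^ 12\<close>.\<close>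

lemma neg_ln_gt_power_segment:
  fixes q :: real
  assumes "0 < q" "a \<le> q" "q \<le> b" "a < b" "0 < p" "l \<le> - ln p"
    and "c * (1 - a) ^ 12 < l + 1 - a / p" "c * (1 - b) ^ 12 < l + 1 - b / p" "0 < c"
  shows "c * (1 - q) ^ 12 < - ln q"
proof -
  define t where "t = (q - a) / (b - a)"
  have t: "0 \<le> t" "t \<le> 1" using assms by (auto simp: t_def)
  have q: "q = (1 - t) * a + t * b" 
  proof -
    have "t * (b - a) = q - a" using assms(4) by (simp add: t_def)
    then show ?thesis by (simp add: algebra_simps)
  qed
  have "convex_on UNIV (\<lambda>x :: real. x ^ 12)" by (rule convex_power_even) simp
  from convex_onD[OF this t, of "1 - a" "1 - b"]
  have "((1 - t) * (1 - a) + t * (1 - b)) ^ 12 \<le> (1 - t) * (1 - a) ^ 12 + t * (1 - b) ^ 12" by simp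
  moreover have "(1 - t) * (1 - a) + t * (1 - b) = 1 - q" unfolding q by (simp add: algebra_simps)
  ultimately have "(1 - q) ^ 12 \<le> (1 - t) * (1 - a) ^ 12 + t * (1 - b) ^ 12" by simp
  then have "c * (1 - q) ^ 12 \<le> c * ((1 - t) * (1 - a) ^ 12 + t * (1 - b) ^ 12)"
    using assms(9) by simp
  also have "\<dots> = (1 - t) * (c * (1 - a) ^ 12) + t * (c * (1 - b) ^ 12)" by (simp add: algebra_simps)
  also have "\<dots> < (1 - t) * (l + 1 - a / p) + t * (l + 1 - b / p)"
  proof (cases "t = 0")
    case False
    then show ?thesis using t assms(7,8)
      by (intro add_le_less_mono mult_left_mono mult_strict_left_mono) auto
  qed (use assms(7) in simp)
  also have "\<dots> = l + 1 - q / p" unfolding q by (simp add: algebra_simps add_divide_distrib diff_divide_distrib)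
  also have "\<dots> \<le> - ln q"
  proof -
    \<comment> \<open>The tangent touches \<open>- ln\<close> at \<open>p\<close>; the number
      \<open>l\<close> stands in for \<open>- ln p\<close>.\<close>
    have "ln (q / p) \<le> q / p - 1" by (rule ln_le_minus_one) (use assms in auto)
    then show ?thesis using assms by (simp add: ln_div)
  qed
  finally show ?thesis .
qed

text \<open>With \<open>Q = 1 - q\<close> this is the core condition for \<open>k = 13\<close> and
  \<open>k r = 4.87\<close>. It is tightest near \<open>q = 0.02\<close>, hence the tangent point
  \<open>1 / 50\<close> on the first segment. From \<open>1 / 2\<close> on,
  \<open>- ln q \<ge> 1 - q\<close> is enough.\<close>

lemma neg_ln_gt_power:
  fixes q :: real
  assumes "0 < q" "q < 1"
  shows "487 / 100 * (1 - q) ^ 12 < - ln q"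
proof -
  have l50: "39 / 10 \<le> - ln (1 / 50 :: real)"
    using ln_ge_if_power_ge[of 10 50 39] by (simp add: ln_div power_divide)
  have l25: "32 / 10 \<le> - ln (1 / 25 :: real)"
    using ln_ge_if_power_ge[of 5 25 16] by (simp add: ln_div power_divide)
  have l5: "16 / 10 \<le> - ln (1 / 5 :: real)"
    using ln_ge_if_power_ge[of 5 5 8] by (simp add: ln_div power_divide)
  consider "q \<le> 3 / 100" | "3 / 100 \<le> q" "q \<le> 12 / 100" | "12 / 100 \<le> q" "q \<le> 1 / 2" | "1 / 2 \<le> q"
    by linarith
  then show ?thesis
  proof cases
    case 1
    show ?thesis
      by (rule neg_ln_gt_power_segment[of q 0 "3 / 100" "1 / 50" "39 / 10"]) (use assms 1 l50 in \<open>auto simp: power_divide\<close>)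
  next
    case 2
    show ?thesis
      by (rule neg_ln_gt_power_segment[of q "3 / 100" "12 / 100" "1 / 25" "32 / 10"]) (use assms 2 l25 in \<open>auto simp: power_divide\<close>)
  next
    case 3
    show ?thesis
      by (rule neg_ln_gt_power_segment[of q "12 / 100" "1 / 2" "1 / 5" "16 / 10"]) (use assms 3 l5 in \<open>auto simp: power_divide\<close>)
  next
    case 4
    have "(1 - q) ^ 11 \<le> (1 / 2) ^ 11" by (rule power_mono) (use 4 assms in auto)
    then have "487 / 100 * (1 - q) ^ 11 < 1" by (simp add: power_divide)
    then have "(487 / 100 * (1 - q) ^ 11) * (1 - q) < 1 * (1 - q)"
      using assms by (intro mult_strict_right_mono) auto
    also have "(487 / 100 * (1 - q) ^ 11) * (1 - q) = 487 / 100 * (1 - q) ^ 12"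
      by (simp add: power_Suc2[symmetric] mult.assoc flip: power_Suc2)
    finally show ?thesis using ln_le_minus_one[of q] assms by simp
  qed
qed

text \<open>For \<open>k = 13\<close> the true value of \<open>k r_core(k)\<close> is about \<open>4.98\<close>.\<close>

lemma r_core_ge:
  assumes "13 \<le> k"
  shows "487 / 100 / real k \<le> r_core k"
  unfolding r_core_def
proof (rule cSup_upper)
  show "bdd_above {r \<in> {0..1}. \<forall>Q\<in>{0<..<1}. 1 - exp (- (real k * r * Q ^ (k - 1))) < Q}"
    by (rule bdd_aboveI[of _ 1]) auto
  have k: "real k \<ge> 13" using assms by simp
  have "1 - exp (- (real k * (487 / 100 / real k) * Q ^ (k - 1))) < Q" if Q: "0 < Q" "Q < 1" for Q
  proof -
    \<comment> \<open>With \<open>k r\<close> held fixed, the condition gets weaker as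
      \<open>k\<close> grows, so \<open>k = 13\<close> decides.\<close>
    have "487 / 100 * Q ^ (k - 1) \<le> 487 / 100 * Q ^ 12"
      by (intro mult_left_mono power_decreasing) (use Q assms in auto)
    also have "\<dots> < - ln (1 - Q)" using neg_ln_gt_power[of "1 - Q"] Q by simp
    finally have "ln (1 - Q) < - (487 / 100 * Q ^ (k - 1))" by simp
    then have "1 - Q < exp (- (487 / 100 * Q ^ (k - 1)))"
      using Q by (metis diff_gt_0_iff_gt exp_less_cancel_iff exp_ln)
    then show ?thesis using k by simp
  qed
  then show "487 / 100 / real k \<in> {r \<in> {0..1}. \<forall>Q\<in>{0<..<1}. 1 - exp (- (real k * r * Q ^ (k - 1))) < Q}"
    using k by auto
qed

section \<open>Limits of binomial ratios\<close>

lemma tendsto_binomial_scaled: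
  fixes X :: "nat \<Rightarrow> nat"
  assumes "(\<lambda>n. real (X n) / real n) \<longlonglongrightarrow> y"
  shows "(\<lambda>n. real (X n choose k) / real n ^ k) \<longlonglongrightarrow> y ^ k / fact k"
proof -
  have "(\<lambda>n. (\<Prod>l=0..<k. real (X n) / real n - real l / real n) / fact k) \<longlonglongrightarrow> (\<Prod>l=0..<k. y - 0) / fact k"
    by (intro tendsto_intros assms lim_const_over_n) auto
  moreover have "(\<Prod>l=0..<k. real (X n) / real n - real l / real n) / fact k = real (X n choose k) / real n ^ k" for n
  proof -
    have "(\<Prod>l=0..<k. real (X n) / real n - real l / real n) = (\<Prod>l=0..<k. real (X n) - real l) / real n ^ k"
      by (simp add: diff_divide_distrib[symmetric] prod_dividef)
    then show ?thesis by (simp add: binomial_gbinomial gbinomial_prod_rev)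
  qed
  ultimately show ?thesis by simp
qed

lemma tendsto_almost_inside:
  fixes X :: "nat \<Rightarrow> nat"
  assumes "(\<lambda>n. real (X n) / real n) \<longlonglongrightarrow> y" "0 < k"
  shows "(\<lambda>n. (real (X n choose k) + real (X n choose (k - 1)) * (real n - real (X n))) / real (n choose k))
    \<longlonglongrightarrow> almost_inside k y"
proof -
  have one: "(\<lambda>n. real n / real n) \<longlonglongrightarrow> 1"
    by (rule tendsto_eventually) (auto intro: eventually_mono[OF eventually_gt_at_top[of 0]])
  have "(\<lambda>n. (real (X n choose k) / real n ^ k + real (X n choose (k - 1)) / real n ^ (k - 1) * (real n / real n - real (X n) / real n))
      / (real (n choose k) / real n ^ k)) \<longlonglongrightarrow> (y ^ k / fact k + y ^ (k - 1) / fact (k - 1) * (1 - y)) / (1 ^ k / fact k)"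
    by (intro tendsto_intros tendsto_binomial_scaled assms one) auto
  also have "(y ^ k / fact k + y ^ (k - 1) / fact (k - 1) * (1 - y)) / (1 ^ k / fact k) = almost_inside k y"
  proof -
    obtain k' where k': "k = Suc k'" using assms(2) by (cases k) auto
    have *: "(A / (K * F) + B / F * z) / (1 / (K * F)) = A + K * B * z"
      if "K \<noteq> 0" "F \<noteq> 0" for A B F K z :: real
      using that by (simp add: field_simps)
    show ?thesis unfolding almost_inside_def k'
      using *[of "real (Suc k')" "fact k'" "y ^ Suc k'" "y ^ k'" "1 - y"] by simp
  qed
  finally show ?thesis
  proof (rule Lim_transform_eventually)
    show "\<forall>\<^sub>F n in sequentially. (real (X n choose k) / real n ^ k + real (X n choose (k - 1)) / real n ^ (k - 1) * (real n / real n - real (X n) / real n))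
      / (real (n choose k) / real n ^ k) = (real (X n choose k) + real (X n choose (k - 1)) * (real n - real (X n))) / real (n choose k)"
      using eventually_gt_at_top[of 0]
    proof eventually_elim
      case (elim n)
      obtain k' where k': "k = Suc k'" using assms(2) by (cases k) auto
      have "real (X n choose k) / real n ^ k + real (X n choose (k - 1)) / real n ^ (k - 1) * (real n / real n - real (X n) / real n)
        = (real (X n choose k) + real (X n choose (k - 1)) * (real n - real (X n))) / real n ^ k"
        using elim unfolding k' by (simp add: field_simps)
      then show ?case using elim by simp
    qed
  qed
qed

section \<open>Success probability\<close>

lemma prob_dec_along_solutions_le:
  assumes "exact_on_trees R \<tau>" "even R" "2 \<le> k" "k \<le> n" "\<Phi> \<in> set_pmf (random_xorsat k n m)"
    and "distinct xs" "set xs = {..<n}"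
  shows "measure_pmf.prob (dec_along \<tau> R xs \<Phi> \<sigma>) (solutions \<Phi>)
    \<le> real (card (solutions \<Phi>)) * (1 / 2) ^ free_steps {..<m} (scopes \<Phi>) R xs {}"
proof -
  note \<Phi> = set_random_xorsat[OF assms(4,5)]
  have fin: "finite (solutions \<Phi>)" unfolding solutions_def \<Phi>(1)
    by (rule finite_subset[OF Collect_restrict]) (simp add: finite_PiE)
  have sk: "skeleton {..<m} (scopes \<Phi>) {..<n} {} \<Phi>"
    unfolding skeleton_def
  proof (intro conjI allI)
    show "variables \<Phi> = {..<n} - {}" using \<Phi>(1) by simp
    fix a
    show "map_option fst (clauses \<Phi> a) =
      (if a \<in> {..<m} \<and> scopes \<Phi> a - {} \<noteq> {} then Some (scopes \<Phi> a - {}) else None)"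
    proof (cases "a < m")
      case True
      then have "scopes \<Phi> a \<noteq> {}" using \<Phi>(4)[OF True] assms(3) by auto
      then show ?thesis using \<Phi>(2)[OF True] True by auto
    next
      case False
      then show ?thesis using \<Phi>(3)[of a] by simp
    qed
  qed
  have "measure_pmf.prob (dec_along \<tau> R xs \<Phi> \<sigma>) (solutions \<Phi>)
      = (\<Sum>\<omega>\<in>solutions \<Phi>. pmf (dec_along \<tau> R xs \<Phi> \<sigma>) \<omega>)"
    by (rule measure_measure_pmf_finite[OF fin])
  also have "\<dots> \<le> real (card (solutions \<Phi>)) * (1 / 2) ^ free_steps {..<m} (scopes \<Phi>) R xs {}"
  proof (rule sum_bounded_above)
    fix \<omega> assume "\<omega> \<in> solutions \<Phi>"
    then have sat: "satisfies_clause \<omega> c" if "c \<in> ran (clauses \<Phi>)" for c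
      using that by (simp add: solutions_def)
    show "pmf (dec_along \<tau> R xs \<Phi> \<sigma>) \<omega> \<le> (1 / 2) ^ free_steps {..<m} (scopes \<Phi>) R xs {}"
      by (rule pmf_dec_along_le[OF assms(1,2) _ _ _ sk sat assms(6)]) (use \<Phi>(4) assms(7) in auto)
  qed
  finally show ?thesis .
qed

text \<open>Fewer than \<open>D\<close> counted clauses let exploration from the first
  \<open>T\<close> variables stop within \<open>i \<ge> T + D\<close> steps. Its closed set bounds
  the forced steps among those \<open>T\<close> by \<open>D\<close>; at most \<open>N\<close> more
  are lost near short cycles. Later steps are simply not counted.\<close>

lemma free_steps_ge_explore:
  assumes "2 \<le> k" "\<And>a. a < m \<Longrightarrow> card (C a) = k" "distinct xs" "set xs = {..<n}" "T \<le> n" "T + D \<le> i"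
    and "explore i {..<n} (set (take T xs)) {..<m} C < D"
    and "card {x. x < n \<and> near_cycle {..<m} C R x} < N"
  shows "T - D - N \<le> free_steps {..<m} C R xs {}"
proof -
  let ?ys = "take T xs"
  have "length xs = n" using distinct_card[OF assms(3)] assms(4) by simp
  then have len: "length ?ys = T" "distinct ?ys" "card (set ?ys) = T"
    using assms(3,5) distinct_card[of ?ys] by auto
  obtain K where K: "set ?ys \<subseteq> K" "closed_under {..<m} C K"
    "card {a \<in> {..<m}. C a \<subseteq> K} \<le> explore i {..<n} (set ?ys) {..<m} C"
    using explore_stops_closed[of "{..<m}" "set ?ys" C i "{..<n}"] assms(1,2,6,7) len(3) by auto
  have "forced_steps {..<m} C ?ys {} \<le> card {a \<in> {..<m}. C a \<subseteq> K}"
    by (rule forced_steps_le) (use assms(1,2) len K in auto)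
  then have forced: "forced_steps {..<m} C ?ys {} < D" using K(3) assms(7) by linarith
  have "card {x \<in> set ?ys. near_cycle {..<m} C R x} \<le> card {x. x < n \<and> near_cycle {..<m} C R x}"
    by (rule card_mono) (use assms(4) set_take_subset[of T xs] in auto)
  then have near: "card {x \<in> set ?ys. near_cycle {..<m} C R x} < N" using assms(8) by linarith
  have "T \<le> free_steps {..<m} C R ?ys {} + forced_steps {..<m} C ?ys {} +
      card {x \<in> set ?ys. near_cycle {..<m} C R x}"
    using free_steps_ge[OF len(2), of "{..<m}" C R "{}"] len(1) by simp
  then have "T - D - N \<le> free_steps {..<m} C R ?ys {}" using forced near by linarith
  also have "\<dots> \<le> free_steps {..<m} C R xs {}"
    using free_steps_append_ge[of "{..<m}" C R ?ys "{}" "drop T xs"] by simp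
  finally show ?thesis .
qed

definition success_prob :: "(rooted_xorsat \<Rightarrow> real) \<Rightarrow> nat \<Rightarrow> nat \<Rightarrow> nat \<Rightarrow> nat \<Rightarrow> real" where
  "success_prob \<tau> R k n m = measure_pmf.prob
     (do {
        \<Phi> \<leftarrow> random_xorsat k n m;
        \<sigma> \<leftarrow> DEC \<tau> R \<Phi>;
        return_pmf (\<Phi>, \<sigma>)
      })
     {(\<Phi>, \<sigma>). \<sigma> \<in> solutions \<Phi>}"

text \<open>Order and instance are independent, so they may be drawn in either order; it then
  suffices to bound the success for each fixed order.\<close>

lemma success_prob_le:
  assumes "k \<le> n" and xs: "\<And>xs. distinct xs \<Longrightarrow> set xs = {..<n} \<Longrightarrow>
    measure_pmf.expectation (random_xorsat k n m)
      (\<lambda>\<Phi>. measure_pmf.prob (dec_along \<tau> R xs \<Phi> (\<lambda>_. undefined)) (solutions \<Phi>)) \<le> B"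
  shows "success_prob \<tau> R k n m \<le> B"
proof -
  let ?M = "random_xorsat k n m"
  let ?O = "random_order n {..<n}"
  have "bind_pmf ?M (\<lambda>\<Phi>. bind_pmf (DEC \<tau> R \<Phi>) (\<lambda>\<sigma>. return_pmf (\<Phi>, \<sigma>)))
      = bind_pmf ?M (\<lambda>\<Phi>. bind_pmf ?O (\<lambda>xs. bind_pmf (dec_along \<tau> R xs \<Phi> (\<lambda>_. undefined)) (\<lambda>\<sigma>. return_pmf (\<Phi>, \<sigma>))))"
    by (intro bind_pmf_cong refl)
      (simp add: DEC_def decimate_eq_dec_along set_random_xorsat(1)[OF assms(1)] bind_assoc_pmf)
  also have "\<dots> = bind_pmf ?O (\<lambda>xs. bind_pmf ?M (\<lambda>\<Phi>. bind_pmf (dec_along \<tau> R xs \<Phi> (\<lambda>_. undefined)) (\<lambda>\<sigma>. return_pmf (\<Phi>, \<sigma>))))"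
    by (rule bind_commute_pmf)
  finally have eq: "success_prob \<tau> R k n m = measure_pmf.prob (bind_pmf ?O (\<lambda>xs. bind_pmf ?M
      (\<lambda>\<Phi>. bind_pmf (dec_along \<tau> R xs \<Phi> (\<lambda>_. undefined)) (\<lambda>\<sigma>. return_pmf (\<Phi>, \<sigma>))))) {(\<Phi>, \<sigma>). \<sigma> \<in> solutions \<Phi>}"
    unfolding success_prob_def by simp
  show ?thesis unfolding eq
  proof (rule measure_bind_pmf_le)
    fix xs assume "xs \<in> set_pmf ?O"
    then have d: "distinct xs" "set xs = {..<n}" using set_random_order[of "{..<n}" n xs] by auto
    show "measure_pmf.prob (bind_pmf ?M (\<lambda>\<Phi>. bind_pmf (dec_along \<tau> R xs \<Phi> (\<lambda>_. undefined))
        (\<lambda>\<sigma>. return_pmf (\<Phi>, \<sigma>)))) {(\<Phi>, \<sigma>). \<sigma> \<in> solutions \<Phi>} \<le> B"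
      using xs[OF d] unfolding measure_bind_pmf_eq[of ?M] map_pmf_def[symmetric]
      by (simp add: vimage_def)
  qed
qed

text \<open>The three terms: too many counted clauses, too many short cycles, and otherwise the
  expected number of solutions times the cost of the free steps. On the bad events success is
  bounded by one.\<close>

lemma success_prob_le_entropy:
  fixes \<rho> :: real
  assumes "exact_on_trees R \<tau>" "even R" "2 \<le> k" "k \<le> n" "m \<le> n" "i \<le> n" "T + D \<le> i"
    and "1 \<le> \<rho>" "0 < N"
  shows "success_prob \<tau> R k n m \<le> (clause_weight \<rho> n i k / real (n choose k)) ^ m / \<rho> ^ D
    + real (R * R * k ^ (2 * R)) / real N + 2 ^ n * (1 / 2) ^ m * (1 / 2) ^ (T - D - N)"
proof (rule success_prob_le[OF assms(4)])
  fix xs :: "nat list" assume xs: "distinct xs" "set xs = {..<n}"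
  let ?M = "random_xorsat k n m"
  let ?f = "\<lambda>\<Phi>. measure_pmf.prob (dec_along \<tau> R xs \<Phi> (\<lambda>_. undefined)) (solutions \<Phi>)"
  define B1 where "B1 = {C. D \<le> explore i {..<n} (set (take T xs)) {..<m} C}"
  define B2 where "B2 = {C. N \<le> card {x. x < n \<and> near_cycle {..<m} C R x}}"
  have int: "integrable ?M f" for f :: "xorsat \<Rightarrow> real"
    by (rule integrable_measure_pmf_finite) (rule finite_set_random_xorsat[OF assms(4)])
  have "measure_pmf.expectation ?M ?f \<le> measure_pmf.expectation ?M (\<lambda>\<Phi>.
      indicator (scopes -` B1) \<Phi> + indicator (scopes -` B2) \<Phi> + (1 / 2) ^ (T - D - N) * real (card (solutions \<Phi>)))"
  proof (rule integral_mono_AE[OF int int], rule AE_pmfI)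
    fix \<Phi> assume \<Phi>: "\<Phi> \<in> set_pmf ?M"
    show "?f \<Phi> \<le> indicator (scopes -` B1) \<Phi> + indicator (scopes -` B2) \<Phi> +
        (1 / 2) ^ (T - D - N) * real (card (solutions \<Phi>))"
    proof (cases "scopes \<Phi> \<in> B1 \<or> scopes \<Phi> \<in> B2")
      case True
      then have "1 \<le> indicator (scopes -` B1) \<Phi> + (indicator (scopes -` B2) \<Phi> :: real)"
        by (auto simp: indicator_def)
      moreover have "?f \<Phi> \<le> 1" by simp
      moreover have "0 \<le> (1 / 2) ^ (T - D - N) * real (card (solutions \<Phi>))" by simp
      ultimately show ?thesis by linarith
    next
      case False
      have "T - D - N \<le> free_steps {..<m} (scopes \<Phi>) R xs {}"
        by (rule free_steps_ge_explore[OF assms(3) _ xs _ assms(7)])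
          (use False set_random_xorsat(4)[OF assms(4) \<Phi>] assms(6,7) in \<open>auto simp: B1_def B2_def\<close>)
      then have "(1 / 2 :: real) ^ free_steps {..<m} (scopes \<Phi>) R xs {} \<le> (1 / 2) ^ (T - D - N)"
        by (intro power_decreasing) auto
      then have "?f \<Phi> \<le> real (card (solutions \<Phi>)) * (1 / 2) ^ (T - D - N)"
        using prob_dec_along_solutions_le[OF assms(1-4) \<Phi> xs, of "\<lambda>_. undefined"]
        by (meson mult_left_mono of_nat_0_le_iff order_trans)
      then show ?thesis using False by (simp add: mult.commute)
    qed
  qed
  also have "\<dots> = measure_pmf.prob (random_scopes k n m) B1 + measure_pmf.prob (random_scopes k n m) B2
      + (1 / 2) ^ (T - D - N) * measure_pmf.expectation ?M (\<lambda>\<Phi>. real (card (solutions \<Phi>)))"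
    unfolding map_scopes_random_xorsat[OF assms(4), symmetric] by (simp add: int)
  also have "\<dots> \<le> (clause_weight \<rho> n i k / real (n choose k)) ^ m / \<rho> ^ D
    + real (R * R * k ^ (2 * R)) / real N + (1 / 2) ^ (T - D - N) * (2 ^ n * (1 / 2) ^ m)"
    unfolding B1_def B2_def
    by (intro add_mono mult_left_mono prob_explore_ge_le prob_many_near_cycles_le expected_solutions_le)
      (use assms xs set_take_subset[of T xs] in auto)
  finally show "measure_pmf.expectation ?M ?f \<le> (clause_weight \<rho> n i k / real (n choose k)) ^ m / \<rho> ^ D
    + real (R * R * k ^ (2 * R)) / real N + 2 ^ n * (1 / 2) ^ m * (1 / 2) ^ (T - D - N)"
    by (simp add: mult_ac)
qed

text \<open>Success is at most the number of solutions, even if no step is free. Above density one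
  this already tends to zero.\<close>

lemma success_prob_le_expected_solutions:
  assumes "exact_on_trees R \<tau>" "even R" "2 \<le> k" "k \<le> n"
  shows "success_prob \<tau> R k n m \<le> 2 ^ n * (1 / 2) ^ m"
proof (rule success_prob_le[OF assms(4)])
  fix xs :: "nat list" assume xs: "distinct xs" "set xs = {..<n}"
  let ?M = "random_xorsat k n m"
  let ?f = "\<lambda>\<Phi>. measure_pmf.prob (dec_along \<tau> R xs \<Phi> (\<lambda>_. undefined)) (solutions \<Phi>)"
  have int: "integrable ?M f" for f :: "xorsat \<Rightarrow> real"
    by (rule integrable_measure_pmf_finite) (rule finite_set_random_xorsat[OF assms(4)])
  have "measure_pmf.expectation ?M ?f \<le> measure_pmf.expectation ?M (\<lambda>\<Phi>. real (card (solutions \<Phi>)))"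
  proof (rule integral_mono_AE[OF int int], rule AE_pmfI)
    fix \<Phi> assume \<Phi>: "\<Phi> \<in> set_pmf ?M"
    have "real (card (solutions \<Phi>)) * (1 / 2) ^ free_steps {..<m} (scopes \<Phi>) R xs {} \<le> real (card (solutions \<Phi>)) * 1"
      by (intro mult_left_mono) (auto simp: power_le_one)
    then show "?f \<Phi> \<le> real (card (solutions \<Phi>))"
      using prob_dec_along_solutions_le[OF assms(1-4) \<Phi> xs, of "\<lambda>_. undefined"] by linarith
  qed
  then show "measure_pmf.expectation ?M ?f \<le> 2 ^ n * (1 / 2) ^ m"
    using expected_solutions_le[OF assms(4), of m] by linarith
qed

lemma tendsto_floor_density:
  assumes "0 \<le> y"
  shows "(\<lambda>n. real (nat \<lfloor>y * real n\<rfloor>) / real n) \<longlonglongrightarrow> y"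
proof (rule tendsto_sandwich)
  show "(\<lambda>n. y - 1 / real n) \<longlonglongrightarrow> y"
    using tendsto_diff[OF tendsto_const[of y] lim_1_over_n] by simp
  have *: "real (nat \<lfloor>y * real n\<rfloor>) = of_int \<lfloor>y * real n\<rfloor>" for n
    using assms by simp
  show "\<forall>\<^sub>F n in sequentially. y - 1 / real n \<le> real (nat \<lfloor>y * real n\<rfloor>) / real n"
    using eventually_gt_at_top[of 0]
  proof eventually_elim
    case (elim n)
    have "y * real n - 1 \<le> real (nat \<lfloor>y * real n\<rfloor>)" unfolding * by linarith
    then have "(y * real n - 1) / real n \<le> real (nat \<lfloor>y * real n\<rfloor>) / real n" by (rule divide_right_mono) simp
    then show ?case using elim by (simp add: diff_divide_distrib)
  qed
  show "\<forall>\<^sub>F n in sequentially. real (nat \<lfloor>y * real n\<rfloor>) / real n \<le> y"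
    using eventually_gt_at_top[of 0]
  proof eventually_elim
    case (elim n)
    have "real (nat \<lfloor>y * real n\<rfloor>) \<le> y * real n" unfolding * by linarith
    then show ?case using elim by (simp add: field_simps)
  qed
qed auto

lemma exp_linear_tendsto_0:
  assumes "0 < (c :: real)"
  shows "(\<lambda>n. exp (b - c * real n)) \<longlonglongrightarrow> 0"
proof -
  have "(\<lambda>n. exp b * exp (- c) ^ n) \<longlonglongrightarrow> exp b * 0"
    by (intro tendsto_mult tendsto_const LIMSEQ_power_zero) (use assms in auto)
  moreover have "exp b * exp (- c) ^ n = exp (b - c * real n)" for n
    by (simp add: mult.commute flip: exp_of_nat_mult exp_add)
  ultimately show ?thesis by simp
qed

lemma two_power_le_exp:
  assumes "real n - real m \<le> x"
  shows "2 ^ n * (1 / 2 :: real) ^ m \<le> exp (x * ln 2)"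
proof -
  have "2 ^ n * (1 / 2 :: real) ^ m = exp (real n * ln 2) * exp (- (real m * ln 2))"
    by (simp add: exp_of_nat_mult exp_minus power_divide field_simps)
  also have "\<dots> = exp ((real n - real m) * ln 2)" by (simp add: algebra_simps flip: exp_add)
  also have "\<dots> \<le> exp (x * ln 2)" using assms by (simp add: mult_right_mono)
  finally show ?thesis .
qed

lemma success_prob_tendsto_0:
  assumes ex: "exact_on_trees R \<tau>" "even R" and k: "2 \<le> k"
    and y: "0 < y" "y < 1" "2 * r * almost_inside k y + (1 - y) < r" and r: "0 \<le> r" "r \<le> 1"
  shows "(\<lambda>n. success_prob \<tau> R k n (nat \<lfloor>r * real n\<rfloor>)) \<longlonglongrightarrow> 0"
proof -
  define g where "g = r * almost_inside k y"
  \<comment> \<open>The interval for \<open>\<theta>\<close> from \<open>1 - r + g\<close> to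
    \<open>y - g\<close> has length \<open>8 * \<epsilon>\<close>. Of the
    \<open>3 * \<epsilon>\<close> below \<open>\<theta>\<close>, one each goes to \<open>D\<close>
    and \<open>N\<close> and one remains as exponential decay. Of the \<open>5 * \<epsilon>\<close>
    above, one goes to \<open>D\<close> and the rest absorbs rounding.\<close>
  define \<epsilon> where "\<epsilon> = (r - (1 - y) - 2 * g) / 8"
  define \<theta> where "\<theta> = 1 - r + g + 3 * \<epsilon>"
  \<comment> \<open>Minimises the Chernoff exponent
    \<open>\<delta> * (\<delta> - \<epsilon> / 2)\<close>, with value
    \<open>- \<epsilon>\<^sup>2 / 16\<close>.\<close>
  define \<delta> where "\<delta> = \<epsilon> / 4"
  have g0: "0 \<le> g" using y r by (simp add: g_def almost_inside_def)
  have \<epsilon>0: "0 < \<epsilon>" using y(3) by (simp add: \<epsilon>_def g_def mult.assoc)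
  have \<epsilon>8: "8 * \<epsilon> = r - 1 + y - 2 * g" by (simp add: \<epsilon>_def)
  have \<theta>: "0 \<le> \<theta>" "\<theta> + g + 5 * \<epsilon> = y" using r g0 \<epsilon>0 \<epsilon>8 by (auto simp: \<theta>_def)
  have small: "g + \<epsilon> \<le> 1" "\<epsilon> \<le> 1" using \<theta> y \<epsilon>0 g0 by auto
  have \<delta>: "0 < \<delta>" "\<delta> \<le> 1" using \<epsilon>0 small by (auto simp: \<delta>_def)
  define i where "i = (\<lambda>n. nat \<lfloor>y * real n\<rfloor>)"
  define m where "m = (\<lambda>n. nat \<lfloor>r * real n\<rfloor>)"
  define T where "T = (\<lambda>n. nat \<lfloor>\<theta> * real n\<rfloor>)"
  define D where "D = (\<lambda>n. nat \<lceil>(g + \<epsilon>) * real n\<rceil>)"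
  define N where "N = (\<lambda>n. nat \<lceil>\<epsilon> * real n\<rceil>)"
  have i: "y * real n - 1 \<le> real (i n)" "real (i n) \<le> y * real n" for n
    using y by (auto simp: i_def)
  have m: "r * real n - 1 \<le> real (m n)" "real (m n) \<le> r * real n" for n
    using r by (auto simp: m_def)
  have T: "\<theta> * real n - 1 \<le> real (T n)" "real (T n) \<le> \<theta> * real n" for n
    using \<theta> by (auto simp: T_def)
  have D: "(g + \<epsilon>) * real n \<le> real (D n)" "real (D n) \<le> (g + \<epsilon>) * real n + 1" for n
    using g0 \<epsilon>0 by (auto simp: D_def)
  have N: "\<epsilon> * real n \<le> real (N n)" "real (N n) \<le> \<epsilon> * real n + 1" for n
    using \<epsilon>0 by (auto simp: N_def)
  have in_le: "i n \<le> n" "m n \<le> n" for n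
  proof -
    have "y * real n \<le> real n" "r * real n \<le> real n" using y r by (auto intro: mult_left_le_one_le)
    then show "i n \<le> n" "m n \<le> n" using i[of n] m[of n] by linarith+
  qed
  define p where "p = (\<lambda>n. (real (i n choose k) + real (i n choose (k - 1)) * (real n - real (i n))) / real (n choose k))"
  have "p \<longlonglongrightarrow> almost_inside k y"
    unfolding p_def i_def by (rule tendsto_almost_inside) (use tendsto_floor_density y k in auto)
  then have ev_p: "\<forall>\<^sub>F n in sequentially. p n < almost_inside k y + \<epsilon> / 2"
    by (rule order_tendstoD) (use \<epsilon>0 in simp)
  \<comment> \<open>The mean count is at most \<open>(g + \<epsilon> / 2) * n\<close>, while
    \<open>D\<close> is at least \<open>(g + \<epsilon>) * n\<close>.\<close>
  have tail: "(clause_weight (1 + \<delta>) n (i n) k / real (n choose k)) ^ m n / (1 + \<delta>) ^ D n \<le> exp (0 - \<epsilon>\<^sup>2 / 16 * real n)"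
    if n: "k \<le> n" and pn: "p n < almost_inside k y + \<epsilon> / 2" for n
  proof -
    have "real (n choose k) > 0" using n by simp
    then have cw: "clause_weight (1 + \<delta>) n (i n) k / real (n choose k) = 1 + \<delta> * p n"
      by (simp add: clause_weight_def p_def field_simps)
    have p0: "0 \<le> p n" using in_le[of n] by (simp add: p_def)
    have "(1 + \<delta> * p n) ^ m n \<le> exp (\<delta> * p n) ^ m n"
      by (intro power_mono exp_ge_add_one_self) (use \<delta> p0 in auto)
    also have "\<dots> = exp (\<delta> * (real (m n) * p n))" by (simp add: mult_ac flip: exp_of_nat_mult)
    also have "\<dots> \<le> exp (\<delta> * ((g + \<epsilon> / 2) * real n))"
    proof -
      have "real (m n) * p n \<le> (r * real n) * (almost_inside k y + \<epsilon> / 2)"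
        by (intro mult_mono) (use m[of n] pn p0 r in auto)
      also have "\<dots> = g * real n + r * (\<epsilon> / 2 * real n)" by (simp add: g_def algebra_simps)
      also have "\<dots> \<le> g * real n + 1 * (\<epsilon> / 2 * real n)"
        by (intro add_left_mono mult_right_mono) (use r \<epsilon>0 in auto)
      also have "\<dots> = (g + \<epsilon> / 2) * real n" by (simp add: algebra_simps)
      finally have "\<delta> * (real (m n) * p n) \<le> \<delta> * ((g + \<epsilon> / 2) * real n)"
        by (rule mult_left_mono) (use \<delta> in simp)
      then show ?thesis by simp
    qed
    finally have num: "(1 + \<delta> * p n) ^ m n \<le> exp (\<delta> * ((g + \<epsilon> / 2) * real n))" .
    have den: "exp ((\<delta> - \<delta>\<^sup>2) * ((g + \<epsilon>) * real n)) \<le> (1 + \<delta>) ^ D n"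
    proof -
      have "0 \<le> \<delta> - \<delta>\<^sup>2" using \<delta> by (simp add: power2_eq_square mult_left_le_one_le)
      then have "(\<delta> - \<delta>\<^sup>2) * ((g + \<epsilon>) * real n) \<le> (\<delta> - \<delta>\<^sup>2) * real (D n)"
        by (intro mult_left_mono D(1))
      also have "\<dots> \<le> ln (1 + \<delta>) * real (D n)"
        by (intro mult_right_mono ln_one_plus_pos_lower_bound) (use \<delta> in auto)
      finally have "exp ((\<delta> - \<delta>\<^sup>2) * ((g + \<epsilon>) * real n)) \<le> exp (real (D n) * ln (1 + \<delta>))"
        by (simp add: mult.commute)
      also have "\<dots> = (1 + \<delta>) ^ D n" using \<delta> by (simp add: exp_of_nat_mult)
      finally show ?thesis .
    qed
    have "(1 + \<delta> * p n) ^ m n / (1 + \<delta>) ^ D n \<le>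
        exp (\<delta> * ((g + \<epsilon> / 2) * real n)) / exp ((\<delta> - \<delta>\<^sup>2) * ((g + \<epsilon>) * real n))"
      by (intro frac_le num den) auto
    also have "\<dots> = exp (\<delta> * ((g + \<epsilon> / 2) * real n) - (\<delta> - \<delta>\<^sup>2) * ((g + \<epsilon>) * real n))"
      by (rule exp_diff[symmetric])
    also have "\<dots> \<le> exp (0 - \<epsilon>\<^sup>2 / 16 * real n)"
    proof -
      have "\<delta> * ((g + \<epsilon> / 2) * real n) - (\<delta> - \<delta>\<^sup>2) * ((g + \<epsilon>) * real n)
          = \<delta> * real n * (\<delta> * (g + \<epsilon>) - \<epsilon> / 2)"
        by (simp add: power2_eq_square algebra_simps)
      also have "\<dots> \<le> \<delta> * real n * (\<delta> * 1 - \<epsilon> / 2)"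
        by (intro mult_left_mono diff_right_mono) (use small \<delta> in auto)
      also have "\<dots> = 0 - \<epsilon>\<^sup>2 / 16 * real n" by (simp add: \<delta>_def power2_eq_square algebra_simps)
      finally show ?thesis by simp
    qed
    finally show ?thesis unfolding cw .
  qed
  have ev_n: "\<forall>\<^sub>F n in sequentially. 2 / (4 * \<epsilon>) \<le> real n" "\<forall>\<^sub>F n in sequentially. k \<le> n" "\<forall>\<^sub>F n in sequentially. 0 < n"
    using filterlim_real_sequentially by (auto simp: filterlim_at_top eventually_ge_at_top eventually_gt_at_top)
  define K where "K = real (R * R * k ^ (2 * R))"
  have bound: "\<forall>\<^sub>F n in sequentially. success_prob \<tau> R k n (m n) \<le>
      exp (0 - \<epsilon>\<^sup>2 / 16 * real n) + K / \<epsilon> * (1 / real n) + exp (4 * ln 2 - \<epsilon> * ln 2 * real n)"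
    using ev_p ev_n
  proof eventually_elim
    case (elim n)
    \<comment> \<open>Pays for rounding \<open>i\<close> down and \<open>D\<close> up, one unit
      each.\<close>
    have "2 \<le> 4 * \<epsilon> * real n" using elim(2) \<epsilon>0 by (simp add: field_simps)
    moreover have "\<theta> * real n + (g + \<epsilon>) * real n + 4 * \<epsilon> * real n = y * real n"
      unfolding \<theta>(2)[symmetric] by (simp add: algebra_simps)
    ultimately have "real (T n) + real (D n) \<le> real (i n)"
      using T(2)[of n] D(2)[of n] i(1)[of n] by linarith
    then have TD: "T n + D n \<le> i n" by linarith
    have "0 < \<epsilon> * real n" using \<epsilon>0 elim(4) by simp
    then have N0: "0 < N n" using N(1)[of n] by (metis less_le_trans of_nat_0_less_iff)
    have "success_prob \<tau> R k n (m n) \<le> (clause_weight (1 + \<delta>) n (i n) k / real (n choose k)) ^ m n / (1 + \<delta>) ^ D n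
        + real (R * R * k ^ (2 * R)) / real (N n) + 2 ^ n * (1 / 2) ^ m n * (1 / 2) ^ (T n - D n - N n)"
      by (rule success_prob_le_entropy[OF ex k elim(3) in_le(2) in_le(1) TD _ N0]) (use \<delta> in auto)
    moreover have "real (R * R * k ^ (2 * R)) / real (N n) \<le> K / \<epsilon> * (1 / real n)"
    proof -
      have "K / real (N n) \<le> K / (\<epsilon> * real n)"
        by (rule divide_left_mono) (use N(1)[of n] \<open>0 < \<epsilon> * real n\<close> N0 in \<open>auto simp: K_def\<close>)
      then show ?thesis by (simp add: K_def)
    qed
    \<comment> \<open>Rounding \<open>m\<close>, \<open>T\<close>, \<open>D\<close> and
      \<open>N\<close> costs one unit each, hence the \<open>4\<close>. Truncated subtraction can
      only enlarge the exponent of \<open>1 / 2\<close>, which helps.\<close>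
    moreover have "2 ^ n * (1 / 2) ^ m n * (1 / 2) ^ (T n - D n - N n) \<le> exp (4 * ln 2 - \<epsilon> * ln 2 * real n)"
    proof -
      have "real (T n) - real (D n) - real (N n) \<le> real (T n - D n - N n)" by linarith
      then have "real n - real (m n + (T n - D n - N n)) \<le>
          real n - (r * real n - 1) - (\<theta> * real n - 1) + ((g + \<epsilon>) * real n + 1) + (\<epsilon> * real n + 1)"
        using m(1)[of n] T(1)[of n] D(2)[of n] N(2)[of n] by linarith
      also have "\<dots> = 4 - \<epsilon> * real n" by (simp add: \<theta>_def algebra_simps)
      finally have "2 ^ n * (1 / 2 :: real) ^ (m n + (T n - D n - N n)) \<le> exp ((4 - \<epsilon> * real n) * ln 2)"
        by (rule two_power_le_exp)
      then show ?thesis by (simp add: power_add algebra_simps)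
    qed
    ultimately show ?case using tail[OF elim(3,1)] by linarith
  qed
  have "(\<lambda>n. exp (0 - \<epsilon>\<^sup>2 / 16 * real n) + K / \<epsilon> * (1 / real n) + exp (4 * ln 2 - \<epsilon> * ln 2 * real n))
      \<longlonglongrightarrow> 0 + K / \<epsilon> * 0 + 0"
    by (intro tendsto_add tendsto_mult tendsto_const lim_1_over_n exp_linear_tendsto_0) (use \<epsilon>0 in auto)
  then have "(\<lambda>n. exp (0 - \<epsilon>\<^sup>2 / 16 * real n) + K / \<epsilon> * (1 / real n) + exp (4 * ln 2 - \<epsilon> * ln 2 * real n))
      \<longlonglongrightarrow> 0" by simp
  from tendsto_sandwich[OF _ bound tendsto_const this]
  show ?thesis by (simp add: success_prob_def m_def)
qed

text \<open>Beyond density one there are more clauses than variables, and the expected number of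
  solutions alone decays exponentially.\<close>

lemma success_prob_tendsto_0_overconstrained:
  assumes ex: "exact_on_trees R \<tau>" "even R" and k: "2 \<le> k" and r: "1 < r"
  shows "(\<lambda>n. success_prob \<tau> R k n (nat \<lfloor>r * real n\<rfloor>)) \<longlonglongrightarrow> 0"
proof -
  have bound: "\<forall>\<^sub>F n in sequentially. success_prob \<tau> R k n (nat \<lfloor>r * real n\<rfloor>) \<le> exp (ln 2 - (r - 1) * ln 2 * real n)"
    using eventually_ge_at_top[of k]
  proof eventually_elim
    case (elim n)
    have "real n - real (nat \<lfloor>r * real n\<rfloor>) \<le> 1 - (r - 1) * real n"
      using r by (simp add: algebra_simps) linarith
    from two_power_le_exp[OF this] show ?case
      using success_prob_le_expected_solutions[OF ex k elim, of "nat \<lfloor>r * real n\<rfloor>"]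
      by (simp add: algebra_simps)
  qed
  have "(\<lambda>n. exp (ln 2 - (r - 1) * ln 2 * real n)) \<longlonglongrightarrow> 0"
    by (rule exp_linear_tendsto_0) (use r in simp)
  from tendsto_sandwich[OF _ bound tendsto_const this]
  show ?thesis by (simp add: success_prob_def)
qed

theorem theorem3:
  fixes k R :: nat and r r_sat :: real and \<tau> :: "rooted_xorsat \<Rightarrow> real"
  assumes "k \<ge> 13"
    and "is_r_sat k r_sat"
    and "r_core k < r" and "r < r_sat"
    and "even R"
    and "local_rule R \<tau>"
    and "exact_on_trees R \<tau>"
  shows "(\<lambda>n. measure_pmf.prob
             (do {
                \<Phi> \<leftarrow> random_xorsat k n (nat \<lfloor>r * real n\<rfloor>);
                \<sigma> \<leftarrow> DEC \<tau> R \<Phi>;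
                return_pmf (\<Phi>, \<sigma>)
              })
             {(\<Phi>, \<sigma>). \<sigma> \<in> solutions \<Phi>}) \<longlonglongrightarrow> 0"
proof -
  have k: "2 \<le> k" "real k > 0" using assms(1) by auto
  have "487 / 100 / real k \<le> r" using r_core_ge[OF assms(1)] assms(3) by linarith
  then have c: "487 / 100 \<le> real k * r" using k by (simp add: field_simps)
  then have "0 < real k * r" by linarith
  then have r0: "0 \<le> r" using k by (simp add: zero_less_mult_iff)
  have "(\<lambda>n. success_prob \<tau> R k n (nat \<lfloor>r * real n\<rfloor>)) \<longlonglongrightarrow> 0"
  proof (cases "r \<le> 1")
    case True
    then show ?thesis
      using overconstrained_density_exists[OF assms(1) c True]
        success_prob_tendsto_0[OF assms(7,5) k(1) _ _ _ r0 True] by blast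
  next
    case False
    then show ?thesis
      by (intro success_prob_tendsto_0_overconstrained assms k) simp
  qed
  then show ?thesis by (simp only: success_prob_def)
qed

end
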